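(* Let $\mathcal H$ be a separable Hilbert space and let $\mathcal H_1\subset\mathcal H_2\subset\cdots\subset\mathcal H$ be finite dimensional subspaces such that the orthogonal projections $P_n$ onto $\mathcal H_n$ converge strongly to $I$. For each $n\in\mathbb N$ let $\{e_1^{(n)},\dots,e_{k_n}^{(n)}\}$ be an orthonormal basis of $\mathcal H_n$. Let $$\Omega_1=\Big\{T:\operatorname{dom}(T)\to\mathcal H\ \Big|\ T\text{ selfadjoint},\ \widehat\sigma_e(T)\text{ convex},\ \bigcup_{n\in\mathbb N}\mathcal H_n\text{ is a core of }T\Big\}$$ and $$\Lambda_1=\{f_{i,j,n}\mid 1\le i,j\le k_n,\ n\in\mathbb N\},\qquad f_{i,j,n}(T)=\langle Te_i^{(n)},e_j^{(n)}\rangle .$$ Then $\operatorname{SCI}(\Omega_1,\Lambda_1,\sigma(\cdot))=1$.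
   Context: Essential spectrum: for an operator $T$ in $\mathcal H$, $\sigma_{e2}(T)=\{\lambda\in\mathbb C\mid \exists (x_k)\subset\operatorname{dom}(T):\ \|x_k\|=1\ \forall k,\ x_k\rightharpoonup 0,\ \|(T-\lambda)x_k\|\to0\}$. Extended essential spectrum of a selfadjoint $T$: $\widehat\sigma_e(T)\subset[-\infty,\infty]$ is $\sigma_{e2}(T)$ together with the point $+\infty$ if $T$ is unbounded above and the point $-\infty$ if $T$ is unbounded below; "convex" means convex as a subset of the extended real line $[-\infty,\infty]$. A computational problem is a quadruple $(\Omega,\Lambda,\Xi,\mathcal M)$ where $\Omega$ is a set (primary set), $\Lambda$ is a set of complex valued functions on $\Omega$ (evaluation set), $\mathcal M$ is a metric space and $\Xi:\Omega\to\mathcal M$ is a map (problem function). An (arithmetic) algorithm is a map $\Gamma:\Omega\to\mathcal M$ such that for each $T\in\Omega$ there exists a finite subset $\Lambda_\Gamma(T)\subset\Lambda$ such that (i) the action of $\Gamma$ on $T$ depends only on $\{f(T)\}_{f\in\Lambda_\Gamma(T)}$; (ii) for every $S\in\Omega$ with $f(T)=f(S)$ for all $f\in\Lambda_\Gamma(T)$ one has $\Lambda_\Gamma(S)=\Lambda_\Gamma(T)$; (iii) the action of $\Gamma$ on $T$ consists of performing only finitely many arithmetic operations on $\{f(T)\}_{f\in\Lambda_\Gamma(T)}$. A tower of algorithms of height $k$ is a family $\Gamma_{n_1,\dots,n_k}:\Omega\to\mathcal M$ of arithmetic algorithms such that $\Xi(T)=\lim_{n_k\to\infty}\cdots\lim_{n_1\to\infty}\Gamma_{n_1,\dots,n_k}(T)$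 in $\mathcal M$ for all $T\in\Omega$. The Solvability Complexity Index $\operatorname{SCI}(\Omega,\Lambda,\Xi,\mathcal M)$ is the smallest integer $k$ for which there exists a tower of algorithms of height $k$ that computes $\Xi$. $\operatorname{SCI}(\Omega,\Lambda,\sigma(\cdot))$ denotes the SCI for $\Xi(T)=\sigma(T)$ (the spectrum) and $\mathcal M$ the set of closed subsets of $\mathbb C$ with the Attouch-Wets metric $d_{\mathrm{AW}}(A,B)=\sum_{i=1}^\infty2^{-i}\min\{1,\sup_{|x|<i}|\operatorname{dist}(x,A)-\operatorname{dist}(x,B)|\}$.
   Formalization: The Hilbert space is assumed to have dimension at least 2; in dimension 0 or 1 the spectrum is found exactly by a single algorithm (height 0), so the SCI is 0 and the claim fails there. *)

theory Defs
  imports "HOL-Analysis.Analysis"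
begin

section \<open>Complex Hilbert spaces\<close>

text \<open>The inner product is linear in the first argument and antilinear in the second.\<close>

class complex_inner = real_normed_vector +
  fixes scaleC :: "complex \<Rightarrow> 'a \<Rightarrow> 'a"  (infixr "*\<^sub>C" 75)
    and cinner :: "'a \<Rightarrow> 'a \<Rightarrow> complex"
  assumes scaleC_add_right: "a *\<^sub>C (x + y) = a *\<^sub>C x + a *\<^sub>C y"
    and scaleC_add_left: "(a + b) *\<^sub>C x = a *\<^sub>C x + b *\<^sub>C x"
    and scaleC_scaleC: "a *\<^sub>C (b *\<^sub>C x) = (a * b) *\<^sub>C x"
    and scaleR_scaleC: "r *\<^sub>R x = complex_of_real r *\<^sub>C x"
    and cinner_commute: "cinner x y = cnj (cinner y x)"
    and cinner_add_left: "cinner (x + y) z = cinner x z + cinner y z"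
    and cinner_scaleC_left: "cinner (a *\<^sub>C x) y = a * cinner x y"
    and cinner_self: "cinner x x = complex_of_real ((norm x)\<^sup>2)"

class chilbert_space = complex_inner + complete_space

global_interpretation complex_vector:
  vector_space "scaleC :: complex \<Rightarrow> 'a \<Rightarrow> 'a::complex_inner"
  defines csubspace = complex_vector.subspace
    and cspan = complex_vector.span
proof
  fix a b :: complex and x y :: 'a
  show "a *\<^sub>C (x + y) = a *\<^sub>C x + a *\<^sub>C y" by (rule scaleC_add_right)
  show "(a + b) *\<^sub>C x = a *\<^sub>C x + b *\<^sub>C x" by (rule scaleC_add_left)
  show "a *\<^sub>C b *\<^sub>C x = (a * b) *\<^sub>C x" by (rule scaleC_scaleC)
  show "1 *\<^sub>C x = x" using scaleR_scaleC[of 1 x] by simp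
qed

definition orthonormal_basis :: "('h::complex_inner) set \<Rightarrow> nat \<Rightarrow> (nat \<Rightarrow> 'h) \<Rightarrow> bool" where
  "orthonormal_basis S k e \<longleftrightarrow>
     (\<forall>i\<in>{1..k}. \<forall>j\<in>{1..k}. cinner (e i) (e j) = (if i = j then 1 else 0)) \<and>
     cspan (e ` {1..k}) = S"

definition finite_dim_subspace :: "('h::complex_inner) set \<Rightarrow> bool" where
  "finite_dim_subspace S \<longleftrightarrow> csubspace S \<and> (\<exists>B. finite B \<and> S = cspan B)"

definition orth_proj :: "('h::complex_inner) set \<Rightarrow> 'h \<Rightarrow> 'h" where
  "orth_proj S x = (THE y. y \<in> S \<and> (\<forall>z\<in>S. cinner (x - y) z = 0))"


section \<open>Unbounded operators\<close>

text \<open>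
  An operator is a partial function; \<open>dom T\<close> is its domain and \<open>T\<cdot>x\<close> its value at
  a point \<open>x\<close> of the domain.
\<close>

type_synonym 'h oper = "'h \<Rightarrow> 'h option"

abbreviation oper_app :: "'h oper \<Rightarrow> 'h \<Rightarrow> 'h"  (infixl "\<cdot>" 90) where
  "T \<cdot> x \<equiv> the (T x)"

definition linear_oper :: "('h::complex_inner) oper \<Rightarrow> bool" where
  "linear_oper T \<longleftrightarrow> csubspace (dom T) \<and>
     (\<forall>x\<in>dom T. \<forall>y\<in>dom T. T \<cdot> (x + y) = T \<cdot> x + T \<cdot> y) \<and>
     (\<forall>c. \<forall>x\<in>dom T. T \<cdot> (c *\<^sub>C x) = c *\<^sub>C (T \<cdot> x))"

definition densely_defined :: "('h::complex_inner) oper \<Rightarrow> bool" where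
  "densely_defined T \<longleftrightarrow> closure (dom T) = UNIV"

text \<open>For densely defined \<open>T\<close> the vector \<open>z\<close> below is unique whenever it exists.\<close>

definition adjoint_oper :: "('h::complex_inner) oper \<Rightarrow> 'h oper" where
  "adjoint_oper T = (\<lambda>y.
     if \<exists>z. \<forall>x\<in>dom T. cinner (T \<cdot> x) y = cinner x z
     then Some (THE z. \<forall>x\<in>dom T. cinner (T \<cdot> x) y = cinner x z)
     else None)"

definition selfadjoint :: "('h::complex_inner) oper \<Rightarrow> bool" where
  "selfadjoint T \<longleftrightarrow> linear_oper T \<and> densely_defined T \<and> adjoint_oper T = T"

text \<open>A core of a closed operator: the closure of the restriction is the operator itself.\<close>

definition is_core :: "('h::complex_inner) set \<Rightarrow> 'h oper \<Rightarrow> bool" where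
  "is_core D T \<longleftrightarrow> D \<subseteq> dom T \<and> closure (Map.graph (T |` D)) = Map.graph T"

definition resolvent_set :: "('h::complex_inner) oper \<Rightarrow> complex set" where
  "resolvent_set T = {z. bij_betw (\<lambda>x. T \<cdot> x - z *\<^sub>C x) (dom T) UNIV \<and>
     (\<exists>C. \<forall>x\<in>dom T. norm x \<le> C * norm (T \<cdot> x - z *\<^sub>C x))}"

definition spectrum :: "('h::complex_inner) oper \<Rightarrow> complex set" where
  "spectrum T = - resolvent_set T"

definition weakly_null :: "(nat \<Rightarrow> 'h::complex_inner) \<Rightarrow> bool" where
  "weakly_null x \<longleftrightarrow> (\<forall>y. (\<lambda>k. cinner (x k) y) \<longlonglongrightarrow> 0)"

definition ess_spectrum2 :: "('h::complex_inner) oper \<Rightarrow> complex set" where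
  "ess_spectrum2 T = {z. \<exists>x. (\<forall>k. x k \<in> dom T) \<and> (\<forall>k. norm (x k) = 1) \<and> weakly_null x \<and>
     (\<lambda>k. norm (T \<cdot> x k - z *\<^sub>C x k)) \<longlonglongrightarrow> 0}"

text \<open>Semiboundedness refers to the quadratic form, which is real for selfadjoint \<open>T\<close>.\<close>

definition oper_bdd_above :: "('h::complex_inner) oper \<Rightarrow> bool" where
  "oper_bdd_above T \<longleftrightarrow> (\<exists>c. \<forall>x\<in>dom T. Re (cinner (T \<cdot> x) x) \<le> c * (norm x)\<^sup>2)"

definition oper_bdd_below :: "('h::complex_inner) oper \<Rightarrow> bool" where
  "oper_bdd_below T \<longleftrightarrow> (\<exists>c. \<forall>x\<in>dom T. c * (norm x)\<^sup>2 \<le> Re (cinner (T \<cdot> x) x))"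

text \<open>For selfadjoint \<open>T\<close> the set \<open>ess_spectrum2 T\<close> consists of real numbers.\<close>

definition ext_ess_spectrum :: "('h::complex_inner) oper \<Rightarrow> ereal set" where
  "ext_ess_spectrum T = {ereal r |r. complex_of_real r \<in> ess_spectrum2 T}
     \<union> {x. x = \<infinity> \<and> \<not> oper_bdd_above T} \<union> {x. x = -\<infinity> \<and> \<not> oper_bdd_below T}"

definition ereal_convex :: "ereal set \<Rightarrow> bool" where
  "ereal_convex S \<longleftrightarrow> (\<forall>x\<in>S. \<forall>y\<in>S. {x..y} \<subseteq> S)"


section \<open>Arithmetic algorithms, towers and the Solvability Complexity Index\<close>

text \<open>
  Complex numbers are handled through their real and imaginary parts. An arithmetic
  computation is a (possibly infinite) decision tree whose inner nodes compare two real
  arithmetic expressions in the available evaluations and whose leaves return a finite list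
  of complex numbers, given by expressions for their real and imaginary parts. A run
  must reach a leaf after finitely many steps and so performs only finitely many arithmetic
  operations and comparisons; their number may depend on the input.
\<close>

datatype 'f arith =
    ReEval 'f
  | ImEval 'f
  | RatConst rat
  | Add "'f arith" "'f arith"
  | Sub "'f arith" "'f arith"
  | Mul "'f arith" "'f arith"
  | Div "'f arith" "'f arith"

primrec arith_val :: "('f \<Rightarrow> complex) \<Rightarrow> 'f arith \<Rightarrow> real" where
  "arith_val v (ReEval f) = Re (v f)"
| "arith_val v (ImEval f) = Im (v f)"
| "arith_val v (RatConst q) = of_rat q"
| "arith_val v (Add a b) = arith_val v a + arith_val v b"
| "arith_val v (Sub a b) = arith_val v a - arith_val v b"
| "arith_val v (Mul a b) = arith_val v a * arith_val v b"
| "arith_val v (Div a b) = arith_val v a / arith_val v b"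

codatatype 'f prog =
    Return "('f arith \<times> 'f arith) list"
  | IfLeq "'f arith" "'f arith" "'f prog" "'f prog"

text \<open>
  \<open>runs v p F out\<close>: with the evaluations given by \<open>v\<close>, the program \<open>p\<close> halts with output
  \<open>out\<close>, and \<open>F\<close> is the set of evaluations that were read during this run.
\<close>

inductive runs :: "('f \<Rightarrow> complex) \<Rightarrow> 'f prog \<Rightarrow> 'f set \<Rightarrow> complex list \<Rightarrow> bool"
  for v :: "'f \<Rightarrow> complex" where
  Return: "runs v (Return es) (\<Union>(a, b)\<in>set es. set_arith a \<union> set_arith b)
             (map (\<lambda>(a, b). Complex (arith_val v a) (arith_val v b)) es)"
| Leq: "arith_val v a \<le> arith_val v b \<Longrightarrow> runs v p F out \<Longrightarrow>
          runs v (IfLeq a b p q) (set_arith a \<union> set_arith b \<union> F) out"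
| Greater: "\<not> arith_val v a \<le> arith_val v b \<Longrightarrow> runs v q F out \<Longrightarrow>
          runs v (IfLeq a b p q) (set_arith a \<union> set_arith b \<union> F) out"

text \<open>
  The parameter \<open>rep\<close> says which point of the metric space a finite list of computed complex
  numbers stands for. The input \<open>T\<close> is accessible to the program only through the values
  \<open>f T\<close> for \<open>f \<in> L T\<close>, where \<open>L\<close> plays the role of \<open>T \<mapsto> \<Lambda>\<^sub>\<Gamma>(T)\<close>.
\<close>

definition arithmetic_algorithm ::
  "'t set \<Rightarrow> ('t \<Rightarrow> complex) set \<Rightarrow> 'm metric \<Rightarrow> (complex list \<Rightarrow> 'm) \<Rightarrow> ('t \<Rightarrow> 'm) \<Rightarrow> bool" where
  "arithmetic_algorithm \<Omega> \<Lambda> M rep \<Gamma> \<longleftrightarrow>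
     \<Gamma> \<in> \<Omega> \<rightarrow> mspace M \<and>
     (\<exists>L. (\<forall>T\<in>\<Omega>. finite (L T) \<and> L T \<subseteq> \<Lambda>) \<and>
          (\<forall>T\<in>\<Omega>. \<forall>S\<in>\<Omega>. (\<forall>f\<in>L T. f T = f S) \<longrightarrow> \<Gamma> S = \<Gamma> T) \<and>
          (\<forall>T\<in>\<Omega>. \<forall>S\<in>\<Omega>. (\<forall>f\<in>L T. f T = f S) \<longrightarrow> L S = L T) \<and>
          (\<exists>p. \<forall>T\<in>\<Omega>. \<exists>F out. runs (\<lambda>f. f T) p F out \<and> F \<subseteq> L T \<and> \<Gamma> T = rep out))"

text \<open>
  \<open>iterated_limit M k G y\<close> states that
  \<open>y = lim\<^bsub>n\<^sub>k\<^esub> \<dots> lim\<^bsub>n\<^sub>1\<^esub> G [n\<^sub>1, \<dots>, n\<^sub>k]\<close> in \<open>M\<close>, all inner limits existing. For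
  \<open>k = 0\<close> no limit is taken.
\<close>

fun iterated_limit :: "'m metric \<Rightarrow> nat \<Rightarrow> (nat list \<Rightarrow> 'm) \<Rightarrow> 'm \<Rightarrow> bool" where
  "iterated_limit M 0 G y \<longleftrightarrow> G [] = y"
| "iterated_limit M (Suc k) G y \<longleftrightarrow>
     (\<exists>z. (\<forall>n. iterated_limit M k (\<lambda>ns. G (ns @ [n])) (z n)) \<and>
          limitin (mtopology_of M) z y sequentially)"

definition tower_of_algorithms ::
  "'t set \<Rightarrow> ('t \<Rightarrow> complex) set \<Rightarrow> ('t \<Rightarrow> 'm) \<Rightarrow> 'm metric \<Rightarrow> (complex list \<Rightarrow> 'm) \<Rightarrow>
   nat \<Rightarrow> (nat list \<Rightarrow> 't \<Rightarrow> 'm) \<Rightarrow> bool" where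
  "tower_of_algorithms \<Omega> \<Lambda> \<Xi> M rep k \<Gamma> \<longleftrightarrow>
     (\<forall>ns. length ns = k \<longrightarrow> arithmetic_algorithm \<Omega> \<Lambda> M rep (\<Gamma> ns)) \<and>
     (\<forall>T\<in>\<Omega>. iterated_limit M k (\<lambda>ns. \<Gamma> ns T) (\<Xi> T))"

text \<open>The value is \<open>\<infinity>\<close> if there is no tower of finite height.\<close>

definition SCI ::
  "'t set \<Rightarrow> ('t \<Rightarrow> complex) set \<Rightarrow> ('t \<Rightarrow> 'm) \<Rightarrow> 'm metric \<Rightarrow> (complex list \<Rightarrow> 'm) \<Rightarrow> enat" where
  "SCI \<Omega> \<Lambda> \<Xi> M rep = Inf {enat k |k. \<exists>\<Gamma>. tower_of_algorithms \<Omega> \<Lambda> \<Xi> M rep k \<Gamma>}"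


section \<open>The Attouch-Wets metric\<close>

text \<open>
  The supremum over \<open>{x. norm x < r}\<close>, truncated at \<open>1\<close>. The convention is
  \<open>dist(x, {}) = \<infinity>\<close>, so that the truncated supremum is \<open>1\<close> if exactly one of the sets is
  empty; this differs from the library convention \<open>infdist x {} = 0\<close>.
\<close>

definition aw_gap :: "real \<Rightarrow> complex set \<Rightarrow> complex set \<Rightarrow> real" where
  "aw_gap r A B = (if (A = {}) \<noteq> (B = {}) then 1
     else min 1 (SUP x\<in>ball 0 r. \<bar>infdist x A - infdist x B\<bar>))"

definition aw_dist :: "complex set \<Rightarrow> complex set \<Rightarrow> real" where
  "aw_dist A B = (\<Sum>i. (1 / 2) ^ Suc i * aw_gap (real (Suc i)) A B)"

definition aw_metric :: "complex set metric" where
  "aw_metric = metric ({A. closed A}, aw_dist)"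

lemma infdist_diff_bound:
  fixes A B :: "complex set"
  assumes "x \<in> ball 0 r"
  shows "\<bar>infdist x A - infdist x B\<bar> \<le> 2 * r + infdist 0 A + infdist 0 B"
proof -
  have "\<bar>infdist x A - infdist 0 A\<bar> \<le> dist x 0" "\<bar>infdist x B - infdist 0 B\<bar> \<le> dist x 0"
    by (rule infdist_triangle_abs)+
  moreover have "dist x 0 < r" using assms by simp
  moreover have "infdist 0 A \<ge> 0" "infdist 0 B \<ge> 0" by (simp_all add: infdist_nonneg)
  ultimately show ?thesis by linarith
qed

lemma bdd_above_infdist_diff:
  "bdd_above ((\<lambda>x. \<bar>infdist x A - infdist x B\<bar>) ` ball (0::complex) r)"
  by (rule bdd_aboveI2, rule infdist_diff_bound)

lemma infdist_diff_le_SUP: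
  assumes "x \<in> ball (0::complex) r"
  shows "\<bar>infdist x A - infdist x B\<bar> \<le> (SUP x\<in>ball 0 r. \<bar>infdist x A - infdist x B\<bar>)"
  using assms by (intro cSUP_upper bdd_above_infdist_diff)

lemma aw_gap_nonneg: "r > 0 \<Longrightarrow> 0 \<le> aw_gap r A B"
  using infdist_diff_le_SUP[of 0 r A B] by (auto simp: aw_gap_def)

lemma aw_gap_le_1: "aw_gap r A B \<le> 1"
  by (simp add: aw_gap_def)

lemma aw_gap_commute: "aw_gap r A B = aw_gap r B A"
  by (auto simp: aw_gap_def abs_minus_commute)

lemma aw_gap_self: "r > 0 \<Longrightarrow> aw_gap r A A = 0"
  by (simp add: aw_gap_def)

lemma aw_gap_triangle:
  assumes r: "r > 0"
  shows "aw_gap r A C \<le> aw_gap r A B + aw_gap r B C"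
proof -
  let ?S = "\<lambda>A B. SUP x\<in>ball (0::complex) r. \<bar>infdist x A - infdist x B\<bar>"
  have "?S A C \<le> ?S A B + ?S B C"
  proof (rule cSUP_least)
    show "ball (0::complex) r \<noteq> {}" using r by simp
    fix x :: complex assume x: "x \<in> ball 0 r"
    show "\<bar>infdist x A - infdist x C\<bar> \<le> ?S A B + ?S B C"
      using infdist_diff_le_SUP[OF x, of A B] infdist_diff_le_SUP[OF x, of B C] by linarith
  qed
  moreover have "0 \<le> ?S A B" "0 \<le> ?S B C"
    using r infdist_diff_le_SUP[of 0 r A B] infdist_diff_le_SUP[of 0 r B C] by auto
  ultimately have "min 1 (?S A C) \<le> min 1 (?S A B) + min 1 (?S B C)" by linarith
  moreover have "0 \<le> aw_gap r A B" "0 \<le> aw_gap r B C" "aw_gap r A C \<le> 1"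
    by (simp_all add: aw_gap_nonneg aw_gap_le_1 r)
  ultimately show ?thesis
    by (cases "A = {}"; cases "B = {}"; cases "C = {}") (auto simp: aw_gap_def)
qed

lemma summable_aw: "summable (\<lambda>i. (1 / 2) ^ Suc i * aw_gap (real (Suc i)) A B)"
proof (rule summable_comparison_test')
  show "summable (\<lambda>i. (1 / 2 :: real) ^ Suc i)"
    by (subst summable_Suc_iff) (simp add: summable_geometric)
  fix n :: nat
  show "norm ((1 / 2) ^ Suc n * aw_gap (real (Suc n)) A B) \<le> (1 / 2) ^ Suc n"
    using aw_gap_nonneg[of "real (Suc n)" A B] aw_gap_le_1[of "real (Suc n)" A B]
    by (simp add: abs_mult mult_left_le)
qed

lemma Metric_space_aw: "Metric_space {A. closed A} aw_dist"
proof
  fix A B :: "complex set"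
  have nn: "0 \<le> (1 / 2) ^ Suc i * aw_gap (real (Suc i)) A B" for i
    using aw_gap_nonneg[of "real (Suc i)" A B] by simp
  show "0 \<le> aw_dist A B"
    unfolding aw_dist_def using nn by (intro suminf_nonneg summable_aw)
  show "aw_dist A B = aw_dist B A"
    unfolding aw_dist_def by (simp add: aw_gap_commute)
  assume "A \<in> {A. closed A}" "B \<in> {A. closed A}"
  then have cl: "closed A" "closed B" by auto
  show "aw_dist A B = 0 \<longleftrightarrow> A = B"
  proof
    assume "A = B"
    then show "aw_dist A B = 0" by (simp add: aw_dist_def aw_gap_self)
  next
    assume "aw_dist A B = 0"
    then have z: "aw_gap (real (Suc i)) A B = 0" for i
      using suminf_eq_zero_iff[OF summable_aw, of A B] nn
      unfolding aw_dist_def by fastforce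
    then have e: "(A = {}) = (B = {})"
      by (metis aw_gap_def zero_neq_one)
    have eq: "infdist x A = infdist x B" for x
    proof -
      obtain i where "norm x < real i" using reals_Archimedean2 by blast
      then have x: "x \<in> ball 0 (real (Suc i))" by simp
      have "min 1 (SUP x\<in>ball (0::complex) (real (Suc i)). \<bar>infdist x A - infdist x B\<bar>) = 0"
        using z[of i] e by (simp add: aw_gap_def)
      then show ?thesis using infdist_diff_le_SUP[OF x, of A B] by linarith
    qed
    show "A = B"
    proof (cases "A = {}")
      case False
      with e have "B \<noteq> {}" by simp
      then show ?thesis
        using False cl in_closed_iff_infdist_zero[of A] in_closed_iff_infdist_zero[of B] eq
        by auto
    qed (use e in simp)
  qed
next
  fix A B C :: "complex set"
  have "aw_dist A C \<le> (\<Sum>i. (1 / 2) ^ Suc i * aw_gap (real (Suc i)) A B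
      + (1 / 2) ^ Suc i * aw_gap (real (Suc i)) B C)"
    unfolding aw_dist_def
  proof (intro suminf_le summable_add summable_aw)
    fix i :: nat
    show "(1 / 2) ^ Suc i * aw_gap (real (Suc i)) A C \<le> (1 / 2) ^ Suc i * aw_gap (real (Suc i)) A B
      + (1 / 2) ^ Suc i * aw_gap (real (Suc i)) B C"
      using aw_gap_triangle[of "real (Suc i)" A C B]
      unfolding distrib_left[symmetric] by (intro mult_left_mono) auto
  qed
  also have "\<dots> = aw_dist A B + aw_dist B C"
    unfolding aw_dist_def by (intro suminf_add[symmetric] summable_aw)
  finally show "aw_dist A C \<le> aw_dist A B + aw_dist B C" .
qed

lemma mspace_aw_metric [simp]: "mspace aw_metric = {A. closed A}"
  unfolding aw_metric_def by (rule Metric_space.mspace_metric[OF Metric_space_aw])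

lemma mdist_aw_metric [simp]: "mdist aw_metric = aw_dist"
  unfolding aw_metric_def by (rule Metric_space.mdist_metric[OF Metric_space_aw])


section \<open>The computational spectral problem\<close>

text \<open>A finite list of computed complex numbers stands for the finite (closed) set of its entries.\<close>

definition SCI_spectrum :: "('h::complex_inner) oper set \<Rightarrow> ('h oper \<Rightarrow> complex) set \<Rightarrow> enat" where
  "SCI_spectrum \<Omega> \<Lambda> = SCI \<Omega> \<Lambda> spectrum aw_metric set"

definition Omega1 :: "(nat \<Rightarrow> ('h::complex_inner) set) \<Rightarrow> 'h oper set" where
  "Omega1 H = {T. selfadjoint T \<and> ereal_convex (ext_ess_spectrum T) \<and> is_core (\<Union>n. H n) T}"

definition matrix_entry :: "(nat \<Rightarrow> nat \<Rightarrow> 'h::complex_inner) \<Rightarrow> nat \<Rightarrow> nat \<Rightarrow> nat \<Rightarrow> 'h oper \<Rightarrow> complex" where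
  "matrix_entry e i j n T = cinner (T \<cdot> e n i) (e n j)"

definition Lambda1 :: "(nat \<Rightarrow> nat) \<Rightarrow> (nat \<Rightarrow> nat \<Rightarrow> 'h::complex_inner) \<Rightarrow> ('h oper \<Rightarrow> complex) set" where
  "Lambda1 k e = {matrix_entry e i j n |i j n. i \<in> {1..k n} \<and> j \<in> {1..k n}}"

end

theory Submission
  imports Defs
begin

text \<open>
  One limit suffices. The \<open>n\<close>-th algorithm tests the points \<open>g\<close> of a rational grid and accepts
  \<open>g\<close> if \<open>\<parallel>P\<^sub>n(T - g)y\<parallel> \<le> 4/(n + 1) \<parallel>y\<parallel>\<close> for some vector \<open>y\<close> of a finite net in \<open>\<H>\<^sub>n\<close>, whose
  mesh is adapted to the size of the \<open>n\<close>-th matrix. Points of the spectrum are approximated because the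
  union of the \<open>\<H>\<^sub>n\<close> is a core. Conversely, if accepted points converge to a real \<open>\<lambda>\<close> outside the
  spectrum, the vectors \<open>y\<close> converge weakly to zero, since \<open>T - \<lambda>\<close> maps the core onto a dense set, and
  \<open>\<langle>Ty, y\<rangle>\<close> converges to \<open>\<lambda>\<close>. By convexity the extended essential spectrum lies strictly on one side of
  \<open>\<lambda>\<close>, so \<open>T\<close> is semibounded; a variational argument for a resolvent of \<open>T\<close> then produces a point of the
  essential spectrum on the other side.

  No algorithm is exact: for the operator given by the matrix with rows \<open>(t, 1)\<close> and \<open>(1, -t)\<close> on two
  orthonormal vectors all computable numbers are rational functions of \<open>t\<close> up to countably many case
  distinctions, whereas \<open>sqrt (1 + t\<^sup>2)\<close> is an eigenvalue.
\<close>

section \<open>Complex inner product spaces\<close>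

text \<open>An arithmetic program cannot diagonalise the matrix of a compression. Eigenvalues are
  therefore replaced by a test that needs only squares and one comparison, the squared residual of a
  rational trial vector. Accordingly the convergence proof speaks of unit vectors with small
  residual throughout, and extremal problems for \<open>norm (A z)\<close> and for quadratic forms
  stand in for the spectral theorem. The tolerance must absorb three errors: the residual 1/(n+1) of
  an approximate eigenvector of the compression, the rounding 1/(n+1) of the eigenvalue, and the
  rounding of the vector. The last is amplified by the norm of the matrix, which is unknown in
  advance; the program first searches for an integer bound, and this makes its decision tree
  infinite. The points at infinity count as members of \<open>ext_ess_spectrum\<close>, so an empty
  side of \<lambda> already yields a semibound on that side. Dimension at least two is forced: in
  dimension one a single matrix entry is the spectrum, and no limit is required.\<close>

lemmas scaleC_one = complex_vector.scale_one

lemma cinner_add_right: "cinner x (y + z) = cinner x y + cinner x z"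
  for x :: "'a::complex_inner"
  by (metis cinner_add_left cinner_commute complex_cnj_add)

lemma cinner_scaleC_right: "cinner x (a *\<^sub>C y) = cnj a * cinner x y"
  for x :: "'a::complex_inner"
  by (metis cinner_commute cinner_scaleC_left complex_cnj_mult)

lemma cinner_scaleR_left: "cinner (r *\<^sub>R x) y = of_real r * cinner x y"
  for x :: "'a::complex_inner"
  by (simp add: scaleR_scaleC cinner_scaleC_left)

lemma cinner_scaleR_right: "cinner x (r *\<^sub>R y) = of_real r * cinner x y"
  for x :: "'a::complex_inner"
  by (simp add: scaleR_scaleC cinner_scaleC_right)

lemma Re_cinner_self: "Re (cinner x x) = (norm x)\<^sup>2"
  by (simp add: cinner_self)

lemma norm_scaleC: "norm (a *\<^sub>C x) = cmod a * norm x" for x :: "'a::complex_inner"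
proof -
  have "complex_of_real ((norm (a *\<^sub>C x))\<^sup>2) = a * cnj a * complex_of_real ((norm x)\<^sup>2)"
    unfolding cinner_self[symmetric] by (simp add: cinner_scaleC_left cinner_scaleC_right)
  also have "\<dots> = complex_of_real ((cmod a * norm x)\<^sup>2)"
    by (simp only: complex_norm_square[symmetric] power_mult_distrib of_real_mult of_real_power)
  finally have "(norm (a *\<^sub>C x))\<^sup>2 = (cmod a * norm x)\<^sup>2"
    using of_real_eq_iff by blast
  then show ?thesis by (simp add: power2_eq_iff_nonneg)
qed

lemma cinner_diff_scaleC_left: "cinner (x - a *\<^sub>C y) z = cinner x z - a * cinner y z"
  for x :: "'a::complex_inner"
  using cinner_add_left[of "x - a *\<^sub>C y" "a *\<^sub>C y" z] by (simp add: cinner_scaleC_left)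

lemma cinner_diff_scaleC_right: "cinner z (x - a *\<^sub>C y) = cinner z x - cnj a * cinner z y"
  for x :: "'a::complex_inner"
  using cinner_add_right[of z "x - a *\<^sub>C y" "a *\<^sub>C y"] by (simp add: cinner_scaleC_right)

lemma cinner_Cauchy_Schwarz: "cmod (cinner x y) \<le> norm x * norm y"
  for x :: "'a::complex_inner"
proof (cases "y = 0")
  case True
  then show ?thesis using cinner_scaleC_right[of x 0 y] by simp
next
  case False
  define a where "a = cinner x y / of_real ((norm y)\<^sup>2)"
  have "cinner (x - a *\<^sub>C y) y = 0"
    using False by (simp add: cinner_diff_scaleC_left a_def cinner_self)
  then have "cinner (x - a *\<^sub>C y) (x - a *\<^sub>C y) = cinner x x - cnj a * cinner x y"
    unfolding cinner_diff_scaleC_right[of "x - a *\<^sub>C y"]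
    using cinner_commute[of y x] by (simp add: cinner_diff_scaleC_left a_def)
  also have "cnj a * cinner x y = of_real ((cmod (cinner x y))\<^sup>2 / (norm y)\<^sup>2)"
    unfolding a_def using complex_norm_square[of "cinner x y"] by (simp add: mult.commute)
  finally have "Re (cinner (x - a *\<^sub>C y) (x - a *\<^sub>C y)) = (norm x)\<^sup>2 - (cmod (cinner x y))\<^sup>2 / (norm y)\<^sup>2"
    by (simp add: cinner_self)
  then have "(cmod (cinner x y))\<^sup>2 / (norm y)\<^sup>2 \<le> (norm x)\<^sup>2"
    by (simp add: Re_cinner_self) (metis diff_ge_0_iff_ge zero_le_power2)
  then have "(cmod (cinner x y))\<^sup>2 \<le> (norm x * norm y)\<^sup>2"
    using False by (simp add: field_simps power_mult_distrib)
  then show ?thesis by (rule power2_le_imp_le) simp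
qed

text \<open>Real bilinearity suffices for all rules on limits, sums and differences; antilinearity
  in the second argument is kept apart in \<open>cinner_scaleC_right\<close>.\<close>

global_interpretation cinner: bounded_bilinear "cinner :: 'a::complex_inner \<Rightarrow> 'a \<Rightarrow> complex"
  by unfold_locales
    (auto simp: cinner_add_left cinner_add_right cinner_scaleR_left cinner_scaleR_right
      scaleR_conv_of_real intro!: exI[of _ 1] cinner_Cauchy_Schwarz)

global_interpretation scaleC: bounded_bilinear "scaleC :: complex \<Rightarrow> 'a::complex_inner \<Rightarrow> 'a"
  by unfold_locales
    (auto simp: scaleC_add_right scaleC_add_left scaleR_scaleC scaleC_scaleC norm_scaleC
      scaleR_conv_of_real mult.commute intro!: exI[of _ 1])

declare cinner.zero_left [simp] cinner.zero_right [simp]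
  scaleC.zero_left [simp] scaleC.zero_right [simp] scaleC_one [simp]

lemma Re_cinner_commute: "Re (cinner x y) = Re (cinner y x)" for x :: "'a::complex_inner"
  using arg_cong[OF cinner_commute[of x y], of Re] by simp

lemma Re_cinner_le: "Re (cinner x y) \<le> norm x * norm y" for x :: "'a::complex_inner"
  using complex_Re_le_cmod cinner_Cauchy_Schwarz order_trans by blast

lemma norm_add_square: "(norm (x + y))\<^sup>2 = (norm x)\<^sup>2 + 2 * Re (cinner x y) + (norm y)\<^sup>2"
  for x :: "'a::complex_inner"
  unfolding Re_cinner_self[symmetric]
  using Re_cinner_commute[of x y] by (simp add: cinner.add_left cinner.add_right)

lemma norm_diff_square: "(norm (x - y))\<^sup>2 = (norm x)\<^sup>2 - 2 * Re (cinner x y) + (norm y)\<^sup>2"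
  for x :: "'a::complex_inner"
  using norm_add_square[of x "- y"] by (simp add: cinner.minus_right)

lemma parallelogram:
  "(norm (x - y))\<^sup>2 = 2 * (norm x)\<^sup>2 + 2 * (norm y)\<^sup>2 - (norm (x + y))\<^sup>2"
  for x :: "'a::complex_inner"
  by (simp add: norm_add_square norm_diff_square)

lemma csubspace_closed_csum:
  "\<lbrakk>csubspace S; \<And>i. i \<in> I \<Longrightarrow> f i \<in> S\<rbrakk> \<Longrightarrow> sum f I \<in> S"
  by (rule complex_vector.subspace_sum)

lemma csubspace_scaleR: "csubspace S \<Longrightarrow> x \<in> S \<Longrightarrow> r *\<^sub>R x \<in> S"
  by (simp add: scaleR_scaleC complex_vector.subspace_scale)

lemma field_sum_of_halves_less: "a < c \<Longrightarrow> b < c \<Longrightarrow> a / 2 + b / 2 < c" for c :: real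
  by simp

text \<open>The minimiser of the distance from \<open>v\<close> exists by the parallelogram identity.\<close>

lemma orthogonal_to_closed_csubspace:
  fixes S :: "'a::chilbert_space set"
  assumes S: "csubspace S" "closed S" and v: "v \<notin> S"
  obtains w where "w \<noteq> 0" "\<And>x. x \<in> S \<Longrightarrow> cinner x w = 0"
proof -
  define d where "d = infdist v S"
  have S0: "0 \<in> S" using S(1) by (rule complex_vector.subspace_0)
  have d_le: "d \<le> norm (v - x)" if "x \<in> S" for x
    using infdist_le[OF that, of v] by (simp add: d_def dist_norm)
  have d0: "d \<ge> 0" by (simp add: d_def infdist_nonneg)
  have "\<exists>x\<in>S. norm (v - x) < d + 1 / real (Suc n)" for n
  proof -
    have "infdist v S < d + 1 / real (Suc n)" by (simp add: d_def)
    then show ?thesis using S0 infdist_notempty[of S v] cINF_less_iff[of S "dist v"]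
      by (metis bdd_belowI2 dist_norm empty_iff zero_le_dist)
  qed
  then obtain x where xS: "\<And>n. x n \<in> S" and xd: "\<And>n. norm (v - x n) < d + 1 / real (Suc n)"
    by metis
  \<comment> \<open>The midpoint of two members of S lies in S, hence at distance at least d from
    v.\<close>
  have key: "(norm (x m - x n))\<^sup>2 \<le> 2 * (norm (v - x m))\<^sup>2 + 2 * (norm (v - x n))\<^sup>2 - 4 * d\<^sup>2" for m n
  proof -
    have "(1/2) *\<^sub>R (x m + x n) \<in> S"
      using S(1) xS by (intro csubspace_scaleR complex_vector.subspace_add)
    then have "d \<le> norm (v - (1/2) *\<^sub>R (x m + x n))" by (rule d_le)
    moreover have "(v - x n) + (v - x m) = 2 *\<^sub>R (v - (1/2) *\<^sub>R (x m + x n))"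
      by (simp add: algebra_simps scaleR_2)
    ultimately have "2 * d \<le> norm ((v - x n) + (v - x m))" by simp
    then have "(2 * d)\<^sup>2 \<le> (norm ((v - x n) + (v - x m)))\<^sup>2" using d0 by (intro power_mono) auto
    then show ?thesis using parallelogram[of "v - x n" "v - x m"] by (simp add: power_mult_distrib)
  qed
  have sq: "(norm (v - x n))\<^sup>2 \<le> d\<^sup>2 + (2 * d + 1) / real (Suc n)" for n
  proof -
    have "(norm (v - x n))\<^sup>2 \<le> (d + 1 / real (Suc n))\<^sup>2" using xd[of n] by (intro power_mono) auto
    also have "\<dots> = d\<^sup>2 + 2 * d * (1 / real (Suc n)) + (1 / real (Suc n))\<^sup>2"
      by (simp add: power2_sum)
    also have "(1 / real (Suc n))\<^sup>2 \<le> 1 / real (Suc n)"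
      unfolding power2_eq_square by (rule mult_left_le_one_le) auto
    finally show ?thesis by (simp add: add_divide_distrib)
  qed
  have "Cauchy x"
  proof (rule metric_CauchyI)
    fix \<epsilon> :: real assume e: "\<epsilon> > 0"
    \<comment> \<open>Makes \<open>key\<close> and \<open>sq\<close> bound the squared gap by half
      of \<open>c / real (Suc m)\<close> plus half of \<open>c / real (Suc n)\<close>.\<close>
    define c where "c = 4 * (2 * d + 1)"
    have "(\<lambda>n. c / real (Suc n)) \<longlonglongrightarrow> 0" by (rule LIMSEQ_Suc) (rule lim_const_over_n)
    then have "\<forall>\<^sub>F n in sequentially. c / real (Suc n) < \<epsilon>\<^sup>2" using e by (intro order_tendstoD) auto
    then obtain N where N: "\<And>n. n \<ge> N \<Longrightarrow> c / real (Suc n) < \<epsilon>\<^sup>2" by (auto simp: eventually_sequentially)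
    have "dist (x m) (x n) < \<epsilon>" if "m \<ge> N" "n \<ge> N" for m n
    proof -
      have "(norm (x m - x n))\<^sup>2 \<le> c / real (Suc m) / 2 + c / real (Suc n) / 2"
      proof -
        have "c / real (Suc i) / 2 = 2 * ((2 * d + 1) / real (Suc i))" for i by (simp add: c_def field_simps)
        from this[of m] this[of n] show ?thesis using key[of m n] sq[of m] sq[of n] by linarith
      qed
      also have "\<dots> < \<epsilon>\<^sup>2" by (rule field_sum_of_halves_less) (rule N that)+
      finally show ?thesis using e by (simp add: dist_norm power2_less_imp_less)
    qed
    then show "\<exists>M. \<forall>m\<ge>M. \<forall>n\<ge>M. dist (x m) (x n) < \<epsilon>" by blast
  qed
  then obtain p where p: "x \<longlonglongrightarrow> p" using Cauchy_convergent convergentD by blast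
  have pS: "p \<in> S" using S(2) xS p by (rule closed_sequentially)
  have pd: "norm (v - p) \<le> d"
  proof (rule LIMSEQ_le)
    show "(\<lambda>n. norm (v - x n)) \<longlonglongrightarrow> norm (v - p)" by (intro tendsto_intros p)
    show "(\<lambda>n. d + 1 / real (Suc n)) \<longlonglongrightarrow> d"
      using tendsto_add[OF tendsto_const[of d] LIMSEQ_Suc[OF lim_1_over_n]] by simp
    show "\<exists>N. \<forall>n\<ge>N. norm (v - x n) \<le> d + 1 / real (Suc n)" using xd less_imp_le by blast
  qed
  define w where "w = v - p"
  have w0: "w \<noteq> 0" using pS v by (auto simp: w_def)
  have "cinner x w = 0" if x: "x \<in> S" for x
  proof (cases "x = 0")
    case False
    \<comment> \<open>With this coefficient w - a x is orthogonal to x. If a x were nonzero,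
      Pythagoras would put p + a x closer to v than p.\<close>
    define a where "a = cinner w x / of_real ((norm x)\<^sup>2)"
    have o: "cinner (w - a *\<^sub>C x) x = 0"
      using False by (simp add: cinner_diff_scaleC_left a_def cinner_self)
    have "p + a *\<^sub>C x \<in> S" using S(1) pS x
      by (intro complex_vector.subspace_add complex_vector.subspace_scale)
    from d_le[OF this] have "norm w \<le> norm (w - a *\<^sub>C x)"
      using pd by (simp add: w_def algebra_simps)
    then have "(norm w)\<^sup>2 \<le> (norm (w - a *\<^sub>C x))\<^sup>2" by (intro power_mono) auto
    moreover have "(norm w)\<^sup>2 = (norm (w - a *\<^sub>C x))\<^sup>2 + (norm (a *\<^sub>C x))\<^sup>2"
      using norm_add_square[of "w - a *\<^sub>C x" "a *\<^sub>C x"] o by (simp add: cinner_scaleC_right)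
    ultimately have "a *\<^sub>C x = 0" by simp
    then have "cinner w x = 0" using o False by auto
    then show ?thesis using cinner_commute[of x w] by simp
  qed simp
  with w0 show ?thesis by (rule that)
qed

section \<open>Selfadjoint operators\<close>

lemma orthogonal_to_dense:
  fixes z :: "'a::complex_inner"
  assumes "closure D = UNIV" "\<And>x. x \<in> D \<Longrightarrow> cinner x z = 0"
  shows "z = 0"
proof -
  have "z \<in> closure D" using assms(1) by simp
  then obtain x where x: "\<And>n. x n \<in> D" "x \<longlonglongrightarrow> z" using closure_sequential by metis
  have "(\<lambda>n. cinner (x n) z) \<longlonglongrightarrow> cinner z z" by (intro cinner.tendsto x(2) tendsto_const)
  then have "cinner z z = 0" using assms(2) x(1) by (simp add: LIMSEQ_const_iff)
  then show ?thesis by (simp add: cinner_self)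
qed

locale selfadjoint_oper =
  fixes T :: "('h::chilbert_space) oper"
  assumes selfadj: "selfadjoint T"
begin

section \<open>Domain, adjoint and closedness\<close>

lemma dom_csubspace: "csubspace (dom T)"
  using selfadj by (simp add: selfadjoint_def linear_oper_def)

lemma dom_dense: "closure (dom T) = UNIV"
  using selfadj by (simp add: selfadjoint_def densely_defined_def)

lemma app_add: "x \<in> dom T \<Longrightarrow> y \<in> dom T \<Longrightarrow> T \<cdot> (x + y) = T \<cdot> x + T \<cdot> y"
  using selfadj unfolding selfadjoint_def linear_oper_def by blast

lemma app_scaleC: "x \<in> dom T \<Longrightarrow> T \<cdot> (c *\<^sub>C x) = c *\<^sub>C (T \<cdot> x)"
  using selfadj unfolding selfadjoint_def linear_oper_def by blast

lemma app_scaleR: "x \<in> dom T \<Longrightarrow> T \<cdot> (c *\<^sub>R x) = c *\<^sub>R (T \<cdot> x)"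
  by (simp add: scaleR_scaleC app_scaleC)

lemmas dom_add = complex_vector.subspace_add[OF dom_csubspace]
  and dom_diff = complex_vector.subspace_diff[OF dom_csubspace]
  and dom_scaleC = complex_vector.subspace_scale[OF dom_csubspace]
  and dom_scaleR = csubspace_scaleR[OF dom_csubspace]
  and dom_0 = complex_vector.subspace_0[OF dom_csubspace]

lemma app_0: "T \<cdot> 0 = 0"
  using app_scaleC[OF dom_0, of 0] by simp

lemma app_diff: "x \<in> dom T \<Longrightarrow> y \<in> dom T \<Longrightarrow> T \<cdot> (x - y) = T \<cdot> x - T \<cdot> y"
  using app_add[of "x - y" y] by (simp add: dom_diff)

lemma app_sum: "(\<And>i. i \<in> I \<Longrightarrow> f i \<in> dom T) \<Longrightarrow> T \<cdot> (sum f I) = (\<Sum>i\<in>I. T \<cdot> f i)"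
proof (induction I rule: infinite_finite_induct)
  case (insert i I)
  then show ?case using app_add[of "f i" "sum f I"] csubspace_closed_csum[OF dom_csubspace, of I f]
    by simp
qed (simp_all add: app_0)

lemma adjoint_unique:
  assumes "\<And>x. x \<in> dom T \<Longrightarrow> cinner (T \<cdot> x) y = cinner x z"
    and "\<And>x. x \<in> dom T \<Longrightarrow> cinner (T \<cdot> x) y = cinner x z'"
  shows "z = z'"
  using orthogonal_to_dense[OF dom_dense, of "z - z'"] assms by (simp add: cinner.diff_right)

text \<open>As T is its own adjoint, the adjoint condition is a membership test for the domain.
  Everything that selfadjointness gives beyond symmetry, namely closedness and surjectivity of
  shifts, is drawn from this test.\<close>

lemma dom_adjointI:
  assumes z: "\<And>x. x \<in> dom T \<Longrightarrow> cinner (T \<cdot> x) y = cinner x z"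
  shows "y \<in> dom T" and "T \<cdot> y = z"
proof -
  have "(THE z. \<forall>x\<in>dom T. cinner (T \<cdot> x) y = cinner x z) = z"
  proof (rule the_equality)
    fix z' assume "\<forall>x\<in>dom T. cinner (T \<cdot> x) y = cinner x z'"
    then show "z' = z" using z by (intro adjoint_unique[of y]) auto
  qed (use z in blast)
  then have "adjoint_oper T y = Some z" unfolding adjoint_oper_def using z by auto
  moreover have "adjoint_oper T = T" using selfadj by (simp add: selfadjoint_def)
  ultimately have "T y = Some z" by simp
  then show "y \<in> dom T" "T \<cdot> y = z" by auto
qed

lemma symmetric:
  assumes "x \<in> dom T" "y \<in> dom T"
  shows "cinner (T \<cdot> x) y = cinner x (T \<cdot> y)"
proof -
  obtain w where w: "T y = Some w" using assms(2) by auto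
  have "adjoint_oper T = T" using selfadj by (simp add: selfadjoint_def)
  then have "adjoint_oper T y \<noteq> None" using w by simp
  then obtain z where z: "\<forall>x\<in>dom T. cinner (T \<cdot> x) y = cinner x z"
    unfolding adjoint_oper_def by (metis (mono_tags, lifting))
  then show ?thesis using dom_adjointI(2)[of y z] assms(1) by auto
qed

lemma closed_graph:
  assumes x: "\<And>n. x n \<in> dom T" "x \<longlonglongrightarrow> a" and y: "(\<lambda>n. T \<cdot> x n) \<longlonglongrightarrow> b"
  shows "a \<in> dom T" and "T \<cdot> a = b"
proof -
  have "cinner (T \<cdot> u) a = cinner u b" if u: "u \<in> dom T" for u
  proof (rule LIMSEQ_unique)
    show "(\<lambda>n. cinner (T \<cdot> u) (x n)) \<longlonglongrightarrow> cinner (T \<cdot> u) a"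
      by (intro cinner.tendsto tendsto_const x)
    show "(\<lambda>n. cinner (T \<cdot> u) (x n)) \<longlonglongrightarrow> cinner u b"
      unfolding symmetric[OF u x(1)] by (intro cinner.tendsto tendsto_const y)
  qed
  then show "a \<in> dom T" "T \<cdot> a = b" using dom_adjointI by blast+
qed

lemma Im_cinner_app: "x \<in> dom T \<Longrightarrow> Im (cinner (T \<cdot> x) x) = 0"
  using symmetric[of x x] cinner_commute[of "T \<cdot> x" x]
  by (metis cnj.simps(2) equal_neg_zero)

text \<open>The lower bound gives injectivity and, with the closed graph, a closed range. A vector
  orthogonal to the range passes the adjoint test and is an eigenvector at the conjugate point,
  which \<open>ker\<close> excludes.\<close>

lemma bij_shift:
  assumes c: "c > 0" and lb: "\<And>x. x \<in> dom T \<Longrightarrow> c * norm x \<le> norm (T \<cdot> x - z *\<^sub>C x)"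
    and ker: "\<And>x. x \<in> dom T \<Longrightarrow> T \<cdot> x = cnj z *\<^sub>C x \<Longrightarrow> x = 0"
  shows "bij_betw (\<lambda>x. T \<cdot> x - z *\<^sub>C x) (dom T) UNIV"
proof -
  let ?f = "\<lambda>x. T \<cdot> x - z *\<^sub>C x"
  let ?R = "?f ` dom T"
  have f_diff: "?f (x - y) = ?f x - ?f y" if "x \<in> dom T" "y \<in> dom T" for x y
    using that by (simp add: app_diff scaleC.diff_right algebra_simps)
  have dist_f: "c * norm (x - y) \<le> norm (?f x - ?f y)" if "x \<in> dom T" "y \<in> dom T" for x y
    using lb[OF dom_diff[OF that]] f_diff[OF that] by simp
  have inj: "inj_on ?f (dom T)"
  proof (rule inj_onI)
    fix x y assume "x \<in> dom T" "y \<in> dom T" "?f x = ?f y"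
    with dist_f[of x y] have "c * norm (x - y) \<le> 0" by simp
    with c show "x = y" by (simp add: mult_le_0_iff)
  qed
  have sub: "csubspace ?R"
  proof (rule complex_vector.subspaceI)
    show "0 \<in> ?R" using dom_0 app_0 by (intro image_eqI[of _ _ 0]) auto
  next
    fix u v assume "u \<in> ?R" "v \<in> ?R"
    then obtain x y where "x \<in> dom T" "y \<in> dom T" "u = ?f x" "v = ?f y" by blast
    then show "u + v \<in> ?R"
      by (intro image_eqI[of _ _ "x + y"]) (auto simp: app_add dom_add scaleC.add_right)
  next
    fix a u assume "u \<in> ?R"
    then obtain x where "x \<in> dom T" "u = ?f x" by blast
    then have "a *\<^sub>C u = ?f (a *\<^sub>C x)" "a *\<^sub>C x \<in> dom T"
      by (simp_all only: app_scaleC[of x] dom_scaleC scaleC.diff_right scaleC_scaleC mult.commute[of z])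
    then show "a *\<^sub>C u \<in> ?R" by (rule image_eqI)
  qed
  have cl: "closed ?R"
  proof (unfold closed_sequential_limits, intro allI impI)
    fix v l assume "(\<forall>n. v n \<in> ?R) \<and> v \<longlonglongrightarrow> l"
    then have v: "\<And>n. v n \<in> ?R" "v \<longlonglongrightarrow> l" by auto
    then have "\<exists>x. x \<in> dom T \<and> v n = ?f x" for n by blast
    then obtain x where x: "\<And>n. x n \<in> dom T" and vx: "\<And>n. v n = ?f (x n)"
      using choice[of "\<lambda>n x. x \<in> dom T \<and> v n = ?f x"] by blast
    have "Cauchy x"
    proof (rule metric_CauchyI)
      fix e :: real assume "e > 0"
      then have "c * e > 0" using c by simp
      moreover have "Cauchy v" using v(2) by (rule LIMSEQ_imp_Cauchy)
      ultimately obtain N where N: "\<And>m n. m \<ge> N \<Longrightarrow> n \<ge> N \<Longrightarrow> dist (v m) (v n) < c * e"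
        using metric_CauchyD by blast
      have "dist (x m) (x n) < e" if "m \<ge> N" "n \<ge> N" for m n
      proof -
        have "c * dist (x m) (x n) < c * e"
          using dist_f[OF x x, of m n] N[OF that] by (simp add: vx dist_norm)
        then show ?thesis using c by simp
      qed
      then show "\<exists>M. \<forall>m\<ge>M. \<forall>n\<ge>M. dist (x m) (x n) < e" by blast
    qed
    then obtain a where a: "x \<longlonglongrightarrow> a" using Cauchy_convergent convergentD by blast
    have "(\<lambda>n. v n + z *\<^sub>C x n) \<longlonglongrightarrow> l + z *\<^sub>C a"
      by (intro tendsto_add v scaleC.tendsto tendsto_const a)
    then have "(\<lambda>n. T \<cdot> x n) \<longlonglongrightarrow> l + z *\<^sub>C a" by (simp add: vx)
    from closed_graph[OF x a this] show "l \<in> ?R" by (intro image_eqI[of _ _ a]) auto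
  qed
  have "?R = UNIV"
  proof (rule ccontr)
    assume "?R \<noteq> UNIV"
    then obtain v where "v \<notin> ?R" by blast
    then obtain w where w: "w \<noteq> 0" "\<And>x. x \<in> ?R \<Longrightarrow> cinner x w = 0"
      using orthogonal_to_closed_csubspace[OF sub cl] by metis
    have "cinner (T \<cdot> x) w = cinner x (cnj z *\<^sub>C w)" if "x \<in> dom T" for x
      using w(2)[of "?f x"] that by (simp add: cinner_diff_scaleC_left cinner_scaleC_right)
    from dom_adjointI[OF this] have "w \<in> dom T" "T \<cdot> w = cnj z *\<^sub>C w" by simp_all
    with w(1) ker show False by simp
  qed
  with inj show ?thesis by (simp add: bij_betw_def)
qed

lemma in_resolvent_setI:
  assumes c: "c > 0" and lb: "\<And>x. x \<in> dom T \<Longrightarrow> c * norm x \<le> norm (T \<cdot> x - z *\<^sub>C x)"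
    and ker: "\<And>x. x \<in> dom T \<Longrightarrow> T \<cdot> x = cnj z *\<^sub>C x \<Longrightarrow> x = 0"
  shows "z \<in> resolvent_set T"
proof -
  have "norm x \<le> 1 / c * norm (T \<cdot> x - z *\<^sub>C x)" if "x \<in> dom T" for x
    using lb[OF that] c by (simp add: field_simps)
  then show ?thesis using bij_shift[OF assms] unfolding resolvent_set_def by blast
qed

text \<open>The form of T - z has imaginary part -(Im z) |x|^2, so T - z is bounded below by |Im z|.
  The bound is proved for every z' because the conjugate point is needed as well.\<close>

lemma spectrum_real:
  assumes "z \<in> spectrum T"
  shows "z \<in> \<real>"
proof (rule ccontr)
  assume "z \<notin> \<real>"
  then have nz: "Im z \<noteq> 0" by (simp add: complex_is_Real_iff)
  have lb: "\<bar>Im z'\<bar> * norm x \<le> norm (T \<cdot> x - z' *\<^sub>C x)" if x: "x \<in> dom T" for z' x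
  proof (cases "x = 0")
    case False
    have "Im (cinner (T \<cdot> x - z' *\<^sub>C x) x) = - (Im z' * (norm x)\<^sup>2)"
      by (simp add: cinner_diff_scaleC_left Im_cinner_app[OF x] cinner_self)
    then have "\<bar>Im z'\<bar> * (norm x)\<^sup>2 = \<bar>Im (cinner (T \<cdot> x - z' *\<^sub>C x) x)\<bar>"
      by (simp add: abs_mult)
    also have "\<dots> \<le> norm (T \<cdot> x - z' *\<^sub>C x) * norm x"
      using abs_Im_le_cmod cinner_Cauchy_Schwarz order_trans by blast
    finally have "(\<bar>Im z'\<bar> * norm x) * norm x \<le> norm (T \<cdot> x - z' *\<^sub>C x) * norm x"
      by (simp add: power2_eq_square mult.assoc)
    then show ?thesis using False by simp
  qed simp
  have "z \<in> resolvent_set T"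
  proof (rule in_resolvent_setI[of "\<bar>Im z\<bar>"])
    fix x assume "x \<in> dom T" "T \<cdot> x = cnj z *\<^sub>C x"
    with lb[of x "cnj z"] nz show "x = 0" by (simp add: mult_le_0_iff)
  qed (use nz lb in auto)
  with assms show False by (simp add: spectrum_def)
qed

text \<open>Weyl's criterion. A real l is its own conjugate, so one lower bound provides both
  conditions of \<open>in_resolvent_setI\<close>. Residuals of unit vectors are the form of the
  spectrum that a finite computation can approach.\<close>

lemma spectrum_iff_approx_eigenvalue:
  "complex_of_real l \<in> spectrum T \<longleftrightarrow>
    (\<forall>\<epsilon>>0. \<exists>x\<in>dom T. norm x = 1 \<and> norm (T \<cdot> x - l *\<^sub>R x) < \<epsilon>)" (is "?L \<longleftrightarrow> ?R")
proof
  assume L: ?L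
  show ?R
  proof (rule ccontr)
    assume "\<not> ?R"
    then obtain c where c: "c > 0"
      and lb1: "\<And>x. x \<in> dom T \<Longrightarrow> norm x = 1 \<Longrightarrow> c \<le> norm (T \<cdot> x - l *\<^sub>R x)"
      by (meson not_less)
    have lb: "c * norm x \<le> norm (T \<cdot> x - complex_of_real l *\<^sub>C x)" if x: "x \<in> dom T" for x
    proof (cases "x = 0")
      case False
      define y where "y = (1 / norm x) *\<^sub>R x"
      have "c \<le> norm (T \<cdot> y - l *\<^sub>R y)"
        using False x by (intro lb1) (auto simp: y_def dom_scaleR)
      also have "T \<cdot> y - l *\<^sub>R y = (1 / norm x) *\<^sub>R (T \<cdot> x - l *\<^sub>R x)"
        using x by (simp add: y_def app_scaleR algebra_simps)
      also have "norm ((1 / norm x) *\<^sub>R w) = norm w / norm x" for w :: 'h by simp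
      finally have "c * norm x \<le> norm (T \<cdot> x - l *\<^sub>R x)" using False by (subst (asm) pos_le_divide_eq) simp_all
      then show ?thesis by (simp only: scaleR_scaleC)
    qed simp
    have "complex_of_real l \<in> resolvent_set T"
    proof (rule in_resolvent_setI[OF c lb])
      fix x assume "x \<in> dom T" "T \<cdot> x = cnj (complex_of_real l) *\<^sub>C x"
      with lb[of x] c show "x = 0" by (simp add: mult_le_0_iff)
    qed
    with L show False by (simp add: spectrum_def)
  qed
next
  assume R: ?R
  show ?L
  proof (rule ccontr)
    assume "\<not> ?L"
    then obtain C where C: "\<And>x. x \<in> dom T \<Longrightarrow> norm x \<le> C * norm (T \<cdot> x - complex_of_real l *\<^sub>C x)"
      unfolding spectrum_def resolvent_set_def by auto
    \<comment> \<open>C may be nonpositive; a positive constant is needed for the division.\<close>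
    define D where "D = max C 1"
    have "1 / D > 0" by (simp add: D_def less_max_iff_disj)
    then obtain x where x: "x \<in> dom T" "norm x = 1" "norm (T \<cdot> x - l *\<^sub>R x) < 1 / D"
      using R by blast
    have "1 \<le> C * norm (T \<cdot> x - l *\<^sub>R x)" using C[OF x(1)] x(2) by (simp add: scaleR_scaleC)
    also have "\<dots> \<le> D * norm (T \<cdot> x - l *\<^sub>R x)" by (intro mult_right_mono) (auto simp: D_def)
    also have "\<dots> < 1" using x(3) \<open>1 / D > 0\<close> by (simp add: field_simps)
    finally show False by simp
  qed
qed

text \<open>Required because the points of the Attouch-Wets space are closed sets.\<close>

lemma closed_spectrum: "closed (spectrum T)"
proof (unfold closed_sequential_limits, intro allI impI, elim conjE)
  fix z a assume z: "\<forall>n. z n \<in> spectrum T" and lim: "z \<longlonglongrightarrow> a"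
  have "\<exists>r. z n = complex_of_real r" for n
    using spectrum_real[of "z n"] z by (auto elim: Reals_cases)
  then obtain r where r: "\<And>n. z n = complex_of_real (r n)" by metis
  have "a \<in> \<real>"
    by (rule closed_sequentially[OF closed_complex_Reals _ lim]) (simp add: r)
  then obtain l where l: "a = of_real l" by (auto elim: Reals_cases)
  have rl: "r \<longlonglongrightarrow> l" using tendsto_Re[OF lim] by (simp add: r l)
  have "of_real l \<in> spectrum T"
    unfolding spectrum_iff_approx_eigenvalue
  proof (intro allI impI)
    fix \<epsilon> :: real assume e: "\<epsilon> > 0"
    then have "\<epsilon> / 2 > 0" by simp
    from LIMSEQ_D[OF rl this] obtain n where n: "\<bar>r n - l\<bar> < \<epsilon> / 2" by (metis order_refl real_norm_def)
    obtain x where x: "x \<in> dom T" "norm x = 1" "norm (T \<cdot> x - r n *\<^sub>R x) < \<epsilon> / 2"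
      using z[rule_format, of n, unfolded r spectrum_iff_approx_eigenvalue, rule_format, of "\<epsilon> / 2"] e
      by auto
    have "T \<cdot> x - l *\<^sub>R x = (T \<cdot> x - r n *\<^sub>R x) + (r n - l) *\<^sub>R x" by (simp add: algebra_simps)
    then have "norm (T \<cdot> x - l *\<^sub>R x) \<le> norm (T \<cdot> x - r n *\<^sub>R x) + norm ((r n - l) *\<^sub>R x)"
      using norm_triangle_ineq by metis
    then have "norm (T \<cdot> x - l *\<^sub>R x) < \<epsilon>" using x n by simp
    with x show "\<exists>x\<in>dom T. norm x = 1 \<and> norm (T \<cdot> x - l *\<^sub>R x) < \<epsilon>" by blast
  qed
  then show "a \<in> spectrum T" by (simp add: l)
qed

end

section \<open>Approximate eigenvalues of bounded symmetric operators\<close>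

text \<open>
  Stated for \<open>y = B x\<close> and \<open>w = B y\<close> with \<open>B\<close> symmetric; the form of \<open>B\<close> need only be almost
  nonnegative at the single vector \<open>x - B x / C\<close>.
\<close>

lemma norm_le_almost_nonneg_form:
  fixes x y w :: "'a::complex_inner"
  assumes C: "C > 0" and w: "norm w \<le> C * norm y" and sym: "cinner w x = cinner y y"
    and form: "- \<kappa> \<le> Re (cinner (y - (1/C) *\<^sub>R w) (x - (1/C) *\<^sub>R y))"
  shows "(norm y)\<^sup>2 \<le> C * (Re (cinner y x) + \<kappa>)"
proof -
  have "Re (cinner (y - (1/C) *\<^sub>R w) (x - (1/C) *\<^sub>R y))
      = Re (cinner y x) - 2/C * (norm y)\<^sup>2 + (1/C)\<^sup>2 * Re (cinner w y)"
    by (simp add: cinner.diff_left cinner.diff_right cinner.scaleR_left cinner.scaleR_right sym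
        Re_cinner_self algebra_simps power2_eq_square)
  \<comment> \<open>The quadratic term of the expansion consumes at most half of the linear gain 2/C
    |y|^2.\<close>
  moreover have "(1/C)\<^sup>2 * Re (cinner w y) \<le> 1/C * (norm y)\<^sup>2"
  proof -
    have "Re (cinner w y) \<le> norm w * norm y" by (rule Re_cinner_le)
    also have "\<dots> \<le> C * norm y * norm y" by (intro mult_right_mono w) simp
    finally have "Re (cinner w y) \<le> C * (norm y)\<^sup>2" by (simp add: power2_eq_square mult.assoc)
    then have "(1/C)\<^sup>2 * Re (cinner w y) \<le> (1/C)\<^sup>2 * (C * (norm y)\<^sup>2)" by (rule mult_left_mono) simp
    also have "\<dots> = 1/C * (norm y)\<^sup>2" using C by (simp add: power2_eq_square)
    finally show ?thesis .
  qed
  ultimately have "1/C * (norm y)\<^sup>2 \<le> Re (cinner y x) + \<kappa>" using form by simp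
  then show ?thesis using C by (simp add: field_simps)
qed

text \<open>Relative to a subspace, so that it serves both resolvents, on the whole space, and
  compressions, on \<open>H n\<close>.\<close>

locale bounded_symmetric_on =
  fixes S :: "('h::complex_inner) set" and A :: "'h \<Rightarrow> 'h" and C :: real
  assumes subspace: "csubspace S"
    and maps: "x \<in> S \<Longrightarrow> A x \<in> S"
    and add: "x \<in> S \<Longrightarrow> y \<in> S \<Longrightarrow> A (x + y) = A x + A y"
    and scale: "x \<in> S \<Longrightarrow> A (c *\<^sub>C x) = c *\<^sub>C A x"
    and sym: "x \<in> S \<Longrightarrow> y \<in> S \<Longrightarrow> cinner (A x) y = cinner x (A y)"
    and C_pos: "C > 0"
    and bound: "x \<in> S \<Longrightarrow> norm (A x) \<le> C * norm x"
begin

lemma scaleR: "x \<in> S \<Longrightarrow> A (c *\<^sub>R x) = c *\<^sub>R A x"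
  by (simp add: scaleR_scaleC scale)

lemmas in_S = maps complex_vector.subspace_add[OF subspace] complex_vector.subspace_diff[OF subspace]
  csubspace_scaleR[OF subspace]

lemma diff: "x \<in> S \<Longrightarrow> y \<in> S \<Longrightarrow> A (x - y) = A x - A y"
  using add[of "x - y" y] in_S(3)[of x y] by simp

lemma shift: "bounded_symmetric_on S (\<lambda>x. A x - l *\<^sub>R x) (C + \<bar>l\<bar>)"
proof
  fix x assume x: "x \<in> S"
  show "norm (A x - l *\<^sub>R x) \<le> (C + \<bar>l\<bar>) * norm x"
    using norm_triangle_ineq4[of "A x" "l *\<^sub>R x"] bound[OF x] by (simp add: algebra_simps)
qed (use C_pos in \<open>auto simp: subspace in_S add scale sym scaleC_add_right scaleC.diff_right
    scaleC.scaleR_right scaleR_add_right cinner.diff_left cinner.diff_right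
    cinner.scaleR_left cinner.scaleR_right\<close>)

text \<open>The operator sg (A^2 - s^2) has a nonnegative form when s bounds
  \<open>norm (A z)\<close> on unit vectors from below (sg = 1) or from above (sg = -1), and its
  norm is at most C^2 + s^2. Hence \<open>norm_le_almost_nonneg_form\<close> without error applies:
  near extremisers are near kernel vectors.\<close>

lemma almost_extremal_square:
  assumes sg: "sg = 1 \<or> sg = -1"
    and ext: "\<And>z. z \<in> S \<Longrightarrow> 0 \<le> sg * ((norm (A z))\<^sup>2 - s\<^sup>2 * (norm z)\<^sup>2)"
    and x: "x \<in> S"
  shows "(norm (A (A x) - s\<^sup>2 *\<^sub>R x))\<^sup>2 \<le> (C\<^sup>2 + s\<^sup>2) * (sg * ((norm (A x))\<^sup>2 - s\<^sup>2 * (norm x)\<^sup>2))"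
proof -
  define B where "B z = sg *\<^sub>R (A (A z) - s\<^sup>2 *\<^sub>R z)" for z
  define D where "D = C\<^sup>2 + s\<^sup>2"
  have D: "D > 0" using C_pos by (simp add: D_def add_pos_nonneg)
  have B_form: "Re (cinner (B z) z) = sg * ((norm (A z))\<^sup>2 - s\<^sup>2 * (norm z)\<^sup>2)" if z: "z \<in> S" for z
    using sym[OF maps[OF z] z]
    by (simp add: B_def cinner.scaleR_left cinner.diff_left Re_cinner_self)
  have BS: "B z \<in> S" if "z \<in> S" for z using that unfolding B_def by (intro in_S)
  have B_sym: "cinner (B z) u = cinner z (B u)" if "z \<in> S" "u \<in> S" for z u
    using that sym[of "A z" u] sym[of z "A u"]
    by (simp add: B_def cinner.scaleR_left cinner.scaleR_right cinner.diff_left cinner.diff_right maps)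
  have B_bound: "norm (B z) \<le> D * norm z" if z: "z \<in> S" for z
  proof -
    have "norm (B z) = norm (A (A z) - s\<^sup>2 *\<^sub>R z)" using sg by (auto simp: B_def norm_minus_commute)
    also have "\<dots> \<le> norm (A (A z)) + s\<^sup>2 * norm z"
      using norm_triangle_ineq4[of "A (A z)" "s\<^sup>2 *\<^sub>R z"] by simp
    also have "norm (A (A z)) \<le> C * (C * norm z)"
      using order_trans[OF bound[OF maps[OF z]] mult_left_mono[OF bound[OF z], of C]] C_pos by simp
    finally show ?thesis by (simp add: D_def algebra_simps power2_eq_square)
  qed
  have B_lin: "B (x - (1/D) *\<^sub>R B x) = B x - (1/D) *\<^sub>R B (B x)"
  proof -
    have "B (u - c *\<^sub>R v) = B u - c *\<^sub>R B v" if "u \<in> S" "v \<in> S" for u v c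
      using that by (simp add: B_def diff scaleR in_S algebra_simps)
    then show ?thesis using x BS by blast
  qed
  have z: "x - (1/D) *\<^sub>R B x \<in> S" using x BS by (intro in_S)
  have "(norm (B x))\<^sup>2 \<le> D * (Re (cinner (B x) x) + 0)"
  proof (rule norm_le_almost_nonneg_form[OF D B_bound[OF BS[OF x]]])
    show "cinner (B (B x)) x = cinner (B x) (B x)" using B_sym BS x by blast
    show "- 0 \<le> Re (cinner (B x - (1 / D) *\<^sub>R B (B x)) (x - (1 / D) *\<^sub>R B x))"
      unfolding B_lin[symmetric] B_form[OF z] using ext[OF z] by simp
  qed
  moreover have "norm (B x) = norm (A (A x) - s\<^sup>2 *\<^sub>R x)" using sg by (auto simp: B_def norm_minus_commute)
  ultimately show ?thesis by (simp add: B_form[OF x] D_def)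
qed

text \<open>Factor A^2 - s^2 = (A - s)(A + s). Either x works for -s, or (A + s) x is longer than
  \<eta> and its normalisation works for s; normalising costs one factor \<eta>, hence the square in
  the hypothesis.\<close>

lemma approx_eigenvector_of_square:
  assumes x: "x \<in> S" "norm x = 1" and \<eta>: "\<eta> > 0"
    and sq: "norm (A (A x) - s\<^sup>2 *\<^sub>R x) \<le> \<eta>\<^sup>2"
  shows "\<exists>\<mu>\<in>{s, -s}. \<exists>u\<in>S. norm u = 1 \<and> norm (A u - \<mu> *\<^sub>R u) \<le> \<eta>"
proof (cases "norm (A x - (-s) *\<^sub>R x) \<le> \<eta>")
  case True
  then show ?thesis using x by blast
next
  case False
  define v where "v = A x + s *\<^sub>R x"
  have v: "v \<in> S" "norm v > \<eta>" using False x by (auto simp: v_def in_S)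
  have "A v - s *\<^sub>R v = A (A x) - s\<^sup>2 *\<^sub>R x"
    using x by (simp add: v_def add scaleR in_S algebra_simps power2_eq_square)
  then have n: "norm (A v - s *\<^sub>R v) \<le> \<eta>\<^sup>2" using sq by simp
  define u where "u = (1 / norm v) *\<^sub>R v"
  have u: "u \<in> S" "norm u = 1" using v \<eta> by (auto simp: u_def in_S)
  have "A u - s *\<^sub>R u = (1 / norm v) *\<^sub>R (A v - s *\<^sub>R v)"
    using v by (simp add: u_def scaleR algebra_simps)
  then have "norm (A u - s *\<^sub>R u) = norm (A v - s *\<^sub>R v) / norm v" by simp
  also have "\<dots> \<le> \<eta>\<^sup>2 / norm v" using n by (simp add: divide_right_mono)
  also have "\<dots> \<le> \<eta>\<^sup>2 / \<eta>" using v \<eta> by (intro divide_left_mono mult_pos_pos) auto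
  finally have "norm (A u - s *\<^sub>R u) \<le> \<eta>" using \<eta> by (simp add: power2_eq_square)
  with u show ?thesis by blast
qed

text \<open>The infimum s of \<open>norm (A z)\<close> over unit vectors is at most \<delta>, and
  near minimisers are approximate eigenvectors of A^2 at s^2. The residual can thus be made
  arbitrarily small while \<mu> stays within \<delta>.\<close>

lemma approx_eigenvalue_near_0:
  assumes x: "x \<in> S" "norm x = 1" and \<delta>: "norm (A x) \<le> \<delta>" and \<eta>: "\<eta> > 0"
  shows "\<exists>\<mu> u. \<bar>\<mu>\<bar> \<le> \<delta> \<and> u \<in> S \<and> norm u = 1 \<and> norm (A u - \<mu> *\<^sub>R u) \<le> \<eta>"
proof -
  define N where "N = {norm (A z) |z. z \<in> S \<and> norm z = 1}"
  define s where "s = Inf N"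
  have ne: "N \<noteq> {}" using x by (auto simp: N_def)
  have bdd: "bdd_below N" by (auto simp: N_def intro!: bdd_belowI[of _ 0])
  have s0: "s \<ge> 0" unfolding s_def using ne by (intro cInf_greatest) (auto simp: N_def)
  have "s \<le> norm (A x)" unfolding s_def using x bdd by (intro cInf_lower) (auto simp: N_def)
  then have s\<delta>: "s \<le> \<delta>" using \<delta> by simp
  have low: "s * norm z \<le> norm (A z)" if z: "z \<in> S" for z
  proof (cases "z = 0")
    case False
    have "s \<le> norm (A ((1 / norm z) *\<^sub>R z))"
      unfolding s_def using z bdd False by (intro cInf_lower) (auto simp: N_def in_S)
    also have "\<dots> = norm (A z) / norm z" using z by (simp add: scaleR)
    finally show ?thesis using False by (subst (asm) pos_le_divide_eq) simp_all
  qed simp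
  have ext: "0 \<le> 1 * ((norm (A z))\<^sup>2 - s\<^sup>2 * (norm z)\<^sup>2)" if z: "z \<in> S" for z
    using power_mono[OF low[OF z], of 2] s0 by (simp add: power_mult_distrib)
  \<comment> \<open>Solves (C^2 + s^2) \<kappa> = (\<eta>^2)^2, the accuracy that the factorisation
    demands.\<close>
  define \<kappa> where "\<kappa> = \<eta>^4 / (C\<^sup>2 + s\<^sup>2)"
  have D: "C\<^sup>2 + s\<^sup>2 > 0" using C_pos by (simp add: add_pos_nonneg)
  have \<kappa>: "\<kappa> > 0" using \<eta> D by (simp add: \<kappa>_def)
  have "s < sqrt (s\<^sup>2 + \<kappa>)" using s0 \<kappa> by (intro real_less_rsqrt) simp
  then have "\<exists>r\<in>N. r < sqrt (s\<^sup>2 + \<kappa>)" using cInf_lessD[OF ne, folded s_def] by blast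
  then obtain y where y: "y \<in> S" "norm y = 1" "norm (A y) < sqrt (s\<^sup>2 + \<kappa>)"
    by (auto simp: N_def)
  have "(norm (A y))\<^sup>2 < s\<^sup>2 + \<kappa>"
    using y(3) power_strict_mono[of "norm (A y)" "sqrt (s\<^sup>2 + \<kappa>)" 2] \<kappa> by (simp add: add_nonneg_nonneg)
  then have "(C\<^sup>2 + s\<^sup>2) * (1 * ((norm (A y))\<^sup>2 - s\<^sup>2 * (norm y)\<^sup>2)) \<le> (C\<^sup>2 + s\<^sup>2) * \<kappa>"
    using y D by (intro mult_left_mono) auto
  also have "\<dots> = (\<eta>\<^sup>2)\<^sup>2" using D C_pos by (simp add: \<kappa>_def)
  finally have "(norm (A (A y) - s\<^sup>2 *\<^sub>R y))\<^sup>2 \<le> (\<eta>\<^sup>2)\<^sup>2"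
    using almost_extremal_square[OF _ ext y(1)] by fastforce
  then have "norm (A (A y) - s\<^sup>2 *\<^sub>R y) \<le> \<eta>\<^sup>2" by (rule power2_le_imp_le) simp
  from approx_eigenvector_of_square[OF y(1,2) \<eta> this]
  obtain \<mu> u where "\<mu> \<in> {s, -s}" "u \<in> S" "norm u = 1" "norm (A u - \<mu> *\<^sub>R u) \<le> \<eta>" by blast
  moreover from this have "\<bar>\<mu>\<bar> \<le> \<delta>" using s0 s\<delta> by auto
  ultimately show ?thesis by blast
qed

text \<open>Purpose: a vector whose residual is merely below a fixed \<delta> leads to a nearby
  point that passes a test with an arbitrarily sharp tolerance \<eta>.\<close>

lemma approx_eigenvalue_near:
  assumes x: "x \<in> S" "norm x = 1" and \<delta>: "norm (A x - l *\<^sub>R x) \<le> \<delta>" and \<eta>: "\<eta> > 0"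
  shows "\<exists>\<mu> u. \<bar>\<mu> - l\<bar> \<le> \<delta> \<and> u \<in> S \<and> norm u = 1 \<and> norm (A u - \<mu> *\<^sub>R u) \<le> \<eta>"
proof -
  interpret A': bounded_symmetric_on S "\<lambda>x. A x - l *\<^sub>R x" "C + \<bar>l\<bar>" by (rule shift)
  obtain \<mu> u where "\<bar>\<mu>\<bar> \<le> \<delta>" "u \<in> S" "norm u = 1" "norm (A u - l *\<^sub>R u - \<mu> *\<^sub>R u) \<le> \<eta>"
    using A'.approx_eigenvalue_near_0[OF x \<delta> \<eta>] by blast
  then show ?thesis
    by (intro exI[of _ "l + \<mu>"] exI[of _ u]) (simp add: scaleR_add_left diff_diff_eq)
qed

text \<open>Here s is the supremum of \<open>norm (A z)\<close> over unit vectors, positive since A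
  is not zero. Each \<eta> yields s or -s; the choice may vary with \<eta>, but if each sign failed
  for some tolerance, both would fail for the smaller one.\<close>

lemma nonzero_approx_eigenvalue:
  assumes x: "x \<in> S" "A x \<noteq> 0"
  shows "\<exists>\<mu>. \<mu> \<noteq> 0 \<and> (\<forall>\<eta>>0. \<exists>u\<in>S. norm u = 1 \<and> norm (A u - \<mu> *\<^sub>R u) \<le> \<eta>)"
proof -
  define N where "N = {norm (A z) |z. z \<in> S \<and> norm z = 1}"
  define s where "s = Sup N"
  have x0: "x \<noteq> 0" using x scaleR[OF x(1), of 0] by auto
  have xN: "norm (A x) / norm x \<in> N"
    using x x0 by (auto simp: N_def scaleR in_S intro!: exI[of _ "(1 / norm x) *\<^sub>R x"])
  then have ne: "N \<noteq> {}" by auto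
  have bdd: "bdd_above N" using bound by (fastforce simp: N_def intro!: bdd_aboveI[of _ C])
  have "norm (A x) / norm x \<le> s" unfolding s_def by (rule cSup_upper[OF xN bdd])
  moreover have "norm (A x) / norm x > 0" using x x0 by simp
  ultimately have s0: "s > 0" by linarith
  have up: "norm (A z) \<le> s * norm z" if z: "z \<in> S" for z
  proof (cases "z = 0")
    case False
    have "norm (A z) / norm z = norm (A ((1 / norm z) *\<^sub>R z))" using z by (simp add: scaleR)
    also have "\<dots> \<le> s"
      unfolding s_def using z bdd False by (intro cSup_upper) (auto simp: N_def in_S)
    finally show ?thesis using False by (subst (asm) pos_divide_le_eq) simp_all
  qed (use scaleR[OF z, of 0] in simp)
  have ext: "0 \<le> (-1) * ((norm (A z))\<^sup>2 - s\<^sup>2 * (norm z)\<^sup>2)" if z: "z \<in> S" for z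
    using power_mono[OF up[OF z], of 2] by (simp add: power_mult_distrib)
  have "\<exists>\<mu>\<in>{s, -s}. \<exists>u\<in>S. norm u = 1 \<and> norm (A u - \<mu> *\<^sub>R u) \<le> \<eta>" if \<eta>: "\<eta> > 0" for \<eta>
  proof -
    have D: "C\<^sup>2 + s\<^sup>2 > 0" using C_pos by (simp add: add_pos_nonneg)
    \<comment> \<open>The second term of the minimum keeps s^2 - \<kappa> nonnegative under the
      root.\<close>
    define \<kappa> where "\<kappa> = min (\<eta>^4 / (C\<^sup>2 + s\<^sup>2)) (s\<^sup>2)"
    have \<kappa>: "\<kappa> > 0" "\<kappa> \<le> s\<^sup>2" using \<eta> D s0 by (auto simp: \<kappa>_def)
    have "sqrt (s\<^sup>2 - \<kappa>) < s" using s0 \<kappa> by (intro real_less_lsqrt) simp_all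
    then have "\<exists>r\<in>N. sqrt (s\<^sup>2 - \<kappa>) < r" using less_cSupD[OF ne, folded s_def] by blast
    then obtain y where y: "y \<in> S" "norm y = 1" "norm (A y) > sqrt (s\<^sup>2 - \<kappa>)"
      by (auto simp: N_def)
    have "(norm (A y))\<^sup>2 > s\<^sup>2 - \<kappa>"
      using y(3) power_strict_mono[of "sqrt (s\<^sup>2 - \<kappa>)" "norm (A y)" 2] \<kappa> by simp
    then have "(C\<^sup>2 + s\<^sup>2) * ((-1) * ((norm (A y))\<^sup>2 - s\<^sup>2 * (norm y)\<^sup>2)) \<le> (C\<^sup>2 + s\<^sup>2) * \<kappa>"
      using y D by (intro mult_left_mono) auto
    also have "\<dots> \<le> (C\<^sup>2 + s\<^sup>2) * (\<eta>^4 / (C\<^sup>2 + s\<^sup>2))"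
      using D by (intro mult_left_mono) (auto simp: \<kappa>_def)
    also have "\<dots> = (\<eta>\<^sup>2)\<^sup>2" using D C_pos by simp
    finally have "(norm (A (A y) - s\<^sup>2 *\<^sub>R y))\<^sup>2 \<le> (\<eta>\<^sup>2)\<^sup>2"
      using almost_extremal_square[OF _ ext y(1)] by fastforce
    then have "norm (A (A y) - s\<^sup>2 *\<^sub>R y) \<le> \<eta>\<^sup>2" by (rule power2_le_imp_le) simp
    from approx_eigenvector_of_square[OF y(1,2) \<eta> this] show ?thesis .
  qed
  note either = this
  define P where "P \<mu> \<eta> \<longleftrightarrow> (\<exists>u\<in>S. norm u = 1 \<and> norm (A u - \<mu> *\<^sub>R u) \<le> \<eta>)" for \<mu> \<eta>
  have "(\<forall>\<eta>>0. P s \<eta>) \<or> (\<forall>\<eta>>0. P (-s) \<eta>)"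
  proof (rule ccontr)
    assume "\<not> ?thesis"
    then obtain a b where ab: "a > 0" "\<not> P s a" "b > 0" "\<not> P (-s) b" by blast
    then have "P s (min a b) \<or> P (-s) (min a b)" using either[of "min a b"] by (auto simp: P_def)
    moreover have "P \<mu> a" "P \<mu> b" if "P \<mu> (min a b)" for \<mu> using that by (auto simp: P_def)
    ultimately show False using ab by blast
  qed
  then show ?thesis using s0 by (auto simp: P_def intro: exI[of _ s] exI[of _ "-s"])
qed

end

section \<open>Exhaustion by finite dimensional subspaces\<close>

lemma weakly_nullI_dense:
  fixes x :: "nat \<Rightarrow> 'a::complex_inner"
  assumes D: "closure D = UNIV" and C: "\<And>k. norm (x k) \<le> C"
    and lim: "\<And>y. y \<in> D \<Longrightarrow> (\<lambda>k. cinner (x k) y) \<longlonglongrightarrow> 0"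
  shows "weakly_null x"
  unfolding weakly_null_def
proof
  fix y :: 'a
  show "(\<lambda>k. cinner (x k) y) \<longlonglongrightarrow> 0"
  proof (rule LIMSEQ_I)
    fix \<epsilon> :: real assume e: "\<epsilon> > 0"
    have C0: "C \<ge> 0" using C[of 0] norm_ge_zero order_trans by blast
    define d where "d = \<epsilon> / 2 / (C + 1)"
    have d: "d > 0" using e C0 by (simp add: d_def)
    have "y \<in> closure D" using D by simp
    then obtain u where u: "u \<in> D" "dist u y < d" using d closure_approachable by blast
    obtain N where N: "\<And>k. k \<ge> N \<Longrightarrow> norm (cinner (x k) u) < \<epsilon> / 2"
      using LIMSEQ_D[OF lim[OF u(1)], of "\<epsilon> / 2"] e by auto
    have "norm (cinner (x k) y - 0) < \<epsilon>" if k: "k \<ge> N" for k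
    proof -
      have "cmod (cinner (x k) (y - u)) \<le> norm (x k) * norm (y - u)" by (rule cinner_Cauchy_Schwarz)
      also have "\<dots> \<le> C * d"
        using C[of k] u(2) C0 by (intro mult_mono) (auto simp: dist_norm norm_minus_commute)
      also have "\<dots> \<le> \<epsilon> / 2" using C0 e by (simp add: d_def field_simps)
      finally have "cmod (cinner (x k) (y - u)) \<le> \<epsilon> / 2" .
      moreover have "cinner (x k) y = cinner (x k) u + cinner (x k) (y - u)"
        by (simp add: cinner.diff_right)
      ultimately show ?thesis
        using N[OF k] norm_triangle_ineq[of "cinner (x k) u" "cinner (x k) (y - u)"] by simp
    qed
    then show "\<exists>N. \<forall>k\<ge>N. norm (cinner (x k) y - 0) < \<epsilon>" by blast
  qed
qed

locale exhaustion =
  fixes H :: "nat \<Rightarrow> ('h::chilbert_space) set" and k :: "nat \<Rightarrow> nat" and e :: "nat \<Rightarrow> nat \<Rightarrow> 'h"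
  assumes H_subspace: "\<And>n. csubspace (H n)"
    and H_Suc: "\<And>n. H n \<subseteq> H (Suc n)"
    and H_limit: "\<And>x. (\<lambda>n. orth_proj (H n) x) \<longlonglongrightarrow> x"
    and H_basis: "\<And>n. orthonormal_basis (H n) (k n) (e n)"
begin

text \<open>The projection in coordinates, where linearity and finite rank are evident;
  \<open>orth_proj_eq\<close> identifies it with the projection of the hypotheses.\<close>

definition P :: "nat \<Rightarrow> 'h \<Rightarrow> 'h" where
  "P n x = (\<Sum>i\<in>{1..k n}. cinner x (e n i) *\<^sub>C e n i)"

lemma H_mono: "m \<le> n \<Longrightarrow> H m \<subseteq> H n"
  using H_Suc lift_Suc_mono_le[of H] by blast

lemma e_inner: "i \<in> {1..k n} \<Longrightarrow> j \<in> {1..k n} \<Longrightarrow> cinner (e n i) (e n j) = (if i = j then 1 else 0)"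
  using H_basis unfolding orthonormal_basis_def by blast

lemma e_in_H: "i \<in> {1..k n} \<Longrightarrow> e n i \<in> H n"
  using H_basis[of n] complex_vector.span_superset[of "e n ` {1..k n}"]
  unfolding orthonormal_basis_def by blast

lemma sum_e_in_H: "(\<Sum>i\<in>{1..k n}. c i *\<^sub>C e n i) \<in> H n"
  using H_subspace e_in_H
  by (intro csubspace_closed_csum complex_vector.subspace_scale) auto

lemma P_in_H: "P n x \<in> H n"
  unfolding P_def by (rule sum_e_in_H)

lemma cinner_sum_e:
  "j \<in> {1..k n} \<Longrightarrow> cinner (\<Sum>i\<in>{1..k n}. c i *\<^sub>C e n i) (e n j) = c j"
  by (simp add: cinner.sum_left cinner_scaleC_left e_inner if_distrib[of "(*) _"] sum.delta'
      cong: if_cong)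

lemma cinner_P_e: "j \<in> {1..k n} \<Longrightarrow> cinner (P n x) (e n j) = cinner x (e n j)"
  unfolding P_def by (rule cinner_sum_e)

lemma orthogonal_H:
  assumes "\<And>j. j \<in> {1..k n} \<Longrightarrow> cinner x (e n j) = 0" and z: "z \<in> H n"
  shows "cinner x z = 0"
proof -
  have "csubspace {z. cinner x z = 0}"
    by (rule complex_vector.subspaceI) (auto simp: cinner.add_right cinner_scaleC_right)
  moreover have "e n ` {1..k n} \<subseteq> {z. cinner x z = 0}" using assms by auto
  ultimately have "cspan (e n ` {1..k n}) \<subseteq> {z. cinner x z = 0}"
    by (intro complex_vector.span_minimal)
  then show ?thesis using H_basis[of n] z unfolding orthonormal_basis_def by blast
qed

lemma cinner_P: "z \<in> H n \<Longrightarrow> cinner (P n x) z = cinner x z"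
  using orthogonal_H[of n "P n x - x" z] by (simp add: cinner_P_e cinner.diff_left)

lemma cinner_P_right: "z \<in> H n \<Longrightarrow> cinner z (P n x) = cinner z x"
  using cinner_P[of z n x] by (metis cinner_commute)

lemma P_unique:
  assumes "y \<in> H n" "\<And>z. z \<in> H n \<Longrightarrow> cinner (x - y) z = 0"
  shows "y = P n x"
proof -
  have d: "y - P n x \<in> H n" using assms P_in_H H_subspace by (intro complex_vector.subspace_diff)
  have "cinner (y - P n x) (y - P n x) = 0"
    using assms(2)[OF d] cinner_P[OF d, of x] by (simp add: cinner.diff_left)
  then show ?thesis by (simp add: cinner_self)
qed

lemma orth_proj_eq: "orth_proj (H n) x = P n x"
  unfolding orth_proj_def
  by (rule the_equality) (auto simp: P_in_H cinner.diff_left cinner_P intro: P_unique)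

lemma P_tendsto: "(\<lambda>n. P n x) \<longlonglongrightarrow> x"
  using H_limit[of x] by (simp add: orth_proj_eq)

lemma P_id: "x \<in> H n \<Longrightarrow> P n x = x"
  using P_unique[of x n x] by simp

lemma P_diff: "P n (x - y) = P n x - P n y"
  by (simp add: P_def cinner.diff_left scaleC.diff_left sum_subtractf)

lemma P_add: "P n (x + y) = P n x + P n y"
  by (simp add: P_def cinner.add_left scaleC_add_left sum.distrib)

lemma P_scaleC: "P n (c *\<^sub>C x) = c *\<^sub>C P n x"
  by (simp add: P_def cinner_scaleC_left scaleC.sum_right scaleC_scaleC)

lemma P_scaleR: "P n (c *\<^sub>R x) = c *\<^sub>R P n x"
  by (simp add: scaleR_scaleC P_scaleC)

lemma norm_P: "norm (P n x) \<le> norm x"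
proof (cases "P n x = 0")
  case False
  have "(norm (P n x))\<^sup>2 = Re (cinner x (P n x))"
    unfolding Re_cinner_self[symmetric] using cinner_P[OF P_in_H] by simp
  also have "\<dots> \<le> norm x * norm (P n x)" by (rule Re_cinner_le)
  finally show ?thesis using False by (simp add: power2_eq_square)
qed simp

lemma P_P: "m \<le> n \<Longrightarrow> P m (P n x) = P m x"
proof -
  assume "m \<le> n"
  then have "cinner (P n x) (e m i) = cinner x (e m i)" if "i \<in> {1..k m}" for i
    using cinner_P e_in_H[OF that] H_mono by blast
  then show ?thesis unfolding P_def[of m] by (intro sum.cong) simp_all
qed

text \<open>Nested subspaces see more and more of x. This makes the sets \<open>V N\<close> of the
  variational argument decrease.\<close>

lemma norm_P_mono: "m \<le> n \<Longrightarrow> norm (P m x) \<le> norm (P n x)"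
  using norm_P[of m "P n x"] by (simp add: P_P)

lemma dense_Union_H: "closure (\<Union>n. H n) = UNIV"
proof -
  have "x \<in> closure (\<Union>n. H n)" for x
    unfolding closure_sequential using P_in_H P_tendsto by (intro exI[of _ "\<lambda>n. P n x"]) auto
  then show ?thesis by blast
qed

text \<open>Finite rank turns weak convergence into norm convergence.\<close>

lemma weakly_null_P:
  assumes "weakly_null x"
  shows "(\<lambda>j. P n (x j)) \<longlonglongrightarrow> 0"
proof -
  have "(\<lambda>j. \<Sum>i\<in>{1..k n}. cinner (x j) (e n i) *\<^sub>C e n i) \<longlonglongrightarrow> (\<Sum>i\<in>{1..k n}. 0 *\<^sub>C e n i)"
    using assms unfolding weakly_null_def by (intro tendsto_sum scaleC.tendsto tendsto_const) auto
  then show ?thesis by (simp add: P_def)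
qed

lemma weakly_nullI_P:
  assumes "\<And>j. norm (x j) \<le> C" "\<And>n. (\<lambda>j. P n (x j)) \<longlonglongrightarrow> 0"
  shows "weakly_null x"
proof (rule weakly_nullI_dense[OF dense_Union_H assms(1)])
  fix y assume "y \<in> (\<Union>n. H n)"
  then obtain n where "y \<in> H n" by blast
  then show "(\<lambda>j. cinner (x j) y) \<longlonglongrightarrow> 0"
    using cinner.tendsto[OF assms(2)[of n] tendsto_const[of y]] by (simp add: cinner_P)
qed

text \<open>
  Let \<open>a N\<close> be the supremum of the form over the unit vectors that are almost orthogonal to \<open>H N\<close>.
  Almost maximisers form a weakly null sequence, and \<open>M - A\<close> has an asymptotically nonnegative form
  along weakly null sequences, where \<open>M\<close> is the limit of \<open>a\<close>.
\<close>

lemma ess_upper_end: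
  fixes A :: "'h \<Rightarrow> 'h"
  assumes "bounded_symmetric_on UNIV A C"
    and y: "\<And>j. norm (y j) = 1" "weakly_null y"
    and \<beta>: "\<And>\<epsilon>. \<epsilon> > 0 \<Longrightarrow> \<forall>\<^sub>F j in sequentially. \<beta> - \<epsilon> \<le> Re (cinner (A (y j)) (y j))"
  shows "\<exists>M z. \<beta> \<le> M \<and> (\<forall>j. norm (z j) = 1) \<and> weakly_null z \<and>
    (\<lambda>j. A (z j) - M *\<^sub>R z j) \<longlonglongrightarrow> 0"
proof -
  interpret A: bounded_symmetric_on UNIV A C by (rule assms(1))
  define q where "q u = Re (cinner (A u) u)" for u
  \<comment> \<open>Exact orthogonality to \<open>H N\<close> would exclude the given sequence y; a
    tolerance that shrinks with N admits its tail and still forces weak convergence to zero.\<close>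
  define V where "V N = {u. norm u = 1 \<and> norm (P N u) \<le> 1 / real (Suc N)}" for N
  define a where "a N = Sup (q ` V N)" for N
  have q_le: "\<bar>q u\<bar> \<le> C * (norm u)\<^sup>2" for u
  proof -
    have "\<bar>q u\<bar> \<le> norm (A u) * norm u"
      unfolding q_def by (rule order_trans[OF abs_Re_le_cmod cinner_Cauchy_Schwarz])
    also have "\<dots> \<le> C * norm u * norm u" by (intro mult_right_mono A.bound) auto
    finally show ?thesis by (simp add: power2_eq_square mult.assoc)
  qed
  have q_scale: "q (r *\<^sub>R u) = r\<^sup>2 * q u" for r u
    by (simp add: q_def A.scaleR cinner.scaleR_left cinner.scaleR_right power2_eq_square)
  have bdd: "bdd_above (q ` V N)" for N
  proof (rule bdd_aboveI2)
    fix u assume "u \<in> V N"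
    then show "q u \<le> C" using q_le[of u] by (simp add: V_def)
  qed
  have y_in: "\<forall>\<^sub>F j in sequentially. y j \<in> V N" for N
  proof -
    have "(\<lambda>j. norm (P N (y j))) \<longlonglongrightarrow> 0" by (rule tendsto_norm_zero[OF weakly_null_P[OF y(2)]])
    then have "\<forall>\<^sub>F j in sequentially. norm (P N (y j)) < 1 / real (Suc N)"
      by (rule order_tendstoD) simp
    then show ?thesis by eventually_elim (auto simp: V_def y(1))
  qed
  have ne: "V N \<noteq> {}" for N using eventually_happens'[OF sequentially_bot y_in[of N]] by blast
  have a_upper: "q u \<le> a N" if "u \<in> V N" for u N
    unfolding a_def using that bdd by (intro cSup_upper) auto
  have V_anti: "V n \<subseteq> V m" if "m \<le> n" for m n
  proof -
    have "1 / real (Suc n) \<le> 1 / real (Suc m)" using that by (simp add: frac_le)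
    then show ?thesis using norm_P_mono[OF that] unfolding V_def by (smt (verit) Collect_mono)
  qed
  have "decseq a"
    unfolding decseq_def a_def using V_anti ne bdd by (intro allI impI cSup_subset_mono) auto
  have a_ge: "\<beta> \<le> a N" for N
  proof (rule field_le_epsilon)
    fix \<epsilon> :: real assume "\<epsilon> > 0"
    from \<beta>[OF this] y_in[of N]
    have "\<forall>\<^sub>F j in sequentially. \<beta> - \<epsilon> \<le> a N"
    proof eventually_elim
      case (elim j)
      then show ?case using a_upper[of "y j" N] by (simp add: q_def)
    qed
    then show "\<beta> \<le> a N + \<epsilon>" by simp
  qed
  then have "\<exists>M. a \<longlonglongrightarrow> M \<and> (\<forall>N. M \<le> a N)"
    using decseq_convergent[OF \<open>decseq a\<close>, of \<beta>] by blast
  then obtain M where M: "a \<longlonglongrightarrow> M" and M_le: "\<And>N. M \<le> a N" by blast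
  have "\<beta> \<le> M" using M a_ge by (intro LIMSEQ_le_const[OF M]) auto
  have "\<exists>u\<in>V N. a N - 1 / real (Suc N) < q u" for N
    using less_cSupD[of "q ` V N" "a N - 1 / real (Suc N)"] ne[of N] by (auto simp: a_def[symmetric])
  then obtain z where zV: "\<And>N. z N \<in> V N" and zq: "\<And>N. a N - 1 / real (Suc N) < q (z N)" by metis
  have z1: "norm (z N) = 1" for N using zV by (simp add: V_def)
  have inv_0: "(\<lambda>N. 1 / real (Suc N)) \<longlonglongrightarrow> 0" using LIMSEQ_Suc[OF lim_1_over_n] by simp
  have Pz: "(\<lambda>N. P n (z N)) \<longlonglongrightarrow> 0" for n
  proof (rule Lim_null_comparison[OF _ inv_0])
    show "\<forall>\<^sub>F N in sequentially. norm (P n (z N)) \<le> 1 / real (Suc N)"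
      using eventually_ge_at_top[of n]
    proof eventually_elim
      case (elim N)
      then have "norm (P n (z N)) \<le> norm (P N (z N))" by (rule norm_P_mono)
      also have "\<dots> \<le> 1 / real (Suc N)" using zV[of N] by (simp add: V_def)
      finally show ?case .
    qed
  qed
  have z_null: "weakly_null z" using z1 Pz by (intro weakly_nullI_P[of z 1]) auto
  have q_lim: "(\<lambda>N. q (z N)) \<longlonglongrightarrow> M"
  proof (rule tendsto_sandwich[of "\<lambda>N. a N - 1 / real (Suc N)" _ _ a])
    show "(\<lambda>N. a N - 1 / real (Suc N)) \<longlonglongrightarrow> M" using tendsto_diff[OF M inv_0] by simp
  qed (use zq a_upper zV M in \<open>auto intro!: always_eventually less_imp_le\<close>)
  define D where "D = C + \<bar>M\<bar>"
  define B where "B u = M *\<^sub>R u - A u" for u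
  have D: "D > 0" using A.C_pos by (simp add: D_def)
  have B_bound: "norm (B u) \<le> D * norm u" for u
    using norm_triangle_ineq4[of "M *\<^sub>R u" "A u"] A.bound[of u] by (simp add: B_def D_def algebra_simps)
  \<comment> \<open>The test vector of \<open>norm_le_almost_nonneg_form\<close> for B; symmetry of
    B makes it weakly null again.\<close>
  define w where "w N = z N - (1 / D) *\<^sub>R B (z N)" for N
  have w_norm: "norm (w N) \<le> 2" for N
  proof -
    have "norm (w N) \<le> norm (z N) + 1 / D * norm (B (z N))"
      unfolding w_def using norm_triangle_ineq4[of "z N" "(1 / D) *\<^sub>R B (z N)"] D by simp
    also have "\<dots> \<le> 1 + 1 / D * D"
      using B_bound[of "z N"] z1[of N] D by (intro add_mono mult_left_mono) auto
    finally show ?thesis using D by simp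
  qed
  have w_null: "weakly_null w"
    unfolding weakly_null_def
  proof
    fix v
    have "cinner (w N) v = cinner (z N) (v - (1 / D) *\<^sub>R B v)" for N
      using A.sym[of "z N" v]
      by (simp add: w_def B_def cinner.diff_left cinner.diff_right cinner.scaleR_left cinner.scaleR_right)
    then show "(\<lambda>N. cinner (w N) v) \<longlonglongrightarrow> 0" using z_null unfolding weakly_null_def by simp
  qed
  \<comment> \<open>Normalising a short vector would magnify its component in \<open>H m\<close>, so
    short vectors are estimated by the bound D alone. Long ones are normalised into
    \<open>V m\<close>, where the form is at most a m, and |w| \<le> 2 turns the excess \<kappa>/4
    into \<kappa>.\<close>
  have w_form: "\<forall>\<^sub>F N in sequentially. - \<kappa> \<le> Re (cinner (B (w N)) (w N))" if \<kappa>: "\<kappa> > 0" for \<kappa>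
  proof -
    have B_q: "Re (cinner (B u) u) = M * (norm u)\<^sup>2 - q u" for u
      by (simp add: B_def q_def cinner.diff_left cinner.scaleR_left Re_cinner_self)
    have "\<forall>\<^sub>F m in sequentially. a m < M + \<kappa> / 4" using \<kappa> by (intro order_tendstoD[OF M]) simp
    then obtain m where m: "a m < M + \<kappa> / 4" using eventually_happens' sequentially_bot by blast
    \<comment> \<open>Dividing by a norm above sqrt (\<kappa>/D) then leaves a projection of length
      at most 1/(m+1).\<close>
    define \<rho> where "\<rho> = sqrt (\<kappa> / D) / real (Suc m)"
    have \<rho>: "\<rho> > 0" using \<kappa> D by (simp add: \<rho>_def)
    have "(\<lambda>N. norm (P m (w N))) \<longlonglongrightarrow> 0" by (rule tendsto_norm_zero[OF weakly_null_P[OF w_null]])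
    then have "\<forall>\<^sub>F N in sequentially. norm (P m (w N)) < \<rho>" using \<rho> by (rule order_tendstoD)
    then show ?thesis
    proof eventually_elim
      case (elim N)
      show ?case
      proof (cases "norm (w N) \<le> sqrt (\<kappa> / D)")
        case True
        have "\<bar>Re (cinner (B (w N)) (w N))\<bar> \<le> norm (B (w N)) * norm (w N)"
          by (rule order_trans[OF abs_Re_le_cmod cinner_Cauchy_Schwarz])
        also have "\<dots> \<le> D * norm (w N) * norm (w N)" by (intro mult_right_mono B_bound) simp
        also have "\<dots> = D * (norm (w N))\<^sup>2" by (simp add: power2_eq_square)
        also have "\<dots> \<le> D * (sqrt (\<kappa> / D))\<^sup>2" using True D by (intro mult_left_mono power_mono) auto
        also have "\<dots> = \<kappa>" using D \<kappa> by simp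
        finally show ?thesis by simp
      next
        case False
        define s where "s = norm (w N)"
        have s: "s > sqrt (\<kappa> / D)" "s > 0" using False D \<kappa> by (auto simp: s_def)
        have "norm (P m (w N)) \<le> s / real (Suc m)"
        proof -
          have "\<rho> \<le> s / real (Suc m)" unfolding \<rho>_def using s by (intro divide_right_mono) auto
          then show ?thesis using elim by linarith
        qed
        then have "1 / s * norm (P m (w N)) \<le> 1 / s * (s / real (Suc m))"
          using s by (intro mult_left_mono) auto
        then have "norm (P m ((1 / s) *\<^sub>R w N)) \<le> 1 / real (Suc m)"
          using s by (simp add: P_scaleR)
        moreover have "norm ((1 / s) *\<^sub>R w N) = 1" using s by (simp add: s_def)
        ultimately have "(1 / s) *\<^sub>R w N \<in> V m" unfolding V_def by blast
        from a_upper[OF this] have "(1 / s)\<^sup>2 * q (w N) \<le> a m" by (simp only: q_scale)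
        then have "s\<^sup>2 * ((1 / s)\<^sup>2 * q (w N)) \<le> s\<^sup>2 * a m" by (rule mult_left_mono) simp
        then have "q (w N) \<le> a m * s\<^sup>2" using s by (simp add: power_one_over mult.commute)
        also have "\<dots> \<le> (M + \<kappa> / 4) * s\<^sup>2" using m by (intro mult_right_mono) auto
        also have "\<dots> \<le> M * s\<^sup>2 + \<kappa>"
        proof -
          have "s\<^sup>2 \<le> 4" using w_norm[of N] power_mono[of s 2 2] s by (simp add: s_def)
          then have "\<kappa> / 4 * s\<^sup>2 \<le> \<kappa> / 4 * 4" using \<kappa> by (intro mult_left_mono) auto
          then show ?thesis by (simp add: algebra_simps)
        qed
        finally show ?thesis unfolding B_q by (simp add: s_def)
      qed
    qed
  qed
  have "(\<lambda>N. B (z N)) \<longlonglongrightarrow> 0"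
  proof (rule LIMSEQ_I)
    fix \<epsilon> :: real assume e: "\<epsilon> > 0"
    \<comment> \<open>M - q (z N) and the defect of the form are each at most \<kappa>, and D * 4 *
      \<kappa> is \<epsilon>^2.\<close>
    define \<kappa> where "\<kappa> = \<epsilon>\<^sup>2 / (4 * D)"
    have \<kappa>: "\<kappa> > 0" using e D by (simp add: \<kappa>_def)
    have "\<forall>\<^sub>F N in sequentially. q (z N) > M - \<kappa>" using \<kappa> by (intro order_tendstoD[OF q_lim]) simp
    with w_form[OF \<kappa>] have "\<forall>\<^sub>F N in sequentially. norm (B (z N) - 0) < \<epsilon>"
    proof eventually_elim
      case (elim N)
      have lin: "B (w N) = B (z N) - (1 / D) *\<^sub>R B (B (z N))"
      proof -
        have "B (u - c *\<^sub>R v) = B u - c *\<^sub>R B v" for u v c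
          using A.diff[of u "c *\<^sub>R v"] by (simp add: B_def A.scaleR algebra_simps)
        then show ?thesis by (simp only: w_def)
      qed
      have "(norm (B (z N)))\<^sup>2 \<le> D * (Re (cinner (B (z N)) (z N)) + \<kappa>)"
      proof (rule norm_le_almost_nonneg_form[OF D B_bound])
        show "cinner (B (B (z N))) (z N) = cinner (B (z N)) (B (z N))"
          using A.sym by (simp add: B_def cinner.diff_left cinner.diff_right cinner.scaleR_left cinner.scaleR_right)
        show "- \<kappa> \<le> Re (cinner (B (z N) - (1 / D) *\<^sub>R B (B (z N))) (z N - (1 / D) *\<^sub>R B (z N)))"
          using elim(1) unfolding lin by (simp only: w_def)
      qed
      also have "D * (Re (cinner (B (z N)) (z N)) + \<kappa>) = D * (M - q (z N) + \<kappa>)"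
        by (simp add: B_def q_def cinner.diff_left cinner.scaleR_left Re_cinner_self z1)
      also have "\<dots> < D * (4 * \<kappa>)" using elim(2) D \<kappa> by (intro mult_strict_left_mono) simp_all
      also have "\<dots> = \<epsilon>\<^sup>2" using D by (simp add: \<kappa>_def)
      finally have "(norm (B (z N)))\<^sup>2 < \<epsilon>\<^sup>2" .
      then have "norm (B (z N)) < \<epsilon>" by (rule power2_less_imp_less) (rule less_imp_le[OF e])
      then show ?case by (simp only: diff_zero)
    qed
    then show "\<exists>N. \<forall>n\<ge>N. norm (B (z n) - 0) < \<epsilon>" by (simp only: eventually_sequentially)
  qed
  from tendsto_minus[OF this] have Az: "(\<lambda>N. A (z N) - M *\<^sub>R z N) \<longlonglongrightarrow> 0"
    by (simp only: B_def minus_diff_eq minus_zero)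
  show ?thesis by (intro exI[of _ M] exI[of _ z] conjI allI \<open>\<beta> \<le> M\<close> z1 z_null Az)
qed

end

section \<open>Absence of spectral pollution\<close>

lemma (in bounded_symmetric_on) scaled_sign:
  assumes "sg = 1 \<or> sg = -1"
  shows "bounded_symmetric_on S (\<lambda>x. sg *\<^sub>R A x) C"
proof
  fix x assume "x \<in> S"
  then show "norm (sg *\<^sub>R A x) \<le> C * norm x" using bound assms by auto
qed (use C_pos in \<open>auto simp: subspace in_S add scale sym scaleR_add_right scaleC.scaleR_right
    cinner.scaleR_left cinner.scaleR_right\<close>)

context selfadjoint_oper
begin

section \<open>Resolvents at real points and nonempty spectrum\<close>

lemma ess_spectrum2_subset_spectrum:
  assumes "complex_of_real l \<in> ess_spectrum2 T"
  shows "complex_of_real l \<in> spectrum T"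
  unfolding spectrum_iff_approx_eigenvalue
proof (intro allI impI)
  fix \<epsilon> :: real assume e: "\<epsilon> > 0"
  obtain x where x: "\<And>j. x j \<in> dom T" "\<And>j. norm (x j) = 1"
      "(\<lambda>j. norm (T \<cdot> x j - complex_of_real l *\<^sub>C x j)) \<longlonglongrightarrow> 0"
    using assms unfolding ess_spectrum2_def by blast
  obtain j where "norm (T \<cdot> x j - complex_of_real l *\<^sub>C x j) < \<epsilon>"
    using eventually_happens'[OF sequentially_bot order_tendstoD(2)[OF x(3) e]] by blast
  then show "\<exists>x\<in>dom T. norm x = 1 \<and> norm (T \<cdot> x - l *\<^sub>R x) < \<epsilon>"
    using x(1,2) by (intro bexI[of _ "x j"]) (simp_all add: scaleR_scaleC)
qed

text \<open>The inverse of T - z at a real z inherits symmetry, which brings an unbounded T within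
  reach of the extremal arguments for bounded operators.\<close>

lemma resolvent_bounded_symmetric:
  assumes z: "complex_of_real z \<notin> spectrum T"
  obtains A C where "bounded_symmetric_on UNIV A C" "\<And>v. A v \<in> dom T"
    "\<And>v. T \<cdot> A v - z *\<^sub>R A v = v"
proof -
  define f where "f x = T \<cdot> x - z *\<^sub>R x" for x
  from z obtain C where bij: "bij_betw f (dom T) UNIV" and C: "\<And>x. x \<in> dom T \<Longrightarrow> norm x \<le> C * norm (f x)"
    unfolding spectrum_def resolvent_set_def f_def scaleR_scaleC by auto
  define A where "A = inv_into (dom T) f"
  have A_dom: "A v \<in> dom T" for v
    using bij unfolding A_def by (metis UNIV_I bij_betw_imp_surj_on inv_into_into)
  have fA: "f (A v) = v" for v
    using bij unfolding A_def by (metis UNIV_I bij_betw_imp_surj_on f_inv_into_f)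
  have A_eq: "A v = x" if "x \<in> dom T" "f x = v" for x v
    using bij that unfolding A_def by (metis bij_betw_imp_inj_on inv_into_f_f)
  have "bounded_symmetric_on UNIV A (max C 1)"
  proof
    fix u v c
    show "A (u + v) = A u + A v"
      by (rule A_eq) (use A_dom fA[of u] fA[of v] in \<open>auto simp: f_def dom_add app_add algebra_simps\<close>)
    show "A (c *\<^sub>C u) = c *\<^sub>C A u"
    proof (rule A_eq)
      show "c *\<^sub>C A u \<in> dom T" using A_dom by (rule dom_scaleC)
      have "f (c *\<^sub>C A u) = c *\<^sub>C f (A u)"
        using A_dom by (simp add: f_def app_scaleC scaleC.diff_right scaleC.scaleR_right)
      then show "f (c *\<^sub>C A u) = c *\<^sub>C u" by (simp add: fA)
    qed
    have "cinner (A u) (f (A v)) = cinner (f (A u)) (A v)"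
      using symmetric[OF A_dom A_dom, of u v]
      by (simp add: f_def cinner.diff_left cinner.diff_right cinner.scaleR_left cinner.scaleR_right)
    then show "cinner (A u) v = cinner u (A v)" by (simp add: fA)
    have "norm (A u) \<le> C * norm u" using C[OF A_dom, of u] by (simp add: fA)
    also have "\<dots> \<le> max C 1 * norm u" by (intro mult_right_mono) auto
    finally show "norm (A u) \<le> max C 1 * norm u" .
  qed (auto simp: complex_vector.subspace_UNIV less_max_iff_disj)
  then show ?thesis using that A_dom fA unfolding f_def by blast
qed

text \<open>If T is invertible, its inverse has a nonzero approximate eigenvalue \<mu>, and 1/\<mu>
  belongs to the spectrum. An empty spectrum would have to be treated separately, since
  \<open>aw_gap\<close> puts the empty set at distance 1 from every other set.\<close>

lemma spectrum_nonempty: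
  assumes "(v::'h) \<noteq> 0"
  shows "spectrum T \<noteq> {}"
proof (cases "complex_of_real 0 \<in> spectrum T")
  case False
  then obtain A C where A: "bounded_symmetric_on UNIV A C" and A_dom: "\<And>v. A v \<in> dom T"
      and TA: "\<And>v. T \<cdot> A v - 0 *\<^sub>R A v = v"
    using resolvent_bounded_symmetric by metis
  interpret A: bounded_symmetric_on UNIV A C by (rule A)
  have "A v \<noteq> 0" using TA[of v] assms app_0 by auto
  then obtain \<mu> where \<mu>: "\<mu> \<noteq> 0"
      and ev: "\<And>\<eta>. \<eta> > 0 \<Longrightarrow> \<exists>u\<in>UNIV. norm u = 1 \<and> norm (A u - \<mu> *\<^sub>R u) \<le> \<eta>"
    using A.nonzero_approx_eigenvalue[of v] by auto
  have "complex_of_real (1 / \<mu>) \<in> spectrum T"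
    unfolding spectrum_iff_approx_eigenvalue
  proof (intro allI impI)
    fix \<epsilon> :: real assume e: "\<epsilon> > 0"
    \<comment> \<open>The first bound keeps |A u| at least |\<mu>|/2, so that A u can be normalised;
      the second makes the normalised residual at most \<epsilon>/2.\<close>
    define \<eta> where "\<eta> = min (\<bar>\<mu>\<bar> / 2) (\<epsilon> * \<mu>\<^sup>2 / 4)"
    have \<eta>: "\<eta> > 0" using e \<mu> by (simp add: \<eta>_def)
    obtain u where u: "norm u = 1" "norm (A u - \<mu> *\<^sub>R u) \<le> \<eta>" using ev[OF \<eta>] by blast
    have Au: "norm (A u) \<ge> \<bar>\<mu>\<bar> / 2"
    proof -
      have "\<eta> \<le> \<bar>\<mu>\<bar> / 2" by (simp add: \<eta>_def)
      moreover have "\<bar>norm (A u) - \<bar>\<mu>\<bar>\<bar> \<le> norm (A u - \<mu> *\<^sub>R u)"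
        using norm_triangle_ineq3[of "A u" "\<mu> *\<^sub>R u"] u(1) by simp
      ultimately show ?thesis using u(2) by linarith
    qed
    moreover have "\<bar>\<mu>\<bar> / 2 > 0" using \<mu> by simp
    ultimately have pos: "norm (A u) > 0" by linarith
    define x where "x = (1 / norm (A u)) *\<^sub>R A u"
    have x: "x \<in> dom T" "norm x = 1" using pos A_dom by (auto simp: x_def dom_scaleR)
    have "T \<cdot> x - (1 / \<mu>) *\<^sub>R x = (- 1 / (\<mu> * norm (A u))) *\<^sub>R (A u - \<mu> *\<^sub>R u)"
      using TA[of u] \<mu> by (simp add: x_def app_scaleR A_dom algebra_simps)
    then have "norm (T \<cdot> x - (1 / \<mu>) *\<^sub>R x) = norm (A u - \<mu> *\<^sub>R u) / (\<bar>\<mu>\<bar> * norm (A u))"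
      by (simp add: abs_mult)
    also have "\<dots> \<le> (\<epsilon> * \<mu>\<^sup>2 / 4) / (\<bar>\<mu>\<bar> * (\<bar>\<mu>\<bar> / 2))"
    proof (intro frac_le mult_left_mono mult_pos_pos)
      show "0 \<le> \<epsilon> * \<mu>\<^sup>2 / 4" using e by simp
      show "norm (A u - \<mu> *\<^sub>R u) \<le> \<epsilon> * \<mu>\<^sup>2 / 4"
        using u(2) by (simp only: \<eta>_def min.bounded_iff)
    qed (use Au \<mu> in auto)
    also have "\<dots> = \<epsilon> / 2" using \<mu> by (simp add: power2_eq_square field_simps)
    also have "\<dots> < \<epsilon>" using e by simp
    finally show "\<exists>x\<in>dom T. norm x = 1 \<and> norm (T \<cdot> x - (1 / \<mu>) *\<^sub>R x) < \<epsilon>" using x by blast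
  qed
  then show ?thesis by blast
qed auto

end

locale exhausted_oper = exhaustion H k e + selfadjoint_oper T
  for H :: "nat \<Rightarrow> ('h::chilbert_space) set" and k e and T :: "'h oper"
begin

text \<open>
  The resolvent at a point beyond the bound of the form turns the lower end of the essential
  numerical range into the upper end for a bounded operator.
\<close>

lemma ess_spectrum_beyond_form_limit:
  assumes sg: "sg = 1 \<or> sg = -1"
    and bdd: "\<And>x. x \<in> dom T \<Longrightarrow> c * (norm x)\<^sup>2 \<le> sg * Re (cinner (T \<cdot> x) x)"
    and y: "\<And>j. y j \<in> dom T" "\<And>j. norm (y j) = 1" "weakly_null y"
    and lim: "(\<lambda>j. Re (cinner (T \<cdot> y j) (y j))) \<longlonglongrightarrow> l"
  shows "\<exists>\<mu>. complex_of_real \<mu> \<in> ess_spectrum2 T \<and> sg * \<mu> \<le> sg * l"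
proof -
  have sg2: "sg * sg = 1" "sg * (sg * r) = r" for r using sg by auto
  \<comment> \<open>One below the form bound, so that R is bounded below by 1 and
    invertible.\<close>
  define c' where "c' = c - 1"
  define R where "R x = sg *\<^sub>R (T \<cdot> x) - c' *\<^sub>R x" for x
  have R_alt: "R x = sg *\<^sub>R (T \<cdot> x - (sg * c') *\<^sub>R x)" for x
    by (simp add: R_def scaleR_diff_right sg2)
  have norm_R: "norm (R x) = norm (T \<cdot> x - (sg * c') *\<^sub>R x)" for x
    unfolding R_alt using sg by (auto simp: norm_minus_commute)
  have R_form: "(norm x)\<^sup>2 \<le> Re (cinner (R x) x)" if "x \<in> dom T" for x
  proof -
    have "Re (cinner (R x) x) = sg * Re (cinner (T \<cdot> x) x) - c' * (norm x)\<^sup>2"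
      by (simp add: R_def cinner.diff_left cinner.scaleR_left Re_cinner_self)
    then show ?thesis using bdd[OF that] by (simp add: c'_def algebra_simps)
  qed
  have R_lb: "norm x \<le> norm (R x)" if "x \<in> dom T" for x
  proof (cases "x = 0")
    case False
    have "norm x * norm x \<le> norm (R x) * norm x"
      using R_form[OF that] Re_cinner_le[of "R x" x] by (simp add: power2_eq_square)
    then show ?thesis using False by simp
  qed simp
  have "complex_of_real (sg * c') \<notin> spectrum T"
  proof
    assume "complex_of_real (sg * c') \<in> spectrum T"
    then obtain x where "x \<in> dom T" "norm x = 1" "norm (T \<cdot> x - (sg * c') *\<^sub>R x) < 1"
      unfolding spectrum_iff_approx_eigenvalue using zero_less_one by blast
    then show False using R_lb[of x] by (simp add: norm_R)
  qed
  then obtain A' C where A': "bounded_symmetric_on UNIV A' C" and A'_dom: "\<And>v. A' v \<in> dom T"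
      and TA': "\<And>v. T \<cdot> A' v - (sg * c') *\<^sub>R A' v = v"
    using resolvent_bounded_symmetric by metis
  define A where "A v = sg *\<^sub>R A' v" for v
  have A: "bounded_symmetric_on UNIV A C"
    unfolding A_def by (rule bounded_symmetric_on.scaled_sign[OF A' sg])
  interpret A: bounded_symmetric_on UNIV A C by (rule A)
  have A_dom: "A v \<in> dom T" for v using A'_dom by (simp add: A_def dom_scaleR)
  have RA: "R (A v) = v" for v
  proof -
    have "R (A v) = (sg * sg) *\<^sub>R (T \<cdot> A' v - (sg * c') *\<^sub>R A' v)"
      by (simp add: R_alt A_def app_scaleR A'_dom scaleR_diff_right mult_ac)
    then show ?thesis by (simp only: TA' sg2 scaleR_one)
  qed
  have R_sym: "cinner (R u) v = cinner u (R v)" if "u \<in> dom T" "v \<in> dom T" for u v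
    using symmetric[OF that]
    by (simp add: R_def cinner.diff_left cinner.diff_right cinner.scaleR_left cinner.scaleR_right)
  define r where "r j = Re (cinner (R (y j)) (y j))" for j
  define \<nu> where "\<nu> = sg * l - c'"
  have "r = (\<lambda>j. sg * Re (cinner (T \<cdot> y j) (y j)) - c')"
    by (rule ext) (simp add: r_def R_def cinner.diff_left cinner.scaleR_left Re_cinner_self y)
  then have r_lim: "r \<longlonglongrightarrow> \<nu>" unfolding \<nu>_def by (auto intro!: tendsto_intros lim)
  have r_ge: "1 \<le> r j" for j using R_form[OF y(1)] y(2) by (simp add: r_def)
  have \<nu>: "\<nu> \<ge> 1" using r_ge by (intro LIMSEQ_le_const[OF r_lim]) auto
  \<comment> \<open>Linearised form of 1 \<le> (R y, y)(A y, y), obtained by expanding the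
    nonnegative form of R at y - \<nu> A y. Taking the limit \<nu> as multiplier loses nothing
    asymptotically, since (2 \<nu> - r j)/\<nu>^2 tends to 1/\<nu>.\<close>
  have A_lower: "2 * \<nu> - r j \<le> \<nu>\<^sup>2 * Re (cinner (A (y j)) (y j))" for j
  proof -
    let ?y = "y j"
    have d: "\<nu> *\<^sub>R A ?y \<in> dom T" "?y - \<nu> *\<^sub>R A ?y \<in> dom T"
      by (intro dom_diff dom_scaleR y(1) A_dom)+
    have "R (?y - \<nu> *\<^sub>R A ?y) = R ?y - \<nu> *\<^sub>R R (A ?y)"
      using y(1)[of j] A_dom[of ?y] d by (simp add: R_def app_diff app_scaleR algebra_simps)
    also have "\<dots> = R ?y - \<nu> *\<^sub>R ?y" by (simp add: RA)
    finally have Ry: "R (?y - \<nu> *\<^sub>R A ?y) = R ?y - \<nu> *\<^sub>R ?y" .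
    have RyA: "cinner (R ?y) (A ?y) = 1"
      using R_sym[OF y(1) A_dom] y(2)[of j] by (simp add: RA cinner_self)
    have "0 \<le> Re (cinner (R ?y - \<nu> *\<^sub>R ?y) (?y - \<nu> *\<^sub>R A ?y))"
      using R_form[OF d(2)] unfolding Ry by (meson order_trans zero_le_power2)
    also have "\<dots> = r j - 2 * \<nu> + \<nu>\<^sup>2 * Re (cinner (A ?y) ?y)"
      using Re_cinner_commute[of ?y "A ?y"]
      by (simp add: r_def cinner.diff_left cinner.diff_right cinner.scaleR_left cinner.scaleR_right
          RyA cinner_self y algebra_simps power2_eq_square)
    finally show ?thesis by simp
  qed
  have A_event: "\<forall>\<^sub>F j in sequentially. 1 / \<nu> - \<epsilon> \<le> Re (cinner (A (y j)) (y j))" if e: "\<epsilon> > 0" for \<epsilon>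
  proof -
    have "\<forall>\<^sub>F j in sequentially. r j < \<nu> + \<epsilon> * \<nu>\<^sup>2" using e \<nu> by (intro order_tendstoD[OF r_lim]) simp
    then show ?thesis
    proof eventually_elim
      case (elim j)
      have "\<nu>\<^sup>2 * (1 / \<nu> - \<epsilon>) = \<nu> - \<epsilon> * \<nu>\<^sup>2" using \<nu> by (simp add: power2_eq_square algebra_simps)
      also have "\<dots> \<le> \<nu>\<^sup>2 * Re (cinner (A (y j)) (y j))" using elim A_lower[of j] by simp
      finally show ?case using \<nu> by (subst (asm) mult_le_cancel_left_pos) auto
    qed
  qed
  obtain M z where M: "1 / \<nu> \<le> M" and z: "\<And>j. norm (z j) = 1" "weakly_null z"
      and Az: "(\<lambda>j. A (z j) - M *\<^sub>R z j) \<longlonglongrightarrow> 0"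
    using ess_upper_end[OF A y(2,3) A_event] by blast
  have M0: "M > 0" using M \<nu> by (smt (verit) divide_pos_pos)
  have nAz: "(\<lambda>j. norm (A (z j))) \<longlonglongrightarrow> M"
  proof (rule Lim_transform[OF tendsto_const])
    have "\<bar>norm (A (z j)) - M\<bar> \<le> norm (A (z j) - M *\<^sub>R z j)" for j
      using norm_triangle_ineq3[of "A (z j)" "M *\<^sub>R z j"] M0 z(1)[of j] by simp
    then show "(\<lambda>j. norm (A (z j)) - M) \<longlonglongrightarrow> 0"
      by (intro Lim_null_comparison[OF _ tendsto_norm_zero[OF Az]] always_eventually) simp
  qed
  have pos: "norm (A (z j)) > 0" for j
  proof -
    have "z j \<noteq> 0" using z(1)[of j] by auto
    moreover have "R 0 = 0" by (simp add: R_def app_0)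
    ultimately show ?thesis using RA[of "z j"] by auto
  qed
  \<comment> \<open>Approximate eigenvectors of the inverse for M become, after applying A and
    normalising, approximate eigenvectors of R for 1/M and of T for \<mu>.\<close>
  define x where "x j = (1 / norm (A (z j))) *\<^sub>R A (z j)" for j
  define \<mu> where "\<mu> = sg * (c' + 1 / M)"
  have x1: "x j \<in> dom T" "norm (x j) = 1" for j using pos[of j] A_dom by (auto simp: x_def dom_scaleR)
  have x_null: "weakly_null x"
    unfolding weakly_null_def
  proof
    fix v
    have "(\<lambda>j. (1 / norm (A (z j))) *\<^sub>R cinner (z j) (A v)) \<longlonglongrightarrow> (1 / M) *\<^sub>R 0"
      using z(2) nAz M0 unfolding weakly_null_def by (intro tendsto_intros) auto
    then show "(\<lambda>j. cinner (x j) v) \<longlonglongrightarrow> 0"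
      by (simp add: x_def cinner.scaleR_left A.sym)
  qed
  have res: "norm (T \<cdot> x j - \<mu> *\<^sub>R x j) = norm (A (z j) - M *\<^sub>R z j) / (M * norm (A (z j)))" for j
  proof -
    have "T \<cdot> x j - \<mu> *\<^sub>R x j = sg *\<^sub>R (R (x j) - (1 / M) *\<^sub>R x j)"
      by (simp add: R_alt \<mu>_def algebra_simps sg2)
    moreover have "R (x j) = (1 / norm (A (z j))) *\<^sub>R R (A (z j))"
      by (simp add: R_def x_def app_scaleR A_dom algebra_simps)
    moreover have "(1 / norm (A (z j))) *\<^sub>R z j - (1 / M) *\<^sub>R x j
        = (- 1 / (M * norm (A (z j)))) *\<^sub>R (A (z j) - M *\<^sub>R z j)"
      using M0 by (simp add: x_def algebra_simps)
    ultimately have "T \<cdot> x j - \<mu> *\<^sub>R x j = (sg * (- 1 / (M * norm (A (z j))))) *\<^sub>R (A (z j) - M *\<^sub>R z j)"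
      by (simp add: RA)
    moreover have "\<bar>sg\<bar> = 1" using sg by auto
    ultimately show ?thesis using M0 by (simp add: abs_mult)
  qed
  have "(\<lambda>j. norm (T \<cdot> x j - \<mu> *\<^sub>R x j)) \<longlonglongrightarrow> 0 / (M * M)"
    unfolding res using M0 by (intro tendsto_intros nAz tendsto_norm_zero Az) auto
  then have "complex_of_real \<mu> \<in> ess_spectrum2 T"
    unfolding ess_spectrum2_def using x1 x_null by (auto simp: scaleR_scaleC intro!: exI[of _ x])
  moreover have "sg * \<mu> \<le> sg * l"
  proof -
    have "1 / M \<le> \<nu>" using M \<nu> M0 by (simp add: field_simps)
    then show ?thesis by (simp add: \<mu>_def sg2 \<nu>_def)
  qed
  ultimately show ?thesis by blast
qed

end

locale core_exhausted_oper = exhausted_oper +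
  assumes core: "is_core (\<Union>n. H n) T"
begin

lemma H_dom: "x \<in> H n \<Longrightarrow> x \<in> dom T"
  using core unfolding is_core_def by blast

lemma core_approx:
  assumes x: "x \<in> dom T"
  obtains u where "\<And>j. u j \<in> (\<Union>n. H n)" "u \<longlonglongrightarrow> x" "(\<lambda>j. T \<cdot> u j) \<longlonglongrightarrow> T \<cdot> x"
proof -
  have "(x, T \<cdot> x) \<in> Map.graph T" using x by (auto simp: Map.graph_def)
  then have "(x, T \<cdot> x) \<in> closure (Map.graph (T |` (\<Union>n. H n)))"
    using core by (simp add: is_core_def)
  then obtain g where g: "\<And>j. g j \<in> Map.graph (T |` (\<Union>n. H n))" and lim: "g \<longlonglongrightarrow> (x, T \<cdot> x)"
    unfolding closure_sequential by blast
  have g': "fst (g j) \<in> (\<Union>n. H n)" "snd (g j) = T \<cdot> fst (g j)" for j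
    using g[of j] by (auto simp: Map.graph_def restrict_map_def split: if_splits)
  show ?thesis
  proof (rule that[of "\<lambda>j. fst (g j)"])
    show "(\<lambda>j. fst (g j)) \<longlonglongrightarrow> x" using tendsto_fst[OF lim] by simp
    show "(\<lambda>j. T \<cdot> fst (g j)) \<longlonglongrightarrow> T \<cdot> x" using tendsto_snd[OF lim] by (simp add: g')
  qed (use g' in auto)
qed

text \<open>Graph norm approximation carries residuals over to the union of the \<open>H n\<close>;
  the core hypothesis thereby ensures that no spectral point is missed.\<close>

lemma approx_eigenvector_in_H:
  assumes l: "complex_of_real l \<in> spectrum T" and \<delta>: "\<delta> > 0"
  shows "\<exists>m. \<exists>x\<in>H m. norm x = 1 \<and> norm (T \<cdot> x - l *\<^sub>R x) < \<delta>"
proof -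
  obtain x where x: "x \<in> dom T" "norm x = 1" "norm (T \<cdot> x - l *\<^sub>R x) < \<delta>"
    using l \<delta> unfolding spectrum_iff_approx_eigenvalue by blast
  obtain u where u: "\<And>j. u j \<in> (\<Union>n. H n)" "u \<longlonglongrightarrow> x" "(\<lambda>j. T \<cdot> u j) \<longlonglongrightarrow> T \<cdot> x"
    using core_approx[OF x(1)] by blast
  have "(\<lambda>j. norm (T \<cdot> u j - l *\<^sub>R u j) / norm (u j)) \<longlonglongrightarrow> norm (T \<cdot> x - l *\<^sub>R x) / norm x"
    using x(2) by (intro tendsto_intros u) auto
  then have "\<forall>\<^sub>F j in sequentially. norm (T \<cdot> u j - l *\<^sub>R u j) / norm (u j) < \<delta>"
    by (rule order_tendstoD) (simp add: x)
  moreover have "\<forall>\<^sub>F j in sequentially. 0 < norm (u j)"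
    using tendsto_norm[OF u(2)] by (rule order_tendstoD) (simp add: x)
  ultimately have "\<forall>\<^sub>F j in sequentially. norm (T \<cdot> u j - l *\<^sub>R u j) / norm (u j) < \<delta> \<and> 0 < norm (u j)"
    by eventually_elim simp
  then obtain j where j: "norm (T \<cdot> u j - l *\<^sub>R u j) / norm (u j) < \<delta>" "0 < norm (u j)"
    using eventually_happens'[OF sequentially_bot] by blast
  obtain m where m: "u j \<in> H m" using u(1) by blast
  define v where "v = (1 / norm (u j)) *\<^sub>R u j"
  have "T \<cdot> v - l *\<^sub>R v = (1 / norm (u j)) *\<^sub>R (T \<cdot> u j - l *\<^sub>R u j)"
    by (simp add: v_def app_scaleR H_dom[OF m] algebra_simps)
  then have "norm (T \<cdot> v - l *\<^sub>R v) < \<delta>" using j by simp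
  moreover have "v \<in> H m" "norm v = 1" using m j H_subspace by (auto simp: v_def csubspace_scaleR)
  ultimately show ?thesis by blast
qed

text \<open>Of the dimensions only \<open>j \<le> n j\<close> is assumed, so that a failed limit
  supplies the family directly, without extracting a subsequence.\<close>

lemma no_spectral_pollution:
  assumes convex: "ereal_convex (ext_ess_spectrum T)"
    and l: "complex_of_real l \<notin> spectrum T"
    and n: "\<And>j. j \<le> n j" and y: "\<And>j. y j \<in> H (n j)" "\<And>j. norm (y j) = 1"
    and \<nu>: "\<nu> \<longlonglongrightarrow> l" and res: "(\<lambda>j. P (n j) (T \<cdot> y j) - \<nu> j *\<^sub>R y j) \<longlonglongrightarrow> 0"
  shows False
proof -
  define v where "v = (\<lambda>j. P (n j) (T \<cdot> y j) - \<nu> j *\<^sub>R y j)"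
  have v: "v \<longlonglongrightarrow> 0" unfolding v_def by (rule res)
  have y_dom: "y j \<in> dom T" for j using y(1) by (rule H_dom)
  \<comment> \<open>Testing weak convergence on D suffices: once n j \<ge> m, \<open>P (n j)\<close>
    may be inserted in front of T y j when pairing with u in \<open>H m\<close>, and the pairing of
    y j with (T - l) u reduces to that of the residual with u, up to \<nu> j - l.\<close>
  define D where "D = {T \<cdot> u - l *\<^sub>R u |u m. u \<in> H m}"
  have "a \<in> closure D" for a
  proof -
    obtain x where x: "x \<in> dom T" "a = T \<cdot> x - l *\<^sub>R x"
      using resolvent_bounded_symmetric[OF l] by metis
    obtain u where u: "\<And>j. u j \<in> (\<Union>n. H n)" "u \<longlonglongrightarrow> x" "(\<lambda>j. T \<cdot> u j) \<longlonglongrightarrow> T \<cdot> x"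
      using core_approx[OF x(1)] by blast
    have "T \<cdot> u j - l *\<^sub>R u j \<in> D" for j using u(1)[of j] by (auto simp: D_def)
    moreover have "(\<lambda>j. T \<cdot> u j - l *\<^sub>R u j) \<longlonglongrightarrow> a" unfolding x(2) by (intro tendsto_intros u)
    ultimately show ?thesis
      unfolding closure_sequential by (intro exI[of _ "\<lambda>j. T \<cdot> u j - l *\<^sub>R u j"]) simp
  qed
  then have D: "closure D = UNIV" by blast
  have y_null: "weakly_null y"
  proof (rule weakly_nullI_dense[OF D, of _ 1])
    fix a assume "a \<in> D"
    then obtain u m where u: "u \<in> H m" and a: "a = T \<cdot> u - l *\<^sub>R u" by (auto simp: D_def)
    have "\<forall>\<^sub>F j in sequentially. norm (cinner (y j) a) \<le> norm (v j) * norm u + \<bar>\<nu> j - l\<bar> * norm u"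
      using eventually_ge_at_top[of m]
    proof eventually_elim
      case (elim j)
      have u': "u \<in> H (n j)" using u H_mono[of m "n j"] elim n[of j] by auto
      have "cinner (y j) a = cinner (T \<cdot> y j) u - l *\<^sub>R cinner (y j) u"
        unfolding a cinner.diff_right cinner.scaleR_right symmetric[OF y_dom H_dom[OF u], symmetric] ..
      also have "cinner (T \<cdot> y j) u = cinner (P (n j) (T \<cdot> y j)) u" by (simp add: cinner_P[OF u'])
      finally have "cinner (y j) a = cinner (v j) u + (\<nu> j - l) *\<^sub>R cinner (y j) u"
        by (simp add: v_def cinner.diff_left cinner.scaleR_left algebra_simps)
      then have "norm (cinner (y j) a) \<le> norm (cinner (v j) u) + \<bar>\<nu> j - l\<bar> * norm (cinner (y j) u)"
        using norm_triangle_ineq[of "cinner (v j) u" "(\<nu> j - l) *\<^sub>R cinner (y j) u"] by simp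
      also have "\<dots> \<le> norm (v j) * norm u + \<bar>\<nu> j - l\<bar> * (norm (y j) * norm u)"
        by (intro add_mono mult_left_mono cinner_Cauchy_Schwarz) simp
      finally show ?case by (simp add: y)
    qed
    moreover have "(\<lambda>j. norm (v j) * norm u + \<bar>\<nu> j - l\<bar> * norm u) \<longlonglongrightarrow> 0 * norm u + \<bar>l - l\<bar> * norm u"
      by (intro tendsto_intros tendsto_norm_zero v \<nu>)
    then have "(\<lambda>j. norm (v j) * norm u + \<bar>\<nu> j - l\<bar> * norm u) \<longlonglongrightarrow> 0" by simp
    ultimately show "(\<lambda>j. cinner (y j) a) \<longlonglongrightarrow> 0" by (rule Lim_null_comparison)
  qed (simp only: y(2))
  have form: "(\<lambda>j. Re (cinner (T \<cdot> y j) (y j))) \<longlonglongrightarrow> l"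
  proof -
    have "(\<lambda>j. Re (cinner (T \<cdot> y j) (y j))) = (\<lambda>j. Re (cinner (v j) (y j)) + \<nu> j)"
      by (rule ext) (simp add: v_def cinner.diff_left cinner.scaleR_left cinner_P[OF y(1)] Re_cinner_self y)
    moreover have "(\<lambda>j. Re (cinner (v j) (y j))) \<longlonglongrightarrow> 0"
    proof (rule Lim_null_comparison[OF _ tendsto_norm_zero[OF v]])
      have "\<bar>Re (cinner (v j) (y j))\<bar> \<le> norm (v j) * norm (y j)" for j
        by (rule order_trans[OF abs_Re_le_cmod cinner_Cauchy_Schwarz])
      then show "\<forall>\<^sub>F j in sequentially. norm (Re (cinner (v j) (y j))) \<le> norm (v j)"
        by (simp add: y)
    qed
    ultimately show ?thesis using tendsto_add[of "\<lambda>j. Re (cinner (v j) (y j))" 0 sequentially \<nu> l] \<nu> by simp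
  qed
  let ?S = "ext_ess_spectrum T"
  have l_notin: "ereal l \<notin> ?S"
    using l ess_spectrum2_subset_spectrum by (auto simp: ext_ess_spectrum_def)
  have "(\<forall>s\<in>?S. ereal l < s) \<or> (\<forall>s\<in>?S. s < ereal l)"
  proof (rule ccontr)
    assume "\<not> ?thesis"
    then obtain s s' where "s \<in> ?S" "s \<le> ereal l" "s' \<in> ?S" "ereal l \<le> s'" by (auto simp: not_less)
    then have "ereal l \<in> ?S" using convex unfolding ereal_convex_def by (meson atLeastAtMost_iff subsetD)
    with l_notin show False by blast
  qed
  then show False
  proof
    assume S: "\<forall>s\<in>?S. ereal l < s"
    have "-\<infinity> \<notin> ?S"
    proof
      assume "-\<infinity> \<in> ?S"
      with S have "ereal l < -\<infinity>" by blast
      then show False by simp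
    qed
    then have "oper_bdd_below T" by (simp add: ext_ess_spectrum_def)
    then obtain c where "\<And>x. x \<in> dom T \<Longrightarrow> c * (norm x)\<^sup>2 \<le> 1 * Re (cinner (T \<cdot> x) x)"
      by (auto simp: oper_bdd_below_def)
    from ess_spectrum_beyond_form_limit[OF disjI1[OF refl] this y_dom y(2) y_null form]
    obtain \<mu> where "complex_of_real \<mu> \<in> ess_spectrum2 T" "1 * \<mu> \<le> 1 * l" by blast
    then have "ereal \<mu> \<in> ?S" "\<not> ereal l < ereal \<mu>" by (auto simp: ext_ess_spectrum_def)
    with S show False by blast
  next
    assume S: "\<forall>s\<in>?S. s < ereal l"
    have "\<infinity> \<notin> ?S"
    proof
      assume "\<infinity> \<in> ?S"
      with S have "\<infinity> < ereal l" by blast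
      then show False by simp
    qed
    then have "oper_bdd_above T" by (simp add: ext_ess_spectrum_def)
    then obtain c where "\<And>x. x \<in> dom T \<Longrightarrow> Re (cinner (T \<cdot> x) x) \<le> c * (norm x)\<^sup>2"
      by (auto simp: oper_bdd_above_def)
    then have "\<And>x. x \<in> dom T \<Longrightarrow> (- c) * (norm x)\<^sup>2 \<le> (- 1) * Re (cinner (T \<cdot> x) x)" by simp
    from ess_spectrum_beyond_form_limit[OF disjI2[OF refl] this y_dom y(2) y_null form]
    obtain \<mu> where "complex_of_real \<mu> \<in> ess_spectrum2 T" "(-1) * \<mu> \<le> (-1) * l" by blast
    then have "ereal \<mu> \<in> ?S" "\<not> ereal \<mu> < ereal l" by (auto simp: ext_ess_spectrum_def)
    with S show False by blast
  qed
qed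

end

section \<open>Convergence in the Attouch-Wets metric\<close>

text \<open>The distance from x to A is attained within R of x, so approximation of that part of A
  alone is enough.\<close>

lemma infdist_le_near:
  fixes A B :: "complex set"
  assumes A: "closed A" "A \<noteq> {}" and near: "\<And>a. a \<in> A \<Longrightarrow> dist x a \<le> R \<Longrightarrow> \<exists>b\<in>B. dist a b < \<epsilon>"
    and R: "infdist x A \<le> R"
  shows "infdist x B \<le> infdist x A + \<epsilon>"
proof -
  obtain a where a: "a \<in> A" "infdist x A = dist x a"
    using infdist_attains_inf[OF A] by blast
  then obtain b where b: "b \<in> B" "dist a b < \<epsilon>" using near R by auto
  have "infdist x B \<le> dist x b" using b(1) by (rule infdist_le)
  also have "\<dots> \<le> dist x a + dist a b" by (rule dist_triangle)
  finally show ?thesis using a b by simp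
qed

text \<open>Compactness, used twice, makes the pointwise conditions uniform on balls: a finite net
  of S in a ball is approached, and the compact part of the ball at distance at least \<eta> from S
  is eventually avoided.\<close>

lemma aw_gap_tendsto_0:
  assumes S: "closed S" "S \<noteq> {}" and G: "\<And>n. closed (G n)"
    and inner: "\<And>z \<epsilon>. z \<in> S \<Longrightarrow> \<epsilon> > 0 \<Longrightarrow> \<forall>\<^sub>F n in sequentially. \<exists>w\<in>G n. dist w z < \<epsilon>"
    and outer: "\<And>z. z \<notin> S \<Longrightarrow> \<exists>\<epsilon>>0. \<forall>\<^sub>F n in sequentially. G n \<inter> ball z \<epsilon> = {}"
    and r: "r > 0"
  shows "(\<lambda>n. aw_gap r (G n) S) \<longlonglongrightarrow> 0"
proof (rule tendstoI)
  fix \<epsilon> :: real assume "\<epsilon> > 0"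
  define \<eta> where "\<eta> = min (\<epsilon> / 2) (1 / 2)"
  have \<eta>: "\<eta> > 0" "\<eta> < \<epsilon>" "\<eta> < 1" using \<open>\<epsilon> > 0\<close> by (auto simp: \<eta>_def)
  obtain z0 where z0: "z0 \<in> S" using S by blast
  \<comment> \<open>For |x| < r the nearest points of both sets lie within r + |z0| + 1 of x, the 1
    covering the step from z0 to a point of \<open>G n\<close>; hence they have norm at most
    R.\<close>
  define R where "R = 2 * r + norm z0 + 1"
  have "compact (S \<inter> cball 0 R)" using S by (intro closed_Int_compact) auto
  then obtain F where F: "finite F" "F \<subseteq> S \<inter> cball 0 R" "S \<inter> cball 0 R \<subseteq> (\<Union>z\<in>F. ball z (\<eta> / 2))"
    using compactE_image[of "S \<inter> cball 0 R" "S \<inter> cball 0 R" "\<lambda>z. ball z (\<eta> / 2)"] \<eta> by force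
  have "\<forall>\<^sub>F n in sequentially. \<forall>z\<in>F. \<exists>w\<in>G n. dist w z < \<eta> / 2"
  proof (rule eventually_ball_finite[OF F(1)], rule ballI)
    fix z assume "z \<in> F"
    then have "z \<in> S" using F(2) by blast
    moreover have "\<eta> / 2 > 0" using \<eta> by simp
    ultimately show "\<forall>\<^sub>F n in sequentially. \<exists>w\<in>G n. dist w z < \<eta> / 2" by (rule inner)
  qed
  then have ev1: "\<forall>\<^sub>F n in sequentially. \<forall>z\<in>S \<inter> cball 0 R. \<exists>w\<in>G n. dist z w < \<eta>"
  proof eventually_elim
    case (elim n)
    show ?case
    proof
      fix z assume "z \<in> S \<inter> cball 0 R"
      then obtain z' where z': "z' \<in> F" "dist z' z < \<eta> / 2" using F(3) by auto
      then obtain w where "w \<in> G n" "dist w z' < \<eta> / 2" using elim by blast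
      then show "\<exists>w\<in>G n. dist z w < \<eta>"
        using z' dist_triangle_half_r[of z' z \<eta> w] by (metis dist_commute)
    qed
  qed
  define K where "K = cball 0 R - (\<Union>s\<in>S. ball s \<eta>)"
  have "compact K" unfolding K_def by (intro compact_diff) auto
  have "\<forall>z\<in>K. \<exists>e>0. \<forall>\<^sub>F n in sequentially. G n \<inter> ball z e = {}"
    using outer \<eta> by (force simp: K_def)
  then obtain e where e: "\<And>z. z \<in> K \<Longrightarrow> e z > 0"
      "\<And>z. z \<in> K \<Longrightarrow> \<forall>\<^sub>F n in sequentially. G n \<inter> ball z (e z) = {}" by metis
  obtain F' where F': "finite F'" "F' \<subseteq> K" "K \<subseteq> (\<Union>z\<in>F'. ball z (e z))"
    using compactE_image[OF \<open>compact K\<close>, of K "\<lambda>z. ball z (e z)"] e by force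
  have "\<forall>\<^sub>F n in sequentially. \<forall>z\<in>F'. G n \<inter> ball z (e z) = {}"
    using F' e by (intro eventually_ball_finite) auto
  then have ev2: "\<forall>\<^sub>F n in sequentially. \<forall>w\<in>G n \<inter> cball 0 R. \<exists>z\<in>S. dist w z < \<eta>"
  proof eventually_elim
    case (elim n)
    show ?case
    proof
      fix w assume w: "w \<in> G n \<inter> cball 0 R"
      then have "w \<notin> K" using elim F' by blast
      then show "\<exists>z\<in>S. dist w z < \<eta>" using w by (auto simp: K_def dist_commute)
    qed
  qed
  have z0R: "z0 \<in> S \<inter> cball 0 R" using z0 r by (simp add: R_def)
  from ev1 ev2 show "\<forall>\<^sub>F n in sequentially. dist (aw_gap r (G n) S) 0 < \<epsilon>"
  proof eventually_elim
    case (elim n)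
    obtain w0 where w0: "w0 \<in> G n" "dist z0 w0 < \<eta>" using elim(1) z0R by blast
    have "\<bar>infdist x (G n) - infdist x S\<bar> \<le> \<eta>" if x: "x \<in> ball 0 r" for x
    proof -
      have nx: "norm x < r" using x by simp
      have dz: "dist x z0 \<le> r + norm z0" using nx norm_triangle_ineq4[of x z0] by (simp add: dist_norm)
      have dw: "dist x w0 \<le> r + norm z0 + 1" using dz w0(2) \<eta> dist_triangle[of x w0 z0] by linarith
      have in_R: "a \<in> cball 0 R" if "dist x a \<le> r + norm z0 + 1" for a
        using that nx norm_triangle_sub[of a x] by (simp add: R_def dist_norm norm_minus_commute)
      have "infdist x S \<le> r + norm z0 + 1" using infdist_le[OF z0, of x] dz by linarith
      then have "infdist x (G n) \<le> infdist x S + \<eta>"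
        using S elim(1) in_R by (intro infdist_le_near[of S x "r + norm z0 + 1"]) auto
      moreover have "infdist x (G n) \<le> r + norm z0 + 1" using infdist_le[OF w0(1), of x] dw by linarith
      then have "infdist x S \<le> infdist x (G n) + \<eta>"
        using G w0 elim(2) in_R by (intro infdist_le_near[of "G n" x "r + norm z0 + 1"]) auto
      ultimately show ?thesis by linarith
    qed
    then have "(SUP x\<in>ball 0 r. \<bar>infdist x (G n) - infdist x S\<bar>) \<le> \<eta>"
      using r by (intro cSUP_least) auto
    then have "aw_gap r (G n) S \<le> \<eta>" using w0 S \<eta> by (auto simp: aw_gap_def)
    then show ?case using aw_gap_nonneg[OF r, of "G n" S] \<eta> by simp
  qed
qed

text \<open>Every gap tends to 0 and is at most 1, so the weights dominate the series and Tannery's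
  theorem applies.\<close>

lemma limitin_aw_metric:
  assumes S: "closed S" "S \<noteq> {}" and G: "\<And>n. closed (G n)"
    and inner: "\<And>z \<epsilon>. z \<in> S \<Longrightarrow> \<epsilon> > 0 \<Longrightarrow> \<forall>\<^sub>F n in sequentially. \<exists>w\<in>G n. dist w z < \<epsilon>"
    and outer: "\<And>z. z \<notin> S \<Longrightarrow> \<exists>\<epsilon>>0. \<forall>\<^sub>F n in sequentially. G n \<inter> ball z \<epsilon> = {}"
  shows "limitin (mtopology_of aw_metric) G S sequentially"
proof -
  let ?f = "\<lambda>i n. (1 / 2) ^ Suc i * aw_gap (real (Suc i)) (G n) S"
  have "(\<lambda>n. \<Sum>i. ?f i n) \<longlonglongrightarrow> (\<Sum>i. 0)"
  proof (rule tannerys_theorem[where a = ?f and M = "\<lambda>i. (1 / 2) ^ Suc i", THEN conjunct2, THEN conjunct2])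
    fix i
    have "(\<lambda>n. ?f i n) \<longlonglongrightarrow> (1 / 2) ^ Suc i * 0"
      by (intro tendsto_mult tendsto_const aw_gap_tendsto_0 assms) auto
    then show "(\<lambda>n. ?f i n) \<longlonglongrightarrow> 0" by simp
  next
    have "norm (?f i n) \<le> (1 / 2) ^ Suc i" for i n
      using aw_gap_nonneg[of "real (Suc i)" "G n" S] aw_gap_le_1[of "real (Suc i)" "G n" S]
      by (simp add: abs_mult mult_left_le)
    then show "\<forall>\<^sub>F (i, n) in at_top \<times>\<^sub>F sequentially. norm (?f i n) \<le> (1 / 2) ^ Suc i"
      by (intro always_eventually) auto
    show "summable (\<lambda>i. (1 / 2 :: real) ^ Suc i)"
      by (subst summable_Suc_iff) (simp add: summable_geometric)
  qed simp
  then have lim: "(\<lambda>n. aw_dist (G n) S) \<longlonglongrightarrow> 0" by (simp add: aw_dist_def)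
  show ?thesis
    unfolding mtopology_of_def mspace_aw_metric mdist_aw_metric
      Metric_space.limit_metric_sequentially[OF Metric_space_aw]
  proof (intro conjI allI impI)
    fix \<epsilon> :: real assume "\<epsilon> > 0"
    then have "\<forall>\<^sub>F n in sequentially. aw_dist (G n) S < \<epsilon>" by (rule order_tendstoD(2)[OF lim])
    then show "\<exists>N. \<forall>n\<ge>N. G n \<in> {A. closed A} \<and> aw_dist (G n) S < \<epsilon>"
      using G by (simp add: eventually_sequentially)
  qed (use S in simp)
qed

section \<open>Arithmetic programs\<close>

text \<open>Semantic version of being an arithmetic expression over L: closure rules replace the
  explicit writing of syntax trees.\<close>

definition arith_fun :: "'f set \<Rightarrow> (('f \<Rightarrow> complex) \<Rightarrow> real) \<Rightarrow> bool" where
  "arith_fun L \<phi> \<longleftrightarrow> (\<exists>a. set_arith a \<subseteq> L \<and> (\<forall>v. arith_val v a = \<phi> v))"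

lemma arith_fun_const: "arith_fun L (\<lambda>v. of_rat q)"
  unfolding arith_fun_def by (intro exI[of _ "RatConst q"]) simp

lemma arith_fun_of_nat: "arith_fun L (\<lambda>v. real n)"
  using arith_fun_const[of L "of_nat n"] by simp

lemma arith_fun_Re: "f \<in> L \<Longrightarrow> arith_fun L (\<lambda>v. Re (v f))"
  unfolding arith_fun_def by (intro exI[of _ "ReEval f"]) simp

lemma arith_fun_Im: "f \<in> L \<Longrightarrow> arith_fun L (\<lambda>v. Im (v f))"
  unfolding arith_fun_def by (intro exI[of _ "ImEval f"]) simp

lemma arith_fun_add: "arith_fun L \<phi> \<Longrightarrow> arith_fun L \<psi> \<Longrightarrow> arith_fun L (\<lambda>v. \<phi> v + \<psi> v)"
  unfolding arith_fun_def by (elim exE conjE, rule_tac x = "Add a aa" in exI) simp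

lemma arith_fun_diff: "arith_fun L \<phi> \<Longrightarrow> arith_fun L \<psi> \<Longrightarrow> arith_fun L (\<lambda>v. \<phi> v - \<psi> v)"
  unfolding arith_fun_def by (elim exE conjE, rule_tac x = "Sub a aa" in exI) simp

lemma arith_fun_mult: "arith_fun L \<phi> \<Longrightarrow> arith_fun L \<psi> \<Longrightarrow> arith_fun L (\<lambda>v. \<phi> v * \<psi> v)"
  unfolding arith_fun_def by (elim exE conjE, rule_tac x = "Mul a aa" in exI) simp

lemma arith_fun_power: "arith_fun L \<phi> \<Longrightarrow> arith_fun L (\<lambda>v. (\<phi> v)\<^sup>2)"
  unfolding power2_eq_square by (rule arith_fun_mult)

lemma arith_fun_sum: "(\<And>i. i \<in> I \<Longrightarrow> arith_fun L (\<phi> i)) \<Longrightarrow> arith_fun L (\<lambda>v. \<Sum>i\<in>I. \<phi> i v)"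
proof (induction I rule: infinite_finite_induct)
  case (insert i I)
  then show ?case by (simp add: arith_fun_add)
qed (use arith_fun_of_nat[of L 0] in simp_all)

lemma arith_val_cong: "(\<And>f. f \<in> set_arith a \<Longrightarrow> v f = w f) \<Longrightarrow> arith_val v a = arith_val w a"
  by (induction a) auto

lemma arith_fun_cong: "arith_fun L \<phi> \<Longrightarrow> (\<And>f. f \<in> L \<Longrightarrow> v f = w f) \<Longrightarrow> \<phi> v = \<phi> w"
  unfolding arith_fun_def by (metis arith_val_cong subsetD)

text \<open>Programs have no memory. The points accepted so far travel in \<open>out\<close>, and
  every branch carries its own list down to its leaf.\<close>

fun select_prog ::
  "('f arith \<times> rat) list \<Rightarrow> ('f arith \<times> 'f arith) list \<Rightarrow> 'f prog" where
  "select_prog [] out = Return out"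
| "select_prog ((a, q) # ts) out =
     IfLeq a (RatConst 0) (select_prog ts ((RatConst q, RatConst 0) # out)) (select_prog ts out)"

lemma runs_select_prog:
  assumes "\<And>a q. (a, q) \<in> set ts \<Longrightarrow> set_arith a \<subseteq> L"
    and "\<And>a b. (a, b) \<in> set out \<Longrightarrow> set_arith a \<union> set_arith b \<subseteq> L"
  shows "\<exists>F res. runs v (select_prog ts out) F res \<and> F \<subseteq> L \<and>
    set res = (\<lambda>(a, b). Complex (arith_val v a) (arith_val v b)) ` set out
      \<union> {complex_of_real (of_rat q) |a q. (a, q) \<in> set ts \<and> arith_val v a \<le> 0}"
  using assms
proof (induction ts out rule: select_prog.induct)
  case (1 out)
  show ?case
    by (intro exI conjI, simp, rule runs.Return) (use 1 in auto)
next
  case (2 a q ts out)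
  have a: "set_arith a \<subseteq> L" and ts: "\<And>a q. (a, q) \<in> set ts \<Longrightarrow> set_arith a \<subseteq> L"
    using 2(3) by auto
  show ?case
  proof (cases "arith_val v a \<le> 0")
    case True
    from 2(1)[OF ts] 2(4) obtain F res where r: "F \<subseteq> L"
      "runs v (select_prog ts ((RatConst q, RatConst 0) # out)) F res"
      "set res = (\<lambda>(a, b). Complex (arith_val v a) (arith_val v b)) ` set ((RatConst q, RatConst 0) # out)
      \<union> {complex_of_real (of_rat q) |a q. (a, q) \<in> set ts \<and> arith_val v a \<le> 0}" by fastforce
    have c: "arith_val v a \<le> arith_val v (RatConst 0)" using True by simp
    show ?thesis
      using runs.Leq[where q = "select_prog ts out", OF c r(2)] r(1,3) a True
      by (intro exI[of _ "set_arith a \<union> set_arith (RatConst 0) \<union> F"] exI[of _ res])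
        (auto simp: Complex_eq)
  next
    case False
    from 2(2)[OF ts] 2(4) obtain F res where r: "F \<subseteq> L"
      "runs v (select_prog ts out) F res"
      "set res = (\<lambda>(a, b). Complex (arith_val v a) (arith_val v b)) ` set out
      \<union> {complex_of_real (of_rat q) |a q. (a, q) \<in> set ts \<and> arith_val v a \<le> 0}" by fastforce
    have c: "\<not> arith_val v a \<le> arith_val v (RatConst 0)" using False by simp
    show ?thesis
      using runs.Greater[where p = "select_prog ts ((RatConst q, RatConst 0) # out)", OF c r(2)]
        r(1,3) a False
      by (intro exI[of _ "set_arith a \<union> set_arith (RatConst 0) \<union> F"] exI[of _ res]) auto
  qed
qed

text \<open>Unbounded search for an integer above the value of a. The tree is infinite, yet by the
  Archimedean property every run leaves the search, at a depth that depends on the input.\<close>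

primcorec search_prog :: "'f arith \<Rightarrow> (nat \<Rightarrow> 'f prog) \<Rightarrow> nat \<Rightarrow> 'f prog" where
  "search_prog a g N = IfLeq a (RatConst (of_nat N)) (g N) (search_prog a g (Suc N))"

lemma runs_search_prog:
  assumes N: "arith_val v a \<le> real N" and less: "\<And>m. m < N \<Longrightarrow> \<not> arith_val v a \<le> real m"
    and a: "set_arith a \<subseteq> L" and r: "runs v (g N) F res" "F \<subseteq> L"
  shows "\<exists>F. runs v (search_prog a g 0) F res \<and> F \<subseteq> L"
proof -
  have "\<exists>F. runs v (search_prog a g m) F res \<and> F \<subseteq> L" if "m \<le> N" for m
    using that
  proof (induction rule: inc_induct)
    case base
    have "runs v (IfLeq a (RatConst (of_nat N)) (g N) (search_prog a g (Suc N)))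
        (set_arith a \<union> set_arith (RatConst (of_nat N)) \<union> F) res"
      by (rule runs.Leq) (use N r in simp_all)
    then show ?case using a r by (subst search_prog.code) auto
  next
    case (step m)
    then obtain F' where F': "runs v (search_prog a g (Suc m)) F' res" "F' \<subseteq> L" by blast
    have "runs v (IfLeq a (RatConst (of_nat m)) (g m) (search_prog a g (Suc m)))
        (set_arith a \<union> set_arith (RatConst (of_nat m)) \<union> F') res"
      by (rule runs.Greater) (use less step F' in simp_all)
    then show ?case using a F' by (subst search_prog.code) auto
  qed
  then show ?thesis by blast
qed

text \<open>The program is a search for the bound N followed by finitely many tests;
  \<open>LEAST\<close> describes exactly where the search stops.\<close>

lemma selection_program:
  fixes \<phi> :: "nat \<Rightarrow> 'x \<Rightarrow> ('f \<Rightarrow> complex) \<Rightarrow> real" and g :: "'x \<Rightarrow> rat"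
  assumes \<psi>: "arith_fun L \<psi>" and fin: "\<And>N. finite (X N)"
    and \<phi>: "\<And>N x. x \<in> X N \<Longrightarrow> arith_fun L (\<phi> N x)"
  obtains p where "\<And>v. \<exists>F res. runs v p F res \<and> F \<subseteq> L \<and>
    set res = {complex_of_real (of_rat (g x)) |x.
      x \<in> X (LEAST N. \<psi> v \<le> real N) \<and> \<phi> (LEAST N. \<psi> v \<le> real N) x v \<le> 0}"
proof -
  obtain a where a: "set_arith a \<subseteq> L" "\<And>v. arith_val v a = \<psi> v"
    using \<psi> unfolding arith_fun_def by blast
  \<comment> \<open>The expressions are fixed before v is known, as the program must not depend on
    v.\<close>
  define b where "b N x = (SOME b. set_arith b \<subseteq> L \<and> (\<forall>v. arith_val v b = \<phi> N x v))" for N x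
  have "set_arith (b N x) \<subseteq> L \<and> (\<forall>v. arith_val v (b N x) = \<phi> N x v)" if "x \<in> X N" for N x
    using \<phi>[OF that] unfolding arith_fun_def b_def by (rule someI_ex)
  then have b: "\<And>N x. x \<in> X N \<Longrightarrow> set_arith (b N x) \<subseteq> L"
      "\<And>N x v. x \<in> X N \<Longrightarrow> arith_val v (b N x) = \<phi> N x v" by simp_all
  have "\<exists>ys. set ys = X N" for N using finite_list[OF fin] by blast
  then obtain xs where xs: "\<And>N. set (xs N) = X N" by metis
  define sel where "sel N = select_prog (map (\<lambda>x. (b N x, g x)) (xs N)) []" for N
  have "\<exists>F res. runs v (search_prog a sel 0) F res \<and> F \<subseteq> L \<and>
    set res = {complex_of_real (of_rat (g x)) |x.
      x \<in> X (LEAST N. \<psi> v \<le> real N) \<and> \<phi> (LEAST N. \<psi> v \<le> real N) x v \<le> 0}" for v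
  proof -
    define N where "N = (LEAST N. \<psi> v \<le> real N)"
    obtain N0 where "\<psi> v \<le> real N0" using real_arch_simple by blast
    then have N: "\<psi> v \<le> real N" unfolding N_def by (rule LeastI)
    have less: "\<not> \<psi> v \<le> real m" if "m < N" for m using that not_less_Least unfolding N_def by blast
    have "\<exists>F res. runs v (sel N) F res \<and> F \<subseteq> L \<and>
      set res = (\<lambda>(a, b). Complex (arith_val v a) (arith_val v b)) ` set []
      \<union> {complex_of_real (of_rat q) |a q. (a, q) \<in> set (map (\<lambda>x. (b N x, g x)) (xs N)) \<and> arith_val v a \<le> 0}"
      unfolding sel_def by (rule runs_select_prog) (use b xs in auto)
    then obtain F res where r: "runs v (sel N) F res" "F \<subseteq> L"
      and res: "set res = {complex_of_real (of_rat q) |a q. (a, q) \<in> set (map (\<lambda>x. (b N x, g x)) (xs N)) \<and> arith_val v a \<le> 0}"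
      by auto
    have "set res = {complex_of_real (of_rat (g x)) |x. x \<in> X N \<and> arith_val v (b N x) \<le> 0}"
      unfolding res by (auto simp: xs)
    also have "\<dots> = {complex_of_real (of_rat (g x)) |x. x \<in> X N \<and> \<phi> N x v \<le> 0}"
      by (simp only: b(2) cong: conj_cong)
    finally have "set res = {complex_of_real (of_rat (g x)) |x. x \<in> X N \<and> \<phi> N x v \<le> 0}" .
    note res = this
    have 1: "arith_val v a \<le> real N" unfolding a(2) by (rule N)
    have 2: "\<not> arith_val v a \<le> real m" if "m < N" for m unfolding a(2) by (rule less[OF that])
    obtain F' where "runs v (search_prog a sel 0) F' res" "F' \<subseteq> L"
      using runs_search_prog[where g = sel, OF 1 2 a(1) r] by blast
    then show ?thesis unfolding N_def[symmetric] using res by (intro exI conjI)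
  qed
  then show ?thesis by (rule that[of "search_prog a sel 0"])
qed

text \<open>With the same evaluation set for all inputs the consistency condition on it is
  trivial.\<close>

lemma arithmetic_algorithmI:
  assumes L: "finite L" "L \<subseteq> \<Lambda>" and \<Gamma>: "\<And>T. T \<in> \<Omega> \<Longrightarrow> \<Gamma> T \<in> mspace M"
    and cong: "\<And>S T. T \<in> \<Omega> \<Longrightarrow> S \<in> \<Omega> \<Longrightarrow> (\<And>f. f \<in> L \<Longrightarrow> f T = f S) \<Longrightarrow> \<Gamma> S = \<Gamma> T"
    and runs: "\<And>T. T \<in> \<Omega> \<Longrightarrow> \<exists>F out. runs (\<lambda>f. f T) p F out \<and> F \<subseteq> L \<and> \<Gamma> T = rep out"
  shows "arithmetic_algorithm \<Omega> \<Lambda> M rep \<Gamma>"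
  unfolding arithmetic_algorithm_def
proof (intro conjI exI[of _ "\<lambda>_. L"] exI[of _ p] ballI impI)
  fix T S assume "T \<in> \<Omega>" "S \<in> \<Omega>" "\<forall>f\<in>L. f T = f S"
  then show "\<Gamma> S = \<Gamma> T" using cong by blast
qed (rule L refl funcsetI \<Gamma> runs | assumption)+

section \<open>The algorithm\<close>

lemma floor_grid:
  fixes r :: real and M B :: nat
  assumes M: "M > 0"
  shows "\<bar>r - of_int \<lfloor>r * real M\<rfloor> / real M\<bar> \<le> 1 / real M"
    and "\<bar>r\<bar> \<le> real B \<Longrightarrow> \<lfloor>r * real M\<rfloor> \<in> {- int (B * M)..int (B * M)}"
proof -
  have "r - of_int \<lfloor>r * real M\<rfloor> / real M = (r * real M - of_int \<lfloor>r * real M\<rfloor>) / real M"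
    using M by (simp add: field_simps)
  moreover have "\<bar>r * real M - of_int \<lfloor>r * real M\<rfloor>\<bar> \<le> 1"
    using of_int_floor_le[of "r * real M"] floor_correct[of "r * real M"] by linarith
  ultimately show "\<bar>r - of_int \<lfloor>r * real M\<rfloor> / real M\<bar> \<le> 1 / real M"
    by (simp add: divide_right_mono)
next
  assume "\<bar>r\<bar> \<le> real B"
  then have "\<bar>r * real M\<bar> \<le> real B * real M" by (simp add: abs_mult mult_right_mono)
  then have "- real (B * M) \<le> r * real M" "r * real M \<le> real (B * M)" by (simp_all add: abs_le_iff)
  then have "- int (B * M) \<le> \<lfloor>r * real M\<rfloor>" "\<lfloor>r * real M\<rfloor> \<le> int (B * M)"
    by (simp_all add: le_floor_iff floor_le_iff)
  then show "\<lfloor>r * real M\<rfloor> \<in> {- int (B * M)..int (B * M)}" by simp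
qed

definition rat_grid :: "nat \<Rightarrow> nat \<Rightarrow> rat set" where
  "rat_grid B M = (\<lambda>j. of_int j / of_nat M) ` {- int (B * M)..int (B * M)}"

lemma finite_rat_grid: "finite (rat_grid B M)"
  by (simp add: rat_grid_def)

lemma rat_grid_approx:
  assumes "M > 0" "\<bar>r\<bar> \<le> real B"
  obtains q where "q \<in> rat_grid B M" "\<bar>r - of_rat q\<bar> \<le> 1 / real M"
proof (rule that[of "of_int \<lfloor>r * real M\<rfloor> / of_nat M"])
  show "of_int \<lfloor>r * real M\<rfloor> / of_nat M \<in> rat_grid B M"
    unfolding rat_grid_def using floor_grid(2)[OF assms] by (rule imageI)
  show "\<bar>r - of_rat (of_int \<lfloor>r * real M\<rfloor> / of_nat M)\<bar> \<le> 1 / real M"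
    using floor_grid(1)[OF assms(1), of r] by (simp add: of_rat_divide)
qed

definition cval :: "(nat \<Rightarrow> rat \<times> rat) \<Rightarrow> nat \<Rightarrow> complex" where
  "cval c i = Complex (of_rat (fst (c i))) (of_rat (snd (c i)))"

context exhaustion
begin

text \<open>Rounding a vector costs at most 2 k n / mesh, which the shifted compression amplifies by
  at most N + n + 1. The factors make (N + n + 5) times this error at most 2/(n+1); the surplus 4
  pays for the loss of norm. \<open>Suc (k n)\<close> keeps the mesh positive even if
  \<open>k n = 0\<close>.\<close>

definition mesh :: "nat \<Rightarrow> nat \<Rightarrow> nat" where
  "mesh n N = Suc (k n) * Suc n * (N + n + 5)"

text \<open>
  A trial is a candidate \<open>g\<close> for an eigenvalue of the compression together with the coordinates of
  a candidate eigenvector. It is accepted if its residual is nonpositive.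
\<close>

definition trials :: "nat \<Rightarrow> nat \<Rightarrow> (rat \<times> (nat \<Rightarrow> rat \<times> rat)) set" where
  "trials n N = rat_grid (Suc n) (Suc n) \<times>
    {c \<in> {1..k n} \<rightarrow>\<^sub>E (rat_grid 1 (mesh n N) \<times> rat_grid 1 (mesh n N)). \<exists>i\<in>{1..k n}. c i \<noteq> (0, 0)}"

text \<open>Coordinate j of \<open>P n (T \<cdot> y) - g *\<^sub>R y\<close>, where y is the trial
  vector and g the trial value.\<close>

definition trial_entry ::
  "nat \<Rightarrow> rat \<times> (nat \<Rightarrow> rat \<times> rat) \<Rightarrow> nat \<Rightarrow> (('h oper \<Rightarrow> complex) \<Rightarrow> complex) \<Rightarrow> complex" where
  "trial_entry n x j v = (\<Sum>i\<in>{1..k n}. cval (snd x) i *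
    (v (matrix_entry e i j n) - complex_of_real (if i = j then of_rat (fst x) else 0)))"

text \<open>Both sides of the acceptance condition are squared, as square roots are not arithmetic;
  16/(n+1)^2 is the square of the tolerance 4/(n+1).\<close>

definition residual ::
  "nat \<Rightarrow> rat \<times> (nat \<Rightarrow> rat \<times> rat) \<Rightarrow> (('h oper \<Rightarrow> complex) \<Rightarrow> complex) \<Rightarrow> real" where
  "residual n x v = (\<Sum>j\<in>{1..k n}. (Re (trial_entry n x j v))\<^sup>2 + (Im (trial_entry n x j v))\<^sup>2)
    - of_rat (16 / (of_nat (Suc n))\<^sup>2 * (\<Sum>i\<in>{1..k n}. (fst (snd x i))\<^sup>2 + (snd (snd x i))\<^sup>2))"

text \<open>A crude bound for the norm of the compression that avoids square roots by means of |a|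
  \<le> 1 + |a|^2.\<close>

definition matrix_size :: "nat \<Rightarrow> (('h oper \<Rightarrow> complex) \<Rightarrow> complex) \<Rightarrow> real" where
  "matrix_size n v = (\<Sum>i\<in>{1..k n}. \<Sum>j\<in>{1..k n}.
     1 + ((Re (v (matrix_entry e i j n)))\<^sup>2 + (Im (v (matrix_entry e i j n)))\<^sup>2))"

definition entries :: "nat \<Rightarrow> ('h oper \<Rightarrow> complex) set" where
  "entries n = (\<lambda>(i, j). matrix_entry e i j n) ` ({1..k n} \<times> {1..k n})"

definition least_size :: "nat \<Rightarrow> 'h oper \<Rightarrow> nat" where
  "least_size n T = (LEAST N. matrix_size n (\<lambda>f. f T) \<le> real N)"

definition approx_spectrum :: "nat \<Rightarrow> 'h oper \<Rightarrow> complex set" where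
  "approx_spectrum n T = {complex_of_real (of_rat (fst x)) |x.
     x \<in> trials n (least_size n T) \<and> residual n x (\<lambda>f. f T) \<le> 0}"

section \<open>The trial search as an arithmetic algorithm\<close>

lemma finite_trials: "finite (trials n N)"
  unfolding trials_def
  by (intro finite_cartesian_product finite_rat_grid finite_Collect_conjI disjI1)
    (simp add: finite_PiE finite_rat_grid)

lemma finite_approx_spectrum: "finite (approx_spectrum n T)"
proof -
  have "approx_spectrum n T \<subseteq> (\<lambda>x. complex_of_real (of_rat (fst x))) ` trials n (least_size n T)"
    unfolding approx_spectrum_def by blast
  then show ?thesis by (rule finite_surj[OF finite_trials])
qed

lemma entries_subset: "entries n \<subseteq> Lambda1 k e"
proof
  fix f assume "f \<in> entries n"
  then obtain i j where "f = matrix_entry e i j n" "i \<in> {1..k n}" "j \<in> {1..k n}"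
    by (auto simp: entries_def)
  then show "f \<in> Lambda1 k e" unfolding Lambda1_def by blast
qed

lemma in_entries: "i \<in> {1..k n} \<Longrightarrow> j \<in> {1..k n} \<Longrightarrow> matrix_entry e i j n \<in> entries n"
  by (auto simp: entries_def)

lemma arith_fun_matrix_size: "arith_fun (entries n) (matrix_size n)"
  unfolding matrix_size_def
  by (intro arith_fun_sum arith_fun_add arith_fun_power arith_fun_Re arith_fun_Im in_entries
      arith_fun_of_nat[of _ 1, simplified])

lemma arith_fun_residual: "arith_fun (entries n) (residual n x)"
proof -
  let ?p = "\<lambda>i. of_rat (fst (snd x i)) :: real" and ?q = "\<lambda>i. of_rat (snd (snd x i)) :: real"
  let ?d = "\<lambda>i j. of_rat (if i = j then fst x else 0) :: real"
  let ?f = "\<lambda>i j. matrix_entry e i j n"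
  have Re: "Re (trial_entry n x j v) = (\<Sum>i\<in>{1..k n}. ?p i * (Re (v (?f i j)) - ?d i j) - ?q i * Im (v (?f i j)))"
    for j v by (auto simp: trial_entry_def cval_def intro!: sum.cong)
  have Im: "Im (trial_entry n x j v) = (\<Sum>i\<in>{1..k n}. ?p i * Im (v (?f i j)) + ?q i * (Re (v (?f i j)) - ?d i j))"
    for j v by (auto simp: trial_entry_def cval_def intro!: sum.cong)
  show ?thesis
    unfolding residual_def Re Im
    by (intro arith_fun_sum arith_fun_add arith_fun_diff arith_fun_mult arith_fun_power
        arith_fun_Re arith_fun_Im in_entries arith_fun_const)
qed

lemma arithmetic_algorithm_approx_spectrum:
  "arithmetic_algorithm \<Omega> (Lambda1 k e) aw_metric set (approx_spectrum n)"
proof -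
  obtain p where p: "\<And>v. \<exists>F res. runs v p F res \<and> F \<subseteq> entries n \<and>
    set res = {complex_of_real (of_rat (fst x)) |x.
      x \<in> trials n (LEAST N. matrix_size n v \<le> real N) \<and> residual n x v \<le> 0}"
    using selection_program[where X = "trials n" and \<phi> = "\<lambda>N. residual n" and g = fst,
        OF arith_fun_matrix_size finite_trials arith_fun_residual] by blast
  show ?thesis
  proof (rule arithmetic_algorithmI[of "entries n" _ _ _ _ p])
    show "finite (entries n)" by (simp add: entries_def)
    show "entries n \<subseteq> Lambda1 k e" by (rule entries_subset)
    fix T :: "'h oper"
    show "approx_spectrum n T \<in> mspace aw_metric"
      using finite_approx_spectrum by (simp add: finite_imp_closed)
    show "\<exists>F out. runs (\<lambda>f. f T) p F out \<and> F \<subseteq> entries n \<and> approx_spectrum n T = set out"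
      using p[of "\<lambda>f. f T"] unfolding approx_spectrum_def least_size_def by metis
  next
    fix S T :: "'h oper" assume eq: "\<And>f. f \<in> entries n \<Longrightarrow> f T = f S"
    have "matrix_size n (\<lambda>f. f T) = matrix_size n (\<lambda>f. f S)"
      by (rule arith_fun_cong[OF arith_fun_matrix_size eq])
    moreover have "residual n x (\<lambda>f. f T) = residual n x (\<lambda>f. f S)" for x
      by (rule arith_fun_cong[OF arith_fun_residual eq])
    ultimately show "approx_spectrum n S = approx_spectrum n T"
      by (simp only: approx_spectrum_def least_size_def)
  qed
qed

section \<open>Coordinates in \<open>H n\<close>\<close>

lemma P_sum: "P n (sum f I) = (\<Sum>i\<in>I. P n (f i))"
proof (induction I rule: infinite_finite_induct)
  case (insert i I)
  then show ?case by (simp add: P_add)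
qed (simp_all add: P_def)

lemma norm_e: "i \<in> {1..k n} \<Longrightarrow> norm (e n i) = 1"
  using e_inner[of i n i] Re_cinner_self[of "e n i"] norm_ge_zero[of "e n i"] by (simp add: power2_eq_1_iff)

lemma norm_sum_e_square: "(norm (\<Sum>i\<in>{1..k n}. c i *\<^sub>C e n i))\<^sup>2 = (\<Sum>i\<in>{1..k n}. (cmod (c i))\<^sup>2)"
proof -
  let ?x = "\<Sum>i\<in>{1..k n}. c i *\<^sub>C e n i"
  have "complex_of_real ((norm ?x)\<^sup>2) = (\<Sum>i\<in>{1..k n}. cnj (c i) * cinner ?x (e n i))"
    unfolding cinner_self[symmetric] cinner.sum_right by (simp only: cinner_scaleC_right)
  also have "\<dots> = (\<Sum>i\<in>{1..k n}. cnj (c i) * c i)"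
    by (intro sum.cong refl arg_cong2[of _ _ _ _ "(*)"] cinner_sum_e)
  also have "\<dots> = complex_of_real (\<Sum>i\<in>{1..k n}. (cmod (c i))\<^sup>2)"
    unfolding of_real_sum by (intro sum.cong refl) (simp only: complex_norm_square mult.commute)
  finally show ?thesis using of_real_eq_iff by blast
qed

lemma H_expand: "x \<in> H n \<Longrightarrow> x = (\<Sum>i\<in>{1..k n}. cinner x (e n i) *\<^sub>C e n i)"
  using P_id[of x n] by (simp add: P_def)

lemma H_eqI:
  assumes "x \<in> H n" "y \<in> H n" "\<And>j. j \<in> {1..k n} \<Longrightarrow> cinner x (e n j) = cinner y (e n j)"
  shows "x = y"
  by (subst H_expand[OF assms(1)], subst H_expand[OF assms(2)]) (use assms(3) in simp)

end

context core_exhausted_oper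
begin

section \<open>Compressions of the operator\<close>

lemma app_sum_e:
  "T \<cdot> (\<Sum>i\<in>{1..k n}. c i *\<^sub>C e n i) = (\<Sum>i\<in>{1..k n}. c i *\<^sub>C (T \<cdot> e n i))"
proof -
  have e_dom: "e n i \<in> dom T" if "i \<in> {1..k n}" for i using e_in_H[OF that] by (rule H_dom)
  have "T \<cdot> (\<Sum>i\<in>{1..k n}. c i *\<^sub>C e n i) = (\<Sum>i\<in>{1..k n}. T \<cdot> (c i *\<^sub>C e n i))"
    by (rule app_sum) (rule dom_scaleC[OF e_dom])
  also have "\<dots> = (\<Sum>i\<in>{1..k n}. c i *\<^sub>C (T \<cdot> e n i))"
    by (intro sum.cong refl app_scaleC e_dom)
  finally show ?thesis .
qed

lemma compression_symmetric: "x \<in> H n \<Longrightarrow> y \<in> H n \<Longrightarrow> cinner (P n (T \<cdot> x)) y = cinner x (P n (T \<cdot> y))"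
  using symmetric[OF H_dom H_dom] by (simp add: cinner_P cinner_P_right)

lemma norm_compression_e:
  assumes i: "i \<in> {1..k n}"
  shows "norm (P n (T \<cdot> e n i)) \<le> (\<Sum>j\<in>{1..k n}. 1 + (cmod (matrix_entry e i j n T))\<^sup>2)"
proof -
  have "norm (P n (T \<cdot> e n i)) \<le> (\<Sum>j\<in>{1..k n}. norm (cinner (T \<cdot> e n i) (e n j) *\<^sub>C e n j))"
    unfolding P_def by (rule norm_sum)
  also have "\<dots> \<le> (\<Sum>j\<in>{1..k n}. 1 + (cmod (matrix_entry e i j n T))\<^sup>2)"
  proof (rule sum_mono)
    fix j assume j: "j \<in> {1..k n}"
    have "norm (cinner (T \<cdot> e n i) (e n j) *\<^sub>C e n j) = cmod (matrix_entry e i j n T)"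
      by (simp add: norm_scaleC matrix_entry_def norm_e[OF j])
    also have "\<dots> \<le> 1 + (cmod (matrix_entry e i j n T))\<^sup>2"
      using zero_le_power2[of "cmod (matrix_entry e i j n T) - 1"] by (simp add: power2_diff)
        (use zero_le_power2[of "cmod (matrix_entry e i j n T)"] in linarith)
    finally show "norm (cinner (T \<cdot> e n i) (e n j) *\<^sub>C e n j) \<le> \<dots>" .
  qed
  finally show ?thesis .
qed

lemma norm_compression:
  assumes x: "x \<in> H n"
  shows "norm (P n (T \<cdot> x)) \<le> matrix_size n (\<lambda>f. f T) * norm x"
proof -
  have Tx: "T \<cdot> x = (\<Sum>i\<in>{1..k n}. cinner x (e n i) *\<^sub>C (T \<cdot> e n i))"
    by (subst H_expand[OF x]) (rule app_sum_e)
  have "norm (P n (T \<cdot> x)) \<le> (\<Sum>i\<in>{1..k n}. norm (cinner x (e n i) *\<^sub>C P n (T \<cdot> e n i)))"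
    unfolding Tx P_sum P_scaleC by (rule norm_sum)
  also have "\<dots> \<le> (\<Sum>i\<in>{1..k n}. (\<Sum>j\<in>{1..k n}. 1 + (cmod (matrix_entry e i j n T))\<^sup>2) * norm x)"
  proof (rule sum_mono)
    fix i assume i: "i \<in> {1..k n}"
    have "norm (cinner x (e n i) *\<^sub>C P n (T \<cdot> e n i)) = cmod (cinner x (e n i)) * norm (P n (T \<cdot> e n i))"
      by (rule norm_scaleC)
    also have "\<dots> \<le> norm x * (\<Sum>j\<in>{1..k n}. 1 + (cmod (matrix_entry e i j n T))\<^sup>2)"
      using cinner_Cauchy_Schwarz[of x "e n i"] norm_e[OF i] norm_compression_e[OF i] by (intro mult_mono) auto
    finally show "norm (cinner x (e n i) *\<^sub>C P n (T \<cdot> e n i))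
      \<le> (\<Sum>j\<in>{1..k n}. 1 + (cmod (matrix_entry e i j n T))\<^sup>2) * norm x" by (simp only: mult.commute)
  qed
  also have "\<dots> = matrix_size n (\<lambda>f. f T) * norm x"
    by (simp add: matrix_size_def sum_distrib_right cmod_power2)
  finally show ?thesis .
qed

text \<open>The added 1 secures a positive constant when \<open>k n = 0\<close> and
  \<open>matrix_size\<close> vanishes.\<close>

lemma compression_bounded_symmetric:
  "bounded_symmetric_on (H n) (\<lambda>x. P n (T \<cdot> x)) (matrix_size n (\<lambda>f. f T) + 1)"
proof
  have "matrix_size n (\<lambda>f. f T) \<ge> 0"
    unfolding matrix_size_def by (intro sum_nonneg add_nonneg_nonneg) auto
  then show "matrix_size n (\<lambda>f. f T) + 1 > 0" by simp
  fix x assume "x \<in> H n"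
  from norm_compression[OF this] show "norm (P n (T \<cdot> x)) \<le> (matrix_size n (\<lambda>f. f T) + 1) * norm x"
    by (simp add: distrib_right add_increasing2)
qed (simp_all add: H_subspace P_in_H app_add[OF H_dom H_dom] app_scaleC[OF H_dom] P_add P_scaleC
    compression_symmetric)

lemma matrix_size_le_least: "matrix_size n (\<lambda>f. f T) \<le> real (least_size n T)"
proof -
  obtain N where "matrix_size n (\<lambda>f. f T) \<le> real N" using real_arch_simple by blast
  then show ?thesis unfolding least_size_def by (rule LeastI)
qed

text \<open>Parseval's identity in \<open>H n\<close>. The comparison itself is exact; rounding
  enters only through the choice of the trials.\<close>

lemma residual_nonpos_iff:
  fixes n x
  defines "y \<equiv> (\<Sum>i\<in>{1..k n}. cval (snd x) i *\<^sub>C e n i)"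
  shows "residual n x (\<lambda>f. f T) \<le> 0 \<longleftrightarrow>
    norm (P n (T \<cdot> y) - of_rat (fst x) *\<^sub>R y) \<le> 4 / real (Suc n) * norm y"
proof -
  let ?g = "of_rat (fst x) :: real"
  have yH: "y \<in> H n" unfolding y_def by (rule sum_e_in_H)
  have Ty: "T \<cdot> y = (\<Sum>i\<in>{1..k n}. cval (snd x) i *\<^sub>C (T \<cdot> e n i))"
    unfolding y_def by (rule app_sum_e)
  have "P n (T \<cdot> y) - ?g *\<^sub>R y = (\<Sum>j\<in>{1..k n}. trial_entry n x j (\<lambda>f. f T) *\<^sub>C e n j)"
  proof (rule H_eqI)
    show "P n (T \<cdot> y) - ?g *\<^sub>R y \<in> H n"
      using H_subspace P_in_H yH by (intro complex_vector.subspace_diff csubspace_scaleR)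
    fix j assume j: "j \<in> {1..k n}"
    have "cinner (P n (T \<cdot> y) - ?g *\<^sub>R y) (e n j)
        = (\<Sum>i\<in>{1..k n}. cval (snd x) i * matrix_entry e i j n T) - complex_of_real ?g * cval (snd x) j"
    proof -
      have "cinner y (e n j) = cval (snd x) j" unfolding y_def by (rule cinner_sum_e[OF j])
      then show ?thesis
        by (simp add: cinner.diff_left cinner_P_e[OF j] Ty cinner.sum_left cinner_scaleC_left
            matrix_entry_def cinner_scaleR_left)
    qed
    also have "complex_of_real ?g * cval (snd x) j
        = (\<Sum>i\<in>{1..k n}. cval (snd x) i * complex_of_real (if i = j then ?g else 0))"
      using j by (simp add: if_distrib[of complex_of_real] if_distrib[of "(*) _"] sum.delta cong: if_cong)
    also have "(\<Sum>i\<in>{1..k n}. cval (snd x) i * matrix_entry e i j n T) - \<dots> = trial_entry n x j (\<lambda>f. f T)"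
      by (simp only: trial_entry_def sum_subtractf[symmetric] right_diff_distrib)
    finally show "cinner (P n (T \<cdot> y) - ?g *\<^sub>R y) (e n j)
      = cinner (\<Sum>j\<in>{1..k n}. trial_entry n x j (\<lambda>f. f T) *\<^sub>C e n j) (e n j)"
      by (simp only: cinner_sum_e[OF j])
  qed (rule sum_e_in_H)
  then have "(norm (P n (T \<cdot> y) - ?g *\<^sub>R y))\<^sup>2
      = (\<Sum>j\<in>{1..k n}. (Re (trial_entry n x j (\<lambda>f. f T)))\<^sup>2 + (Im (trial_entry n x j (\<lambda>f. f T)))\<^sup>2)"
    by (simp only: norm_sum_e_square cmod_power2)
  moreover have "(4 / real (Suc n) * norm y)\<^sup>2
      = of_rat (16 / (of_nat (Suc n))\<^sup>2 * (\<Sum>i\<in>{1..k n}. (fst (snd x i))\<^sup>2 + (snd (snd x i))\<^sup>2))"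
  proof -
    have "(norm y)\<^sup>2 = of_rat (\<Sum>i\<in>{1..k n}. (fst (snd x i))\<^sup>2 + (snd (snd x i))\<^sup>2)"
      unfolding y_def norm_sum_e_square by (simp add: cmod_power2 cval_def of_rat_sum of_rat_add of_rat_power)
    moreover have "(4 / real (Suc n))\<^sup>2 = of_rat (16 / (of_nat (Suc n))\<^sup>2)"
      by (simp add: of_rat_divide of_rat_power power_divide of_rat_add)
    ultimately show ?thesis by (simp only: power_mult_distrib of_rat_mult)
  qed
  ultimately have "residual n x (\<lambda>f. f T) \<le> 0 \<longleftrightarrow>
      (norm (P n (T \<cdot> y) - ?g *\<^sub>R y))\<^sup>2 \<le> (4 / real (Suc n) * norm y)\<^sup>2"
    by (simp only: residual_def) simp
  then show ?thesis by (simp add: abs_le_square_iff[symmetric])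
qed

lemma approx_spectrum_sound:
  assumes "z \<in> approx_spectrum n T"
  obtains g y where "z = complex_of_real g" "y \<in> H n" "norm y = 1"
    "norm (P n (T \<cdot> y) - g *\<^sub>R y) \<le> 4 / real (Suc n)"
proof -
  obtain x where x: "x \<in> trials n (least_size n T)" and z: "z = complex_of_real (of_rat (fst x))"
    and r: "residual n x (\<lambda>f. f T) \<le> 0" using assms by (auto simp: approx_spectrum_def)
  define y where "y = (\<Sum>i\<in>{1..k n}. cval (snd x) i *\<^sub>C e n i)"
  have y: "norm (P n (T \<cdot> y) - of_rat (fst x) *\<^sub>R y) \<le> 4 / real (Suc n) * norm y"
    using r unfolding residual_nonpos_iff y_def .
  have yH: "y \<in> H n" unfolding y_def by (rule sum_e_in_H)
  \<comment> \<open>A zero trial vector would accept every g; its exclusion from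
    \<open>trials\<close> makes y normalisable.\<close>
  obtain i where i: "i \<in> {1..k n}" "snd x i \<noteq> (0, 0)" using x by (auto simp: trials_def)
  have "cval (snd x) i \<noteq> 0" using i(2) by (auto simp: cval_def complex_eq_iff prod_eq_iff)
  then have "y \<noteq> 0" using cinner_sum_e[OF i(1), of "cval (snd x)"] by (auto simp: y_def)
  then have pos: "norm y > 0" by simp
  define u where "u = (1 / norm y) *\<^sub>R y"
  have "P n (T \<cdot> u) - of_rat (fst x) *\<^sub>R u = (1 / norm y) *\<^sub>R (P n (T \<cdot> y) - of_rat (fst x) *\<^sub>R y)"
    by (simp add: u_def app_scaleR H_dom[OF yH] P_scaleR algebra_simps)
  then have "norm (P n (T \<cdot> u) - of_rat (fst x) *\<^sub>R u)
      = norm (P n (T \<cdot> y) - of_rat (fst x) *\<^sub>R y) / norm y" by simp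
  also have "\<dots> \<le> 4 / real (Suc n)" using y pos by (subst pos_divide_le_eq) auto
  finally show ?thesis
    using that[OF z, of u] yH pos H_subspace by (auto simp: u_def csubspace_scaleR)
qed

text \<open>Origin of the constant 4. With h = 1/(n+1), the residual of y and the rounding of \<mu>
  cost h each; rounding y to u costs (N + n + 1) \<delta>. Since (N + n + 5) \<delta> \<le> 2 h, the
  total is at most 4 h - 4 \<delta> \<le> 4 h (1 - \<delta>) \<le> 4 h |u|.\<close>

lemma approx_spectrum_complete:
  assumes y: "y \<in> H n" "norm y = 1" and \<mu>: "\<bar>\<mu>\<bar> \<le> real n"
    and res: "norm (P n (T \<cdot> y) - \<mu> *\<^sub>R y) \<le> 1 / real (Suc n)"
  shows "\<exists>z\<in>approx_spectrum n T. dist z (complex_of_real \<mu>) \<le> 1 / real (Suc n)"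
proof -
  define h where "h = 1 / real (Suc n)"
  define N where "N = least_size n T"
  define M where "M = mesh n N"
  have M: "M > 0" by (simp add: M_def mesh_def)
  obtain g where g: "g \<in> rat_grid (Suc n) (Suc n)" "\<bar>\<mu> - of_rat g\<bar> \<le> h"
    using rat_grid_approx[of "Suc n" \<mu> "Suc n"] \<mu> unfolding h_def by auto
  have h1: "h \<le> 1" "h > 0" by (auto simp: h_def)
  have "\<exists>c. fst c \<in> rat_grid 1 M \<and> snd c \<in> rat_grid 1 M \<and>
      cmod (cinner y (e n i) - Complex (of_rat (fst c)) (of_rat (snd c))) \<le> 2 / real M"
    if i: "i \<in> {1..k n}" for i
  proof -
    let ?w = "cinner y (e n i)"
    have w: "cmod ?w \<le> 1" using cinner_Cauchy_Schwarz[of y "e n i"] y(2) norm_e[OF i] by simp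
    obtain a where a: "a \<in> rat_grid 1 M" "\<bar>Re ?w - of_rat a\<bar> \<le> 1 / real M"
      using rat_grid_approx[OF M, of "Re ?w" 1] w abs_Re_le_cmod[of ?w] by auto
    obtain b where b: "b \<in> rat_grid 1 M" "\<bar>Im ?w - of_rat b\<bar> \<le> 1 / real M"
      using rat_grid_approx[OF M, of "Im ?w" 1] w abs_Im_le_cmod[of ?w] by auto
    have "cmod (?w - Complex (of_rat a) (of_rat b)) \<le> 2 / real M"
      using cmod_le[of "?w - Complex (of_rat a) (of_rat b)"] a(2) b(2) by simp
    then show ?thesis using a b by (intro exI[of _ "(a, b)"]) simp
  qed
  then obtain c0 where c0: "\<And>i. i \<in> {1..k n} \<Longrightarrow> fst (c0 i) \<in> rat_grid 1 M \<and> snd (c0 i) \<in> rat_grid 1 M \<and>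
      cmod (cinner y (e n i) - Complex (of_rat (fst (c0 i))) (of_rat (snd (c0 i)))) \<le> 2 / real M" by metis
  define c where "c = restrict c0 {1..k n}"
  have c: "c \<in> {1..k n} \<rightarrow>\<^sub>E rat_grid 1 M \<times> rat_grid 1 M"
    using c0 by (auto simp: c_def PiE_def mem_Times_iff)
  have c_approx: "cmod (cinner y (e n i) - cval c i) \<le> 2 / real M" if "i \<in> {1..k n}" for i
    using c0[OF that] that by (simp add: c_def cval_def)
  define u where "u = (\<Sum>i\<in>{1..k n}. cval c i *\<^sub>C e n i)"
  have uH: "u \<in> H n" unfolding u_def by (rule sum_e_in_H)
  define \<delta> where "\<delta> = real (k n) * (2 / real M)"
  have yu: "norm (y - u) \<le> \<delta>"
  proof -
    have "y - u = (\<Sum>i\<in>{1..k n}. (cinner y (e n i) - cval c i) *\<^sub>C e n i)"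
      by (subst H_expand[OF y(1)]) (simp only: u_def scaleC.diff_left sum_subtractf)
    then have "norm (y - u) \<le> (\<Sum>i\<in>{1..k n}. norm ((cinner y (e n i) - cval c i) *\<^sub>C e n i))"
      by (simp only: norm_sum)
    also have "\<dots> \<le> (\<Sum>i\<in>{1..k n}. 2 / real M)"
    proof (rule sum_mono)
      fix i assume i: "i \<in> {1..k n}"
      show "norm ((cinner y (e n i) - cval c i) *\<^sub>C e n i) \<le> 2 / real M"
        using c_approx[OF i] by (simp add: norm_scaleC norm_e[OF i])
    qed
    also have "\<dots> = \<delta>" by (simp add: \<delta>_def)
    finally show ?thesis .
  qed
  have \<delta>: "(real N + real n + 5) * \<delta> \<le> 2 * h"
  proof -
    have "(real N + real n + 5) * \<delta> = real (k n) / real (Suc (k n)) * (2 * h)"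
    proof -
      define Q where "Q = real N + real n + 5"
      have "Q > 0" by (simp add: Q_def)
      moreover have "real M = real (Suc (k n)) * real (Suc n) * Q"
        by (simp only: M_def mesh_def of_nat_mult) (simp add: Q_def)
      ultimately show ?thesis unfolding Q_def[symmetric] \<delta>_def h_def by (simp add: divide_simps)
    qed
    also have "\<dots> \<le> 1 * (2 * h)" using h1 by (intro mult_right_mono) auto
    finally show ?thesis by simp
  qed
  have \<delta>0: "\<delta> \<ge> 0" by (simp add: \<delta>_def)
  have "5 * \<delta> \<le> (real N + real n + 5) * \<delta>" using \<delta>0 by (intro mult_right_mono) auto
  then have \<delta>1: "\<delta> < 1" using \<delta> h1 by linarith
  have nu: "norm u \<ge> 1 - \<delta>" using norm_triangle_ineq2[of y u] yu y(2) by linarith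
  have "\<exists>i\<in>{1..k n}. c i \<noteq> (0, 0)"
  proof (rule ccontr)
    assume "\<not> ?thesis"
    then have "u = 0" by (auto simp: u_def cval_def intro!: sum.neutral simp flip: zero_complex.code)
    then show False using nu \<delta>1 by simp
  qed
  then have x: "(g, c) \<in> trials n N" using g c by (simp add: trials_def M_def)
  interpret A: bounded_symmetric_on "H n" "\<lambda>x. P n (T \<cdot> x)" "matrix_size n (\<lambda>f. f T) + 1"
    by (rule compression_bounded_symmetric)
  let ?A = "\<lambda>x. P n (T \<cdot> x) - of_rat g *\<^sub>R x"
  have "norm (?A y) \<le> 2 * h"
  proof -
    have "?A y = (P n (T \<cdot> y) - \<mu> *\<^sub>R y) + (\<mu> - of_rat g) *\<^sub>R y" by (simp add: algebra_simps)
    then have "norm (?A y) \<le> norm (P n (T \<cdot> y) - \<mu> *\<^sub>R y) + norm ((\<mu> - of_rat g) *\<^sub>R y)"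
      using norm_triangle_ineq by metis
    then show ?thesis using res g(2) y(2) by (simp add: h_def)
  qed
  moreover have "norm (?A (y - u)) \<le> (real N + real n + 1) * \<delta>"
  proof -
    have yuH: "y - u \<in> H n" using y(1) uH H_subspace by (intro complex_vector.subspace_diff)
    have "\<bar>of_rat g\<bar> \<le> real n + 1" using g(2) \<mu> h1 by linarith
    then have "norm (of_rat g *\<^sub>R (y - u)) \<le> (real n + 1) * norm (y - u)" by (simp add: mult_right_mono)
    moreover have "norm (P n (T \<cdot> (y - u))) \<le> real N * norm (y - u)"
      using norm_compression[OF yuH] mult_right_mono[OF matrix_size_le_least, of "norm (y - u)" n]
      by (simp add: N_def)
    ultimately have "norm (?A (y - u)) \<le> real N * norm (y - u) + (real n + 1) * norm (y - u)"
      using norm_triangle_ineq4[of "P n (T \<cdot> (y - u))" "of_rat g *\<^sub>R (y - u)"] by linarith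
    also have "\<dots> = (real N + real n + 1) * norm (y - u)" by (simp add: algebra_simps)
    also have "\<dots> \<le> (real N + real n + 1) * \<delta>" using yu by (intro mult_left_mono) auto
    finally show ?thesis .
  qed
  moreover have "?A u = ?A y - ?A (y - u)"
    using y(1) uH by (simp add: A.diff algebra_simps)
  then have "norm (?A u) \<le> norm (?A y) + norm (?A (y - u))" by (simp only: norm_triangle_ineq4)
  ultimately have Au: "norm (?A u) \<le> 2 * h + (real N + real n + 1) * \<delta>" by linarith
  have "(real N + real n + 1) * \<delta> + 4 * \<delta> \<le> 2 * h" using \<delta> by (simp add: algebra_simps)
  then have "2 * h + (real N + real n + 1) * \<delta> \<le> 4 * h - 4 * \<delta>" by linarith
  also have "\<dots> \<le> 4 * h * (1 - \<delta>)" using mult_right_mono[OF h1(1) \<delta>0] by (simp add: algebra_simps)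
  also have "\<dots> \<le> 4 * h * norm u" using nu h1 by (intro mult_left_mono) auto
  finally have "norm (?A u) \<le> 4 / real (Suc n) * norm u" using Au by (simp add: h_def)
  then have "residual n (g, c) (\<lambda>f. f T) \<le> 0" unfolding residual_nonpos_iff by (simp add: u_def)
  then have "complex_of_real (of_rat g) \<in> approx_spectrum n T"
    using x unfolding approx_spectrum_def N_def by force
  moreover have "dist (complex_of_real (of_rat g)) (complex_of_real \<mu>) \<le> 1 / real (Suc n)"
    using g(2) by (simp add: h_def dist_of_real dist_real_def abs_minus_commute)
  ultimately show ?thesis by blast
qed

text \<open>\<open>P n\<close> contracts, so the compression has no larger residual than T at a
  vector of \<open>H n\<close>. \<open>approx_eigenvalue_near\<close> moves l by at most
  \<epsilon>/2 to reach the residual 1/(n+1), which the grid detects.\<close>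

lemma approx_spectrum_inner:
  assumes z: "z \<in> spectrum T" and \<epsilon>: "\<epsilon> > 0"
  shows "\<forall>\<^sub>F n in sequentially. \<exists>w\<in>approx_spectrum n T. dist w z < \<epsilon>"
proof -
  obtain l where l: "z = complex_of_real l" using spectrum_real[OF z] by (auto elim: Reals_cases)
  obtain m x where x: "x \<in> H m" "norm x = 1" "norm (T \<cdot> x - l *\<^sub>R x) < \<epsilon> / 2"
    using approx_eigenvector_in_H[of l "\<epsilon> / 2"] z \<epsilon> unfolding l by auto
  \<comment> \<open>Keeps the moved point \<mu> inside the window that the grid covers.\<close>
  obtain n0 where n0: "\<bar>l\<bar> + \<epsilon> \<le> real n0" using real_arch_simple by blast
  have "\<forall>\<^sub>F n in sequentially. 1 / real (Suc n) < \<epsilon> / 2"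
    using order_tendstoD(2)[OF LIMSEQ_Suc[OF lim_1_over_n], of "\<epsilon> / 2"] \<epsilon> by simp
  with eventually_ge_at_top[of "max m n0"] show ?thesis
  proof eventually_elim
    case (elim n)
    interpret A: bounded_symmetric_on "H n" "\<lambda>x. P n (T \<cdot> x)" "matrix_size n (\<lambda>f. f T) + 1"
      by (rule compression_bounded_symmetric)
    have xn: "x \<in> H n" using x(1) H_mono[of m n] elim(1) by auto
    have "P n (T \<cdot> x) - l *\<^sub>R x = P n (T \<cdot> x - l *\<^sub>R x)" by (simp add: P_diff P_scaleR P_id[OF xn])
    then have "norm (P n (T \<cdot> x) - l *\<^sub>R x) \<le> \<epsilon> / 2" using norm_P[of n "T \<cdot> x - l *\<^sub>R x"] x(3) by simp
    then obtain \<mu> u where \<mu>: "\<bar>\<mu> - l\<bar> \<le> \<epsilon> / 2" and u: "u \<in> H n" "norm u = 1"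
        "norm (P n (T \<cdot> u) - \<mu> *\<^sub>R u) \<le> 1 / real (Suc n)"
      using A.approx_eigenvalue_near[OF xn x(2), of l "\<epsilon> / 2" "1 / real (Suc n)"] by auto
    have "real n0 \<le> real n" using elim(1) by simp
    then have "\<bar>\<mu>\<bar> \<le> real n" using \<mu> n0 \<epsilon> by linarith
    from approx_spectrum_complete[OF u(1,2) this u(3)]
    obtain w where w: "w \<in> approx_spectrum n T" "dist w (complex_of_real \<mu>) \<le> 1 / real (Suc n)" by blast
    have "dist w z \<le> dist w (complex_of_real \<mu>) + dist (complex_of_real \<mu>) z" by (rule dist_triangle)
    also have "dist (complex_of_real \<mu>) z \<le> \<epsilon> / 2" using \<mu> by (simp add: l dist_of_real dist_real_def)
    finally have "dist w z < \<epsilon>" using w(2) elim(2) by linarith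
    with w(1) show ?case by blast
  qed
qed

text \<open>Nonreal points are avoided because all outputs are real; accumulation at a real point
  yields the family refuted by \<open>no_spectral_pollution\<close>.\<close>

lemma approx_spectrum_outer:
  assumes convex: "ereal_convex (ext_ess_spectrum T)" and z: "z \<notin> spectrum T"
  shows "\<exists>\<epsilon>>0. \<forall>\<^sub>F n in sequentially. approx_spectrum n T \<inter> ball z \<epsilon> = {}"
proof (cases "z \<in> \<real>")
  case False
  then have "Im z \<noteq> 0" by (simp add: complex_is_Real_iff)
  moreover have "approx_spectrum n T \<inter> ball z \<bar>Im z\<bar> = {}" for n
  proof -
    have "w \<notin> ball z \<bar>Im z\<bar>" if w: "w \<in> approx_spectrum n T" for w
    proof -
      obtain g where "w = complex_of_real g" using w by (auto simp: approx_spectrum_def)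
      then show ?thesis using abs_Im_le_cmod[of "z - w"] by (simp add: dist_norm)
    qed
    then show ?thesis by blast
  qed
  ultimately show ?thesis by (intro exI[of _ "\<bar>Im z\<bar>"]) simp
next
  case True
  then obtain l where l: "z = complex_of_real l" by (auto elim: Reals_cases)
  show ?thesis
  proof (rule ccontr)
    assume contr: "\<not> ?thesis"
    have ex: "\<exists>n g y. j \<le> n \<and> \<bar>g - l\<bar> < 1 / real (Suc j) \<and> y \<in> H n \<and> norm y = 1 \<and>
        norm (P n (T \<cdot> y) - g *\<^sub>R y) \<le> 4 / real (Suc n)" for j
    proof -
      have "\<not> (\<forall>\<^sub>F n in sequentially. approx_spectrum n T \<inter> ball z (1 / real (Suc j)) = {})"
        using contr by (metis of_nat_0_less_iff zero_less_Suc zero_less_divide_1_iff)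
      then obtain n where "j \<le> n" "approx_spectrum n T \<inter> ball z (1 / real (Suc j)) \<noteq> {}"
        unfolding eventually_sequentially by blast
      then obtain w where n: "j \<le> n" "w \<in> approx_spectrum n T" "dist z w < 1 / real (Suc j)"
        by auto
      obtain g y where gy: "w = complex_of_real g" "y \<in> H n" "norm y = 1"
          "norm (P n (T \<cdot> y) - g *\<^sub>R y) \<le> 4 / real (Suc n)"
        using approx_spectrum_sound[OF n(2)] by blast
      have "\<bar>g - l\<bar> < 1 / real (Suc j)"
        using n(3) by (simp add: l gy(1) dist_of_real dist_real_def abs_minus_commute)
      then show ?thesis using n(1) gy by blast
    qed
    obtain n g y where n: "\<And>j. j \<le> n j" and g: "\<And>j. \<bar>g j - l\<bar> < 1 / real (Suc j)"
      and y: "\<And>j. y j \<in> H (n j)" "\<And>j. norm (y j) = 1"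
      and res: "\<And>j. norm (P (n j) (T \<cdot> y j) - g j *\<^sub>R y j) \<le> 4 / real (Suc (n j))"
      using ex by metis
    have inv: "(\<lambda>j. c / real (Suc j)) \<longlonglongrightarrow> 0" for c :: real
      by (rule LIMSEQ_Suc) (rule lim_const_over_n)
    have g_lim: "g \<longlonglongrightarrow> l"
    proof (rule LIM_zero_cancel, rule Lim_null_comparison[OF _ inv[of 1]])
      show "\<forall>\<^sub>F j in sequentially. norm (g j - l) \<le> 1 / real (Suc j)"
        using g by (intro always_eventually allI) (simp add: less_imp_le)
    qed
    have res_lim: "(\<lambda>j. P (n j) (T \<cdot> y j) - g j *\<^sub>R y j) \<longlonglongrightarrow> 0"
    proof (rule Lim_null_comparison[OF _ inv[of 4]], intro always_eventually allI)
      fix j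
      have "4 / real (Suc (n j)) \<le> 4 / real (Suc j)" using n[of j] by (intro divide_left_mono) auto
      then show "norm (P (n j) (T \<cdot> y j) - g j *\<^sub>R y j) \<le> 4 / real (Suc j)" using res[of j] by linarith
    qed
    show False by (rule no_spectral_pollution[OF convex z[unfolded l] n y g_lim res_lim])
  qed
qed

end

section \<open>No tower of height zero\<close>

lemma cofinite_not_root: "p \<noteq> 0 \<Longrightarrow> \<forall>\<^sub>F t in cofinite. poly p (complex_of_real t) \<noteq> 0"
  using finite_vimageI[OF poly_roots_finite[of p] inj_of_real] by (simp add: vimage_def eventually_cofinite)

text \<open>Cross multiplied and up to finitely many t, so that roots of denominators do no harm.
  The polynomials are complex because the contradiction is found at the imaginary unit.\<close>

definition almost_rational :: "(real \<Rightarrow> real) \<Rightarrow> bool" where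
  "almost_rational \<phi> \<longleftrightarrow> (\<exists>p q. q \<noteq> 0 \<and>
    (\<forall>\<^sub>F t in cofinite. poly p (complex_of_real t) = complex_of_real (\<phi> t) * poly q (complex_of_real t)))"

lemma almost_rationalI:
  "\<lbrakk>q \<noteq> 0; \<forall>\<^sub>F t in cofinite. poly p (complex_of_real t) = complex_of_real (\<phi> t) * poly q (complex_of_real t)\<rbrakk>
    \<Longrightarrow> almost_rational \<phi>"
  unfolding almost_rational_def by blast

lemma almost_rationalE:
  assumes "almost_rational \<phi>"
  obtains p q where "q \<noteq> 0"
    "\<forall>\<^sub>F t in cofinite. poly p (complex_of_real t) = complex_of_real (\<phi> t) * poly q (complex_of_real t)"
  using assms unfolding almost_rational_def by blast

lemma almost_rational_affine: "almost_rational (\<lambda>t. a + t * b)"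
  by (rule almost_rationalI[of 1 "[:complex_of_real a, complex_of_real b:]"]) simp_all

lemma almost_rational_add:
  assumes "almost_rational \<phi>" "almost_rational \<psi>"
  shows "almost_rational (\<lambda>t. \<phi> t + \<psi> t)"
proof -
  obtain p q where 1: "q \<noteq> 0"
    "\<forall>\<^sub>F t in cofinite. poly p (complex_of_real t) = complex_of_real (\<phi> t) * poly q (complex_of_real t)"
    using assms(1) by (rule almost_rationalE)
  obtain p' q' where 2: "q' \<noteq> 0"
    "\<forall>\<^sub>F t in cofinite. poly p' (complex_of_real t) = complex_of_real (\<psi> t) * poly q' (complex_of_real t)"
    using assms(2) by (rule almost_rationalE)
  show ?thesis
  proof (rule almost_rationalI[of "q * q'" "p * q' + p' * q"])
    show "\<forall>\<^sub>F t in cofinite. poly (p * q' + p' * q) (of_real t) = complex_of_real (\<phi> t + \<psi> t) * poly (q * q') (of_real t)"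
      using 1(2) 2(2) by eventually_elim (simp add: algebra_simps)
  qed (use 1 2 in simp)
qed

lemma almost_rational_mult:
  assumes "almost_rational \<phi>" "almost_rational \<psi>"
  shows "almost_rational (\<lambda>t. \<phi> t * \<psi> t)"
proof -
  obtain p q where 1: "q \<noteq> 0"
    "\<forall>\<^sub>F t in cofinite. poly p (complex_of_real t) = complex_of_real (\<phi> t) * poly q (complex_of_real t)"
    using assms(1) by (rule almost_rationalE)
  obtain p' q' where 2: "q' \<noteq> 0"
    "\<forall>\<^sub>F t in cofinite. poly p' (complex_of_real t) = complex_of_real (\<psi> t) * poly q' (complex_of_real t)"
    using assms(2) by (rule almost_rationalE)
  show ?thesis
  proof (rule almost_rationalI[of "q * q'" "p * p'"])
    show "\<forall>\<^sub>F t in cofinite. poly (p * p') (of_real t) = complex_of_real (\<phi> t * \<psi> t) * poly (q * q') (of_real t)"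
      using 1(2) 2(2) by eventually_elim simp
  qed (use 1 2 in simp)
qed

lemma almost_rational_inverse:
  assumes "almost_rational \<phi>"
  shows "almost_rational (\<lambda>t. inverse (\<phi> t))"
proof -
  obtain p q where 1: "q \<noteq> 0"
    "\<forall>\<^sub>F t in cofinite. poly p (complex_of_real t) = complex_of_real (\<phi> t) * poly q (complex_of_real t)"
    using assms by (rule almost_rationalE)
  show ?thesis
  proof (cases "p = 0")
    \<comment> \<open>Here \<open>\<phi>\<close> vanishes almost everywhere, and so does its inverse, because \<open>inverse 0 = 0\<close>.\<close>
    case True
    show ?thesis
    proof (rule almost_rationalI[of 1 0])
      show "\<forall>\<^sub>F t in cofinite. poly 0 (of_real t) = complex_of_real (inverse (\<phi> t)) * poly 1 (of_real t)"
        using 1(2) cofinite_not_root[OF 1(1)] by eventually_elim (simp add: True)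
    qed simp
  next
    case False
    show ?thesis
    proof (rule almost_rationalI[OF False, of q])
      show "\<forall>\<^sub>F t in cofinite. poly q (of_real t) = complex_of_real (inverse (\<phi> t)) * poly p (of_real t)"
        using 1(2) cofinite_not_root[OF False] by eventually_elim simp
    qed
  qed
qed

lemma almost_rational_arith_val:
  fixes v :: "real \<Rightarrow> 'f \<Rightarrow> complex"
  assumes "\<And>f. f \<in> set_arith a \<Longrightarrow> \<exists>\<alpha> \<beta>. \<forall>t. v t f = \<alpha> + complex_of_real t * \<beta>"
  shows "almost_rational (\<lambda>t. arith_val (v t) a)"
  using assms
proof (induction a)
  case (ReEval f)
  then obtain \<alpha> \<beta> where "\<And>t. v t f = \<alpha> + complex_of_real t * \<beta>" by auto
  then show ?case using almost_rational_affine[of "Re \<alpha>" "Re \<beta>"] by simp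
next
  case (ImEval f)
  then obtain \<alpha> \<beta> where "\<And>t. v t f = \<alpha> + complex_of_real t * \<beta>" by auto
  then show ?case using almost_rational_affine[of "Im \<alpha>" "Im \<beta>"] by simp
next
  case (RatConst c)
  show ?case using almost_rational_affine[of "of_rat c" 0] by simp
next
  case (Add a b)
  have "almost_rational (\<lambda>t. arith_val (v t) a)" "almost_rational (\<lambda>t. arith_val (v t) b)"
    by (rule Add.IH; simp add: Add.prems)+
  from almost_rational_add[OF this] show ?case by simp
next
  case (Sub a b)
  have ab: "almost_rational (\<lambda>t. arith_val (v t) a)" "almost_rational (\<lambda>t. arith_val (v t) b)"
    by (rule Sub.IH; simp add: Sub.prems)+
  have "almost_rational (\<lambda>t. (-1 + t * 0) * arith_val (v t) b)"
    by (rule almost_rational_mult[OF almost_rational_affine ab(2)])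
  from almost_rational_add[OF ab(1) this] show ?case by simp
next
  case (Mul a b)
  have "almost_rational (\<lambda>t. arith_val (v t) a)" "almost_rational (\<lambda>t. arith_val (v t) b)"
    by (rule Mul.IH; simp add: Mul.prems)+
  from almost_rational_mult[OF this] show ?case by simp
next
  case (Div a b)
  have ab: "almost_rational (\<lambda>t. arith_val (v t) a)" "almost_rational (\<lambda>t. arith_val (v t) b)"
    by (rule Div.IH; simp add: Div.prems)+
  from almost_rational_mult[OF ab(1) almost_rational_inverse[OF ab(2)]] show ?case
    by (simp add: divide_inverse)
qed

text \<open>The order of vanishing at the imaginary unit is odd on one side and even on the other.\<close>

lemma sqrt_not_rational:
  assumes q: "q \<noteq> 0" and I: "infinite I"
    and eq: "\<And>t. t \<in> I \<Longrightarrow> complex_of_real (sqrt (1 + t\<^sup>2)) * poly q (of_real t) = poly p (of_real t)"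
  shows False
proof -
  let ?r = "[:1, 0, 1 :: complex:]"
  have "poly (?r * (q * q) - p * p) (complex_of_real t) = 0" if t: "t \<in> I" for t
  proof -
    have "1 + t\<^sup>2 \<ge> 0" by (simp add: add_nonneg_nonneg)
    then have "complex_of_real (sqrt (1 + t\<^sup>2)) * complex_of_real (sqrt (1 + t\<^sup>2)) = 1 + complex_of_real t * complex_of_real t"
      unfolding of_real_mult[symmetric] real_sqrt_mult_self by (simp add: power2_eq_square)
    then show ?thesis using eq[OF t, symmetric] by (simp add: algebra_simps)
  qed
  then have sub: "I \<subseteq> {t. poly (?r * (q * q) - p * p) (complex_of_real t) = 0}" by blast
  have "?r * (q * q) - p * p = 0"
  proof (rule ccontr)
    assume "?r * (q * q) - p * p \<noteq> 0"
    from cofinite_not_root[OF this] have "finite {t. poly (?r * (q * q) - p * p) (complex_of_real t) = 0}"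
      unfolding eventually_cofinite not_not .
    with sub I show False using finite_subset by metis
  qed
  then have pq: "p * p = ?r * (q * q)" by simp
  have r: "?r = [:- \<i>, 1:] * [:\<i>, 1:]" by simp
  have "order \<i> ?r = order \<i> [:- \<i>, 1:] + order \<i> [:\<i>, 1:]" unfolding r by (rule order_mult) simp
  also have "order \<i> [:- \<i>, 1:] = 1" using order_power_n_n[of \<i> 1] by simp
  also have "order \<i> [:\<i>, 1:] = 0" by (rule order_0I) simp
  finally have r1: "order \<i> ?r = 1" by simp
  have r0: "?r \<noteq> 0" by simp
  have p: "p \<noteq> 0"
  proof
    assume "p = 0"
    then have "?r * (q * q) = 0" using pq by simp
    then show False using q r0 by (metis mult_eq_0_iff)
  qed
  have "order \<i> p + order \<i> p = order \<i> (p * p)" using p by (simp add: order_mult)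
  also have "\<dots> = order \<i> ?r + order \<i> (q * q)" unfolding pq by (intro order_mult no_zero_divisors r0 q)
  also have "order \<i> (q * q) = order \<i> q + order \<i> q" using q by (simp add: order_mult)
  finally show False using r1 by presburger
qed

section \<open>Leaves of a program\<close>

primrec prog_leaf :: "bool list \<Rightarrow> 'f prog \<Rightarrow> ('f arith \<times> 'f arith) list option" where
  "prog_leaf [] p = (case p of Return es \<Rightarrow> Some es | IfLeq a b p q \<Rightarrow> None)"
| "prog_leaf (c # cs) p = (case p of Return es \<Rightarrow> None | IfLeq a b p q \<Rightarrow> prog_leaf cs (if c then p else q))"

text \<open>A leaf is addressed by its branch decisions, regardless of the comparisons that lead
  there. The addresses form a countable set although the tree is infinite.\<close>

lemma runs_prog_leaf:
  assumes "runs v p F out"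
  shows "\<exists>cs es. prog_leaf cs p = Some es \<and> out = map (\<lambda>(a, b). Complex (arith_val v a) (arith_val v b)) es \<and>
    (\<forall>(a, b)\<in>set es. set_arith a \<union> set_arith b \<subseteq> F)"
  using assms
proof induction
  case (Return es)
  show ?case by (intro exI[of _ "[]"] exI[of _ es]) auto
next
  case (Leq a b p F out q)
  then obtain cs es where "prog_leaf cs p = Some es" "out = map (\<lambda>(a, b). Complex (arith_val v a) (arith_val v b)) es"
    "\<forall>(a, b)\<in>set es. set_arith a \<union> set_arith b \<subseteq> F" by blast
  then show ?case by (intro exI[of _ "True # cs"] exI[of _ es]) auto
next
  case (Greater a b q F out p)
  then obtain cs es where "prog_leaf cs q = Some es" "out = map (\<lambda>(a, b). Complex (arith_val v a) (arith_val v b)) es"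
    "\<forall>(a, b)\<in>set es. set_arith a \<union> set_arith b \<subseteq> F" by blast
  then show ?case by (intro exI[of _ "False # cs"] exI[of _ es]) auto
qed

text \<open>The reals are uncountable, and countably many finite fibres have a countable
  union.\<close>

lemma infinite_fiber:
  fixes h :: "real \<Rightarrow> 'b::countable"
  shows "\<exists>b. infinite {t. h t = b}"
proof (rule ccontr)
  assume "\<not> ?thesis"
  then have "countable (\<Union>b. {t. h t = b})" by (intro countable_UN) (auto intro: countable_finite)
  moreover have "(\<Union>b. {t. h t = b}) = UNIV" by auto
  ultimately show False using uncountable_UNIV_real by simp
qed

text \<open>Infinitely many t end at one leaf, and its list of expressions is finite. So one
  expression equals sqrt (1 + t^2) for infinitely many t, although it is almost rational in
  t.\<close>

lemma no_exact_program:
  fixes S :: "real \<Rightarrow> 't"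
  assumes affine: "\<And>f. f \<in> \<Lambda> \<Longrightarrow> \<exists>\<alpha> \<beta>. \<forall>t. f (S t) = \<alpha> + complex_of_real t * \<beta>"
    and runs: "\<And>t. \<exists>F out. runs (\<lambda>f. f (S t)) p F out \<and> F \<subseteq> \<Lambda> \<and>
      complex_of_real (sqrt (1 + t\<^sup>2)) \<in> set out"
  shows False
proof -
  let ?I = "\<lambda>a. {t. set_arith a \<subseteq> \<Lambda> \<and> arith_val (\<lambda>f. f (S t)) a = sqrt (1 + t\<^sup>2)}"
  define good where "good t c \<longleftrightarrow> (\<exists>es. prog_leaf c p = Some es \<and> t \<in> (\<Union>a\<in>fst ` set es. ?I a))" for t c
  have ex: "\<exists>c. good t c" for t
  proof -
    obtain F out where r: "runs (\<lambda>f. f (S t)) p F out" "F \<subseteq> \<Lambda>" "complex_of_real (sqrt (1 + t\<^sup>2)) \<in> set out"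
      using runs by blast
    obtain cs es where l: "prog_leaf cs p = Some es"
        and out: "out = map (\<lambda>(a, b). Complex (arith_val (\<lambda>f. f (S t)) a) (arith_val (\<lambda>f. f (S t)) b)) es"
        and F: "\<forall>(a, b)\<in>set es. set_arith a \<union> set_arith b \<subseteq> F"
      using runs_prog_leaf[OF r(1)] by blast
    from r(3) obtain a b where ab: "(a, b) \<in> set es"
        "complex_of_real (sqrt (1 + t\<^sup>2)) = Complex (arith_val (\<lambda>f. f (S t)) a) (arith_val (\<lambda>f. f (S t)) b)"
      unfolding out by auto
    have "arith_val (\<lambda>f. f (S t)) a = sqrt (1 + t\<^sup>2)" using arg_cong[OF ab(2), of Re] by simp
    moreover have "set_arith a \<subseteq> \<Lambda>" using F ab(1) r(2) by blast
    ultimately have "t \<in> ?I a" by blast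
    moreover have "a \<in> fst ` set es" using ab(1) by (rule image_eqI[rotated]) simp
    ultimately show ?thesis unfolding good_def using l by blast
  qed
  define cs where "cs t = (SOME c. good t c)" for t
  have cs: "good t (cs t)" for t unfolding cs_def using ex by (rule someI_ex)
  obtain c where inf: "infinite {t. cs t = c}" using infinite_fiber[of cs] by blast
  then have "{t. cs t = c} \<noteq> {}" by (rule infinite_imp_nonempty)
  then obtain t0 where "cs t0 = c" by blast
  then obtain es where es: "prog_leaf c p = Some es" using cs[of t0] unfolding good_def by blast
  have "{t. cs t = c} \<subseteq> (\<Union>a\<in>fst ` set es. ?I a)"
  proof
    fix t assume "t \<in> {t. cs t = c}"
    then have "good t c" using cs[of t] by simp
    then obtain es' where "prog_leaf c p = Some es'" "t \<in> (\<Union>a\<in>fst ` set es'. ?I a)"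
      unfolding good_def by blast
    then show "t \<in> (\<Union>a\<in>fst ` set es. ?I a)" using es by simp
  qed
  then have "infinite (\<Union>a\<in>fst ` set es. ?I a)" using inf by (rule infinite_super)
  moreover have "finite (fst ` set es)" by simp
  ultimately obtain a where I: "infinite (?I a)" by blast
  then have "?I a \<noteq> {}" by (rule infinite_imp_nonempty)
  then have "\<exists>t. t \<in> ?I a" by (simp only: ex_in_conv simp_thms)
  then obtain t1 where "t1 \<in> ?I a" ..
  then have "set_arith a \<subseteq> \<Lambda> \<and> arith_val (\<lambda>f. f (S t1)) a = sqrt (1 + t1\<^sup>2)" by (rule CollectD)
  then have sub: "set_arith a \<subseteq> \<Lambda>" by (rule conjunct1)
  have "almost_rational (\<lambda>t. arith_val (\<lambda>f. f (S t)) a)"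
  proof (rule almost_rational_arith_val)
    fix f assume "f \<in> set_arith a"
    then have "f \<in> \<Lambda>" using sub by blast
    then show "\<exists>\<alpha> \<beta>. \<forall>t. f (S t) = \<alpha> + complex_of_real t * \<beta>" by (rule affine)
  qed
  then obtain P Q where Q: "Q \<noteq> 0" and ev: "\<forall>\<^sub>F t in cofinite.
      poly P (complex_of_real t) = complex_of_real (arith_val (\<lambda>f. f (S t)) a) * poly Q (complex_of_real t)"
    by (rule almost_rationalE)
  define E where "E = {t. poly P (complex_of_real t)
    \<noteq> complex_of_real (arith_val (\<lambda>f. f (S t)) a) * poly Q (complex_of_real t)}"
  have "finite E" using ev by (simp add: eventually_cofinite E_def)
  then have "infinite (?I a - E)" using I by (rule Diff_infinite_finite)
  moreover have "complex_of_real (sqrt (1 + t\<^sup>2)) * poly Q (complex_of_real t) = poly P (complex_of_real t)"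
    if "t \<in> ?I a - E" for t
  proof -
    have "arith_val (\<lambda>f. f (S t)) a = sqrt (1 + t\<^sup>2)" using that by blast
    moreover have "poly P (complex_of_real t)
        = complex_of_real (arith_val (\<lambda>f. f (S t)) a) * poly Q (complex_of_real t)"
      using that unfolding E_def by blast
    ultimately show ?thesis by (simp only:)
  qed
  ultimately show False by (rule sqrt_not_rational[OF Q])
qed

text \<open>For orthonormal x and y it vanishes on their orthogonal complement; on their span, trace
  0 and determinant -(1 + t^2) fix the eigenvalues, while it depends on t affinely.\<close>

definition rank_two :: "'h::complex_inner \<Rightarrow> 'h \<Rightarrow> real \<Rightarrow> 'h \<Rightarrow> 'h" where
  "rank_two x y t u = cinner u x *\<^sub>C (t *\<^sub>R x + y) + cinner u y *\<^sub>C (x - t *\<^sub>R y)"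

lemma bounded_symmetric_rank_two:
  "bounded_symmetric_on UNIV (rank_two x y t)
    (norm x * norm (t *\<^sub>R x + y) + norm y * norm (x - t *\<^sub>R y) + 1)"
proof
  fix u v :: 'a
  show "cinner (rank_two x y t u) v = cinner u (rank_two x y t v)"
    using cinner_commute[of u] cinner_commute[of x v] cinner_commute[of y v]
    by (simp add: rank_two_def cinner.add_left cinner.add_right cinner.diff_left cinner.diff_right
        cinner_scaleC_left cinner_scaleC_right cinner_scaleR_left cinner_scaleR_right algebra_simps)
  have "norm (rank_two x y t u) \<le> norm (cinner u x *\<^sub>C (t *\<^sub>R x + y)) + norm (cinner u y *\<^sub>C (x - t *\<^sub>R y))"
    unfolding rank_two_def by (rule norm_triangle_ineq)
  also have "\<dots> \<le> (norm u * norm x) * norm (t *\<^sub>R x + y) + (norm u * norm y) * norm (x - t *\<^sub>R y)"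
    unfolding norm_scaleC by (intro add_mono mult_right_mono cinner_Cauchy_Schwarz) auto
  also have "\<dots> \<le> (norm x * norm (t *\<^sub>R x + y) + norm y * norm (x - t *\<^sub>R y) + 1) * norm u"
    by (simp add: algebra_simps)
  finally show "norm (rank_two x y t u) \<le> (norm x * norm (t *\<^sub>R x + y) + norm y * norm (x - t *\<^sub>R y) + 1) * norm u" .
qed (auto simp: rank_two_def complex_vector.subspace_UNIV cinner.add_left scaleC_add_left
    cinner_scaleC_left scaleC_add_right scaleC_scaleC intro!: add_nonneg_pos)

lemma selfadjoint_bounded:
  fixes B :: "'h::chilbert_space \<Rightarrow> 'h"
  assumes "bounded_symmetric_on UNIV B C"
  shows "selfadjoint (\<lambda>u. Some (B u))"
proof -
  interpret B: bounded_symmetric_on UNIV B C by (rule assms)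
  have d: "dom (\<lambda>u. Some (B u)) = UNIV" by auto
  have "adjoint_oper (\<lambda>u. Some (B u)) y = Some (B y)" for y
  proof -
    have "(THE z. \<forall>x\<in>UNIV. cinner (B x) y = cinner x z) = B y"
    proof (rule the_equality)
      fix z assume z: "\<forall>x\<in>UNIV. cinner (B x) y = cinner x z"
      have "z - B y = 0"
        by (rule orthogonal_to_dense[of UNIV]) (use z B.sym in \<open>simp_all add: cinner.diff_right\<close>)
      then show "z = B y" by simp
    qed (use B.sym in simp)
    moreover have "\<exists>z. \<forall>x\<in>UNIV. cinner (B x) y = cinner x z" using B.sym by blast
    ultimately show ?thesis by (simp add: adjoint_oper_def d)
  qed
  then show ?thesis
    by (simp add: selfadjoint_def linear_oper_def densely_defined_def d complex_vector.subspace_UNIV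
        B.add B.scale fun_eq_iff)
qed

text \<open>By continuity the graph over a dense set is dense in the full graph, so density of the
  union of the \<open>H n\<close> is all that the core condition asks here.\<close>

lemma is_core_bounded:
  fixes B :: "'h::chilbert_space \<Rightarrow> 'h"
  assumes "bounded_symmetric_on UNIV B C" and D: "closure D = UNIV"
  shows "is_core D (\<lambda>u. Some (B u))"
proof -
  interpret B: bounded_symmetric_on UNIV B C by (rule assms(1))
  have B_lim: "(\<lambda>j. B (u j)) \<longlonglongrightarrow> B a" if u: "u \<longlonglongrightarrow> a" for u a
  proof (rule LIM_zero_cancel, rule Lim_null_comparison)
    show "\<forall>\<^sub>F j in sequentially. norm (B (u j) - B a) \<le> C * norm (u j - a)"
      using B.bound by (intro always_eventually allI) (simp add: B.diff[symmetric])
    show "(\<lambda>j. C * norm (u j - a)) \<longlonglongrightarrow> 0"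
      using tendsto_mult_right_zero[OF tendsto_norm_zero[OF LIM_zero[OF u]]] .
  qed
  have g: "Map.graph ((\<lambda>u. Some (B u)) |` D) = {(u, B u) |u. u \<in> D}"
    by (auto simp: Map.graph_def restrict_map_def split: if_splits)
  have g': "Map.graph (\<lambda>u. Some (B u)) = {(u, B u) |u. True}" by (auto simp: Map.graph_def)
  have "closure {(u, B u) |u. u \<in> D} = {(u, B u) |u. True}"
  proof (intro equalityI subsetI)
    fix z assume "z \<in> closure {(u, B u) |u. u \<in> D}"
    then obtain w where w: "\<And>j. w j \<in> {(u, B u) |u. u \<in> D}" and lim: "w \<longlonglongrightarrow> z"
      unfolding closure_sequential by blast
    have w': "snd (w j) = B (fst (w j))" for j using w[of j] by auto
    have "(\<lambda>j. snd (w j)) \<longlonglongrightarrow> B (fst z)" unfolding w' by (rule B_lim[OF tendsto_fst[OF lim]])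
    then have "snd z = B (fst z)" using tendsto_snd[OF lim] LIMSEQ_unique by blast
    then show "z \<in> {(u, B u) |u. True}" by (cases z) auto
  next
    fix z assume "z \<in> {(u, B u) |u. True}"
    then obtain a where z: "z = (a, B a)" by blast
    have "a \<in> closure D" using D by simp
    then obtain u where u: "\<And>j. u j \<in> D" "u \<longlonglongrightarrow> a" unfolding closure_sequential by blast
    have "(\<lambda>j. (u j, B (u j))) \<longlonglongrightarrow> z" unfolding z by (intro tendsto_Pair u(2) B_lim)
    then show "z \<in> closure {(u, B u) |u. u \<in> D}"
      unfolding closure_sequential using u(1) by (intro exI[of _ "\<lambda>j. (u j, B (u j))"]) auto
  qed
  then show ?thesis by (auto simp: is_core_def g g')
qed

text \<open>Finite rank maps weakly null sequences to norm null ones, and boundedness excludes both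
  infinite points. Only an inclusion holds in general, as the set is empty in finite dimension; it
  is convex in either case.\<close>

lemma ext_ess_spectrum_rank_two: "ext_ess_spectrum (\<lambda>u. Some (rank_two x y t u)) \<subseteq> {0}"
proof -
  let ?T = "\<lambda>u. Some (rank_two x y t u)"
  interpret B: bounded_symmetric_on UNIV "rank_two x y t"
    "norm x * norm (t *\<^sub>R x + y) + norm y * norm (x - t *\<^sub>R y) + 1"
    by (rule bounded_symmetric_rank_two)
  define C where "C = norm x * norm (t *\<^sub>R x + y) + norm y * norm (x - t *\<^sub>R y) + 1"
  have bd: "\<bar>Re (cinner (rank_two x y t u) u)\<bar> \<le> C * (norm u)\<^sup>2" for u
  proof -
    have "\<bar>Re (cinner (rank_two x y t u) u)\<bar> \<le> norm (rank_two x y t u) * norm u"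
      by (rule order_trans[OF abs_Re_le_cmod cinner_Cauchy_Schwarz])
    also have "\<dots> \<le> C * norm u * norm u" unfolding C_def by (intro mult_right_mono B.bound) auto
    finally show ?thesis by (simp add: power2_eq_square mult.assoc)
  qed
  have "oper_bdd_above ?T" unfolding oper_bdd_above_def
    using bd by (intro exI[of _ C]) (auto simp: abs_le_iff)
  moreover have "oper_bdd_below ?T" unfolding oper_bdd_below_def
  proof (intro exI[of _ "- C"] ballI)
    fix u show "- C * (norm u)\<^sup>2 \<le> Re (cinner (the (?T u)) u)" using bd[of u] by (simp add: abs_le_iff)
  qed
  moreover have "r = 0" if r: "complex_of_real r \<in> ess_spectrum2 ?T" for r
  proof -
    obtain u where u: "\<And>j. norm (u j) = 1" "weakly_null u"
        and lim: "(\<lambda>j. norm (rank_two x y t (u j) - complex_of_real r *\<^sub>C u j)) \<longlonglongrightarrow> 0"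
      using r unfolding ess_spectrum2_def by auto
    have "(\<lambda>j. rank_two x y t (u j)) \<longlonglongrightarrow> 0 *\<^sub>C (t *\<^sub>R x + y) + 0 *\<^sub>C (x - t *\<^sub>R y)"
      unfolding rank_two_def using u(2) unfolding weakly_null_def
      by (intro tendsto_add scaleC.tendsto tendsto_const) auto
    then have "(\<lambda>j. rank_two x y t (u j) - (rank_two x y t (u j) - complex_of_real r *\<^sub>C u j)) \<longlonglongrightarrow> 0 - 0"
      using lim by (intro tendsto_diff) (simp_all add: tendsto_norm_zero_iff)
    then have "(\<lambda>j. norm (complex_of_real r *\<^sub>C u j)) \<longlonglongrightarrow> 0" by (simp add: tendsto_norm_zero)
    then show "r = 0" by (simp add: norm_scaleC u(1) LIMSEQ_const_iff)
  qed
  ultimately show ?thesis by (auto simp: ext_ess_spectrum_def zero_ereal_def)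
qed

lemma sqrt_in_spectrum_rank_two:
  assumes xy: "cinner x x = 1" "cinner y y = 1" "cinner x y = 0"
  shows "complex_of_real (sqrt (1 + t\<^sup>2)) \<in> spectrum (\<lambda>u. Some (rank_two x y t u))"
proof -
  define s where "s = sqrt (1 + t\<^sup>2)"
  have "1 + t\<^sup>2 \<ge> 0" by (simp add: add_nonneg_nonneg)
  then have s2: "s * s = 1 + t * t" by (simp add: s_def power2_eq_square)
  \<comment> \<open>The first row of the matrix, t + (s - t) = s, dictates the coefficient; the
    second row then amounts to s^2 = 1 + t^2.\<close>
  define w where "w = x + (s - t) *\<^sub>R y"
  have yx: "cinner y x = 0" using cinner_commute[of y x] xy by simp
  have wx: "cinner w x = 1" by (simp add: w_def cinner.add_left cinner_scaleR_left xy yx)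
  have wy: "cinner w y = complex_of_real (s - t)" by (simp add: w_def cinner.add_left cinner_scaleR_left xy)
  have "rank_two x y t w = t *\<^sub>R x + y + (s - t) *\<^sub>R (x - t *\<^sub>R y)"
    unfolding rank_two_def wx wy by (simp only: scaleR_scaleC[symmetric] scaleC_one)
  also have "\<dots> = s *\<^sub>R x + (1 - (s - t) * t) *\<^sub>R y" by (simp add: algebra_simps)
  also have "1 - (s - t) * t = s * (s - t)" using s2 by (simp add: algebra_simps)
  also have "s *\<^sub>R x + (s * (s - t)) *\<^sub>R y = s *\<^sub>R w" by (simp add: w_def scaleR_add_right)
  finally have ev: "rank_two x y t w = complex_of_real s *\<^sub>C w" by (simp only: scaleR_scaleC)
  have w0: "w \<noteq> 0" using wx by auto
  have z: "rank_two x y t 0 = 0" by (simp add: rank_two_def)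
  have "\<not> inj_on (\<lambda>u. rank_two x y t u - complex_of_real s *\<^sub>C u) UNIV"
  proof
    assume "inj_on (\<lambda>u. rank_two x y t u - complex_of_real s *\<^sub>C u) UNIV"
    from inj_onD[OF this, of w 0] show False using ev w0 z by simp
  qed
  then show ?thesis unfolding s_def[symmetric] by (auto simp: spectrum_def resolvent_set_def bij_betw_def dom_def)
qed

lemma orthonormal_pair_exists:
  assumes "\<And>b. cspan {b} \<noteq> (UNIV :: 'h::complex_inner set)"
  obtains x y :: "'h::complex_inner" where "cinner x x = 1" "cinner y y = 1" "cinner x y = 0"
proof -
  have normalize: "cinner ((1 / norm v) *\<^sub>R v) ((1 / norm v) *\<^sub>R v) = 1" if "v \<noteq> 0" for v :: 'h
    using that by (simp add: cinner_self)
  \<comment> \<open>The span of the zero vector is trivial, so the case b = 0 provides a nonzero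
    vector.\<close>
  obtain v :: 'h where "v \<notin> cspan {0}" using assms by blast
  then have v: "v \<noteq> 0" using complex_vector.span_zero by metis
  define x where "x = (1 / norm v) *\<^sub>R v"
  have x: "cinner x x = 1" unfolding x_def by (rule normalize[OF v])
  obtain w where w: "w \<notin> cspan {x}" using assms by blast
  define u where "u = w - cinner w x *\<^sub>C x"
  have "u \<noteq> 0"
  proof
    assume "u = 0"
    then have "w = cinner w x *\<^sub>C x" by (simp add: u_def)
    moreover have "cinner w x *\<^sub>C x \<in> cspan {x}"
      by (intro complex_vector.span_scale complex_vector.span_base) simp
    ultimately show False using w by simp
  qed
  moreover have "cinner u x = 0" by (simp add: u_def cinner_diff_scaleC_left x)
  then have "cinner x u = 0" using cinner_commute[of x u] by simp
  ultimately show ?thesis using that[OF x normalize] by (simp add: cinner_scaleR_right)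
qed

context exhaustion
begin

text \<open>Without a limit the finite output would have to be the spectrum itself and contain sqrt
  (1 + t^2) for every member of the rank two family.\<close>

lemma no_tower_of_height_zero:
  assumes dim: "\<And>b. cspan {b} \<noteq> (UNIV :: 'h::chilbert_space set)"
  shows "\<not> tower_of_algorithms (Omega1 H) (Lambda1 k e) spectrum aw_metric set 0 \<Gamma>"
proof
  assume tower: "tower_of_algorithms (Omega1 H) (Lambda1 k e) spectrum aw_metric set 0 \<Gamma>"
  obtain x y :: 'h where xy: "cinner x x = 1" "cinner y y = 1" "cinner x y = 0"
    using orthonormal_pair_exists[OF dim] by blast
  define S where "S t = (\<lambda>u. Some (rank_two x y t u))" for t
  have S: "S t \<in> Omega1 H" for t
  proof -
    have "ereal_convex (ext_ess_spectrum (S t))"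
      unfolding ereal_convex_def
    proof (intro ballI)
      fix a b assume ab: "a \<in> ext_ess_spectrum (S t)" "b \<in> ext_ess_spectrum (S t)"
      then have "a = 0" "b = 0" using ext_ess_spectrum_rank_two[of x y t] by (auto simp: S_def)
      then show "{a..b} \<subseteq> ext_ess_spectrum (S t)" using ab by simp
    qed
    then show ?thesis
      using selfadjoint_bounded[OF bounded_symmetric_rank_two]
        is_core_bounded[OF bounded_symmetric_rank_two dense_Union_H]
      by (simp add: Omega1_def S_def)
  qed
  have \<Gamma>: "\<Gamma> [] T = spectrum T" if "T \<in> Omega1 H" for T
    using tower that by (simp add: tower_of_algorithms_def)
  have "arithmetic_algorithm (Omega1 H) (Lambda1 k e) aw_metric set (\<Gamma> [])"
    using tower by (simp add: tower_of_algorithms_def)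
  then obtain L p where L: "\<forall>T\<in>Omega1 H. finite (L T) \<and> L T \<subseteq> Lambda1 k e"
    and p: "\<forall>T\<in>Omega1 H. \<exists>F out. runs (\<lambda>f. f T) p F out \<and> F \<subseteq> L T \<and> \<Gamma> [] T = set out"
    unfolding arithmetic_algorithm_def by (elim conjE exE) (rule that)
  show False
  proof (rule no_exact_program[of "Lambda1 k e" S p])
    fix f assume "f \<in> Lambda1 k e"
    then obtain i j n where f: "f = matrix_entry e i j n" by (auto simp: Lambda1_def)
    have "f (S t) = (cinner (e n i) x * cinner y (e n j) + cinner (e n i) y * cinner x (e n j))
        + complex_of_real t * (cinner (e n i) x * cinner x (e n j) - cinner (e n i) y * cinner y (e n j))" for t
      by (simp add: f matrix_entry_def S_def rank_two_def cinner.add_left cinner.diff_left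
          cinner_scaleC_left cinner_scaleR_left algebra_simps)
    then show "\<exists>\<alpha> \<beta>. \<forall>t. f (S t) = \<alpha> + complex_of_real t * \<beta>" by blast
  next
    fix t
    obtain F out where r: "runs (\<lambda>f. f (S t)) p F out" "F \<subseteq> L (S t)" "\<Gamma> [] (S t) = set out"
      using bspec[OF p S[of t]] by blast
    have "complex_of_real (sqrt (1 + t\<^sup>2)) \<in> set out"
      using sqrt_in_spectrum_rank_two[OF xy, of t] by (simp only: r(3)[symmetric] \<Gamma>[OF S]) (simp only: S_def)
    moreover have "F \<subseteq> Lambda1 k e" using r(2) bspec[OF L S[of t]] by (rule order_trans[OF _ conjunct2])
    ultimately show "\<exists>F out. runs (\<lambda>f. f (S t)) p F out \<and> F \<subseteq> Lambda1 k e \<and>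
        complex_of_real (sqrt (1 + t\<^sup>2)) \<in> set out"
      using r(1) by (intro exI conjI)
  qed
qed

end

section \<open>The solvability complexity index\<close>

theorem theorem2p1:
  fixes H :: "nat \<Rightarrow> ('h::chilbert_space) set"
    and k :: "nat \<Rightarrow> nat"
    and e :: "nat \<Rightarrow> nat \<Rightarrow> 'h"
  assumes separable: "separable_space (euclidean :: 'h topology)"
    and dim_ge_2: "\<And>b. cspan {b} \<noteq> (UNIV :: 'h set)"
    and finite_dim: "\<And>n. finite_dim_subspace (H n)"
    and increasing: "\<And>n. H n \<subseteq> H (Suc n)"
    and strong_limit: "\<And>x. (\<lambda>n. orth_proj (H n) x) \<longlonglongrightarrow> x"
    and basis: "\<And>n. orthonormal_basis (H n) (k n) (e n)"
  shows "SCI_spectrum (Omega1 H) (Lambda1 k e) = 1"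
proof -
  interpret exhaustion H k e
    by unfold_locales (use finite_dim increasing strong_limit basis in \<open>auto simp: finite_dim_subspace_def\<close>)
  obtain v :: 'h where "v \<notin> cspan {0}" using dim_ge_2 by blast
  then have v: "v \<noteq> 0" using complex_vector.span_zero by metis
  \<comment> \<open>A tower of height one is evaluated at singleton lists only.\<close>
  define \<Gamma> where "\<Gamma> ns = approx_spectrum (hd ns)" for ns
  have "tower_of_algorithms (Omega1 H) (Lambda1 k e) spectrum aw_metric set 1 \<Gamma>"
    unfolding tower_of_algorithms_def
  proof (intro conjI allI impI ballI)
    fix ns :: "nat list"
    show "arithmetic_algorithm (Omega1 H) (Lambda1 k e) aw_metric set (\<Gamma> ns)"
      unfolding \<Gamma>_def by (rule arithmetic_algorithm_approx_spectrum)
  next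
    fix T assume T: "T \<in> Omega1 H"
    then interpret core_exhausted_oper H k e T
      by unfold_locales (auto simp: Omega1_def)
    have closed: "closed (approx_spectrum n T)" for n
      by (rule finite_imp_closed) (rule finite_approx_spectrum)
    have convex: "ereal_convex (ext_ess_spectrum T)" using T by (simp add: Omega1_def)
    have "limitin (mtopology_of aw_metric) (\<lambda>n. approx_spectrum n T) (spectrum T) sequentially"
      by (rule limitin_aw_metric[OF closed_spectrum spectrum_nonempty[OF v] closed
            approx_spectrum_inner approx_spectrum_outer[OF convex]])
    then show "iterated_limit aw_metric 1 (\<lambda>ns. \<Gamma> ns T) (spectrum T)"
      unfolding One_nat_def iterated_limit.simps
      by (intro exI[of _ "\<lambda>n. approx_spectrum n T"]) (simp add: \<Gamma>_def)
  qed
  then have "SCI_spectrum (Omega1 H) (Lambda1 k e) \<le> enat 1"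
    unfolding SCI_spectrum_def SCI_def by (intro Inf_lower) blast
  moreover have "1 \<le> SCI_spectrum (Omega1 H) (Lambda1 k e)"
    unfolding SCI_spectrum_def SCI_def
  proof (rule Inf_greatest)
    fix a assume "a \<in> {enat h |h. \<exists>\<Gamma>. tower_of_algorithms (Omega1 H) (Lambda1 k e) spectrum aw_metric set h \<Gamma>}"
    then obtain h \<Gamma>' where a: "a = enat h"
      and "tower_of_algorithms (Omega1 H) (Lambda1 k e) spectrum aw_metric set h \<Gamma>'" by blast
    then have "h \<noteq> 0" using no_tower_of_height_zero[OF dim_ge_2, of \<Gamma>'] by (cases "h = 0") simp_all
    then show "1 \<le> a" by (simp add: a one_enat_def)
  qed
  ultimately show ?thesis by (simp add: one_enat_def)
qed

end
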